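(* Let $1<p<\infty$ and let $I$ be an inner function. If $T$ is a bounded linear operator on $K_I^p$ that commutes with the compressed shift $S^I$, then there exists $\varphi\in H^\infty$ such that $T=T_\varphi^I$.
   Context: $\mathbb{D}$ is the open unit disc in $\mathbb{C}$ and $\mathbb{T}$ is the unit circle, with normalized Lebesgue measure. For $1\le p<\infty$, $H^p\subset L^p(\mathbb{T})$ is the Hardy space of functions with vanishing negative Fourier coefficients, identified with their holomorphic extensions to $\mathbb{D}$; $H^\infty$ is the space of bounded holomorphic functions on $\mathbb{D}$ (identified with their boundary values on $\mathbb{T}$). $H_0^p$ is the subspace of $H^p$ of functions vanishing at $0$, and $\overline{H_0^p}$ is the space of complex conjugates of functions in $H_0^p$. An inner function is $I\in H^\infty$ with $|I|=1$ a.e. on $\mathbb{T}$. For an inner function $I$ and $1<p<\infty$, $$K_I^p=H^p\cap I\,\overline{H_0^p},$$ a closed subspace of $H^p$ (the product and intersection being taken in $L^p(\mathbb{T})$). For $1<p<\infty$, $P_+:L^p(\mathbb{T})\to H^p$ is the Riesz projection (the bounded projection onto $H^p$ that annihilates $\overline{H_0^p}$), and $P_-=\mathrm{id}-P_+$. The map $P_I:H^p\to K_I^p$, $P_If=I\,P_-(\bar I f)$, is a bounded projection of $H^p$ onto $K_I^p$. The compressed shift $S^I$ on $K_I^p$ is $S^If=P_I(zf)$ for $f\in K_I^p$. For $\varphi\in H^\infty$, the compression $T_\varphi^I$ on $K_I^p$ is $T_\varphi^If=P_I(\varphi f)$ for $f\in K_I^p$. *)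

theory Defs
  imports "HOL-Complex_Analysis.Complex_Analysis" "HOL-Probability.Probability"
begin

text \<open>Normalized Lebesgue measure on the unit circle, as a Borel measure on the complex plane
  that is concentrated on the circle.\<close>

definition circle :: "complex measure" where
  "circle = distr (uniform_measure lborel {0..2 * pi}) borel cis"

lemma sets_circle [measurable_cong, simp]: "sets circle = sets borel"
  by (simp add: circle_def)

lemma prob_space_circle: "prob_space circle"
  unfolding circle_def
  by (intro prob_space.prob_space_distr prob_space_uniform_measure)
     (auto simp: uniform_measure_def intro!: borel_measurable_continuous_onI continuous_intros)

definition circle_fun_eq :: "(complex \<Rightarrow> complex) \<Rightarrow> (complex \<Rightarrow> complex) \<Rightarrow> bool" where
  "circle_fun_eq f g \<longleftrightarrow>
     f \<in> borel_measurable circle \<and> g \<in> borel_measurable circle \<and> (AE z in circle. f z = g z)"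

lemma part_equivp_circle_fun_eq: "part_equivp circle_fun_eq"
proof (rule part_equivpI)
  show "\<exists>f. circle_fun_eq f f"
    by (rule exI[of _ "\<lambda>_. 0"]) (simp add: circle_fun_eq_def)
  show "symp circle_fun_eq"
    by (auto simp: symp_def circle_fun_eq_def)
  show "transp circle_fun_eq"
    unfolding transp_def circle_fun_eq_def by (auto elim: AE_mp)
qed

text \<open>Values outside the unit circle do not matter, as the complement of the circle is a null set.\<close>

quotient_type circle_fun = "complex \<Rightarrow> complex" / partial: circle_fun_eq
  by (rule part_equivp_circle_fun_eq)

instantiation circle_fun :: comm_ring_1
begin

lift_definition zero_circle_fun :: circle_fun is "\<lambda>_. 0"
  by (simp add: circle_fun_eq_def)

lift_definition one_circle_fun :: circle_fun is "\<lambda>_. 1"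
  by (simp add: circle_fun_eq_def)

lift_definition plus_circle_fun :: "circle_fun \<Rightarrow> circle_fun \<Rightarrow> circle_fun" is "\<lambda>f g z. f z + g z"
  by (auto simp: circle_fun_eq_def)

lift_definition minus_circle_fun :: "circle_fun \<Rightarrow> circle_fun \<Rightarrow> circle_fun" is "\<lambda>f g z. f z - g z"
  by (auto simp: circle_fun_eq_def)

lift_definition uminus_circle_fun :: "circle_fun \<Rightarrow> circle_fun" is "\<lambda>f z. - f z"
  by (auto simp: circle_fun_eq_def)

lift_definition times_circle_fun :: "circle_fun \<Rightarrow> circle_fun \<Rightarrow> circle_fun" is "\<lambda>f g z. f z * g z"
  by (auto simp: circle_fun_eq_def)

instance
proof
  show "(0 :: circle_fun) \<noteq> 1"
  proof transfer
    interpret prob_space circle by (rule prob_space_circle)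
    show "\<not> circle_fun_eq (\<lambda>_. 0) (\<lambda>_. 1)"
      by (simp add: circle_fun_eq_def)
  qed
qed (transfer, auto simp: circle_fun_eq_def algebra_simps)+

end

lift_definition scale_fun :: "complex \<Rightarrow> circle_fun \<Rightarrow> circle_fun" is "\<lambda>c f z. c * f z"
  by (auto simp: circle_fun_eq_def)

lift_definition cnj_fun :: "circle_fun \<Rightarrow> circle_fun" is "\<lambda>f z. cnj (f z)"
  by (auto simp: circle_fun_eq_def intro!: measurable_compose[of _ _ borel cnj]
        borel_measurable_continuous_onI continuous_intros)

lift_definition id_fun :: circle_fun is "\<lambda>z. z"
  by (simp add: circle_fun_eq_def)

lift_definition unimodular :: "circle_fun \<Rightarrow> bool" is "\<lambda>f. AE z in circle. norm (f z) = 1"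
  by (auto simp: circle_fun_eq_def elim: AE_mp)

lift_definition fourier_coeff :: "circle_fun \<Rightarrow> int \<Rightarrow> complex"
  is "\<lambda>f n. LINT z|circle. f z * z powi (- n)"
proof (rule ext)
  fix f g :: "complex \<Rightarrow> complex" and n :: int
  assume fg: "circle_fun_eq f g"
  have [measurable]: "(\<lambda>z::complex. z powi (- n)) \<in> borel_measurable circle"
    by (cases "n \<ge> 0") (simp_all add: power_int_def)
  from fg have [measurable]: "f \<in> borel_measurable circle" "g \<in> borel_measurable circle"
    and ae: "AE z in circle. f z = g z"
    by (auto simp: circle_fun_eq_def)
  show "(LINT z|circle. f z * z powi (- n)) = (LINT z|circle. g z * z powi (- n))"
    by (rule integral_cong_AE) (use ae in auto)
qed

text \<open>The real exponent \<open>p\<close> is meant to satisfy \<open>1 \<le> p\<close>.\<close>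

lift_definition p_integrable :: "real \<Rightarrow> circle_fun \<Rightarrow> bool"
  is "\<lambda>p f. integrable circle (\<lambda>z. norm (f z) powr p)"
proof -
  fix p :: real and f g :: "complex \<Rightarrow> complex"
  assume fg: "circle_fun_eq f g"
  from fg have [measurable]: "f \<in> borel_measurable circle" "g \<in> borel_measurable circle"
    and ae: "AE z in circle. f z = g z"
    by (auto simp: circle_fun_eq_def)
  show "integrable circle (\<lambda>z. norm (f z) powr p) = integrable circle (\<lambda>z. norm (g z) powr p)"
    by (rule integrable_cong_AE) (use ae in auto)
qed

lift_definition Lp_norm :: "real \<Rightarrow> circle_fun \<Rightarrow> real"
  is "\<lambda>p f. (LINT z|circle. norm (f z) powr p) powr (1 / p)"
proof -
  fix p :: real and f g :: "complex \<Rightarrow> complex"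
  assume fg: "circle_fun_eq f g"
  from fg have [measurable]: "f \<in> borel_measurable circle" "g \<in> borel_measurable circle"
    and ae: "AE z in circle. f z = g z"
    by (auto simp: circle_fun_eq_def)
  have "(LINT z|circle. norm (f z) powr p) = (LINT z|circle. norm (g z) powr p)"
    by (rule integral_cong_AE) (use ae in auto)
  then show "(LINT z|circle. norm (f z) powr p) powr (1 / p) =
      (LINT z|circle. norm (g z) powr p) powr (1 / p)"
    by simp
qed

definition Lp :: "real \<Rightarrow> circle_fun set" where
  "Lp p = {f. p_integrable p f}"


definition Hp :: "real \<Rightarrow> circle_fun set" where
  "Hp p = {f \<in> Lp p. \<forall>n<0. fourier_coeff f n = 0}"

text \<open>For \<open>f \<in> Hp p\<close> the coefficients of negative index vanish, so on the open unit disc this power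
  series is the holomorphic (Poisson) extension of \<open>f\<close>.\<close>

definition hol_ext :: "circle_fun \<Rightarrow> complex \<Rightarrow> complex" where
  "hol_ext f w = (\<Sum>n. fourier_coeff f (int n) * w ^ n)"

definition Hp0 :: "real \<Rightarrow> circle_fun set" where
  "Hp0 p = {f \<in> Hp p. hol_ext f 0 = 0}"

lift_definition has_boundary_values :: "(complex \<Rightarrow> complex) \<Rightarrow> circle_fun \<Rightarrow> bool"
  is "\<lambda>F g. AE z in circle. ((\<lambda>r. F (of_real r * z)) \<longlongrightarrow> g z) (at_left (1::real))"
proof -
  fix F f g :: "complex \<Rightarrow> complex"
  let ?lim = "\<lambda>h z. ((\<lambda>r. F (of_real r * z)) \<longlongrightarrow> h z) (at_left (1::real))"
  assume "circle_fun_eq f g"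
  then have ae: "AE z in circle. f z = g z"
    by (simp add: circle_fun_eq_def)
  show "(AE z in circle. ?lim f z) = (AE z in circle. ?lim g z)"
  proof
    assume "AE z in circle. ?lim f z"
    with ae show "AE z in circle. ?lim g z" by eventually_elim simp
  next
    assume "AE z in circle. ?lim g z"
    with ae show "AE z in circle. ?lim f z" by eventually_elim simp
  qed
qed

text \<open>Bounded holomorphic functions on the disc have radial limits a.e. by Fatou's theorem;
  \<open>Hinf\<close> consists of these boundary functions.\<close>

definition Hinf :: "circle_fun set" where
  "Hinf = {g. \<exists>F. F holomorphic_on ball 0 1 \<and> bounded (F ` ball 0 1) \<and> has_boundary_values F g}"

definition inner_fun :: "circle_fun \<Rightarrow> bool" where
  "inner_fun I \<longleftrightarrow> I \<in> Hinf \<and> unimodular I"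


definition model_space :: "real \<Rightarrow> circle_fun \<Rightarrow> circle_fun set" where
  "model_space p I = Hp p \<inter> (\<lambda>g. I * cnj_fun g) ` Hp0 p"

text \<open>The projection of \<open>Lp p\<close> onto \<open>Hp p\<close> along the conjugates of \<open>Hp0 p\<close>. For \<open>1 < p\<close> the
  space \<open>Lp p\<close> is the direct sum of the two by M. Riesz' theorem, so the description is
  proper for every \<open>f \<in> Lp p\<close>.\<close>

definition riesz_proj :: "real \<Rightarrow> circle_fun \<Rightarrow> circle_fun" where
  "riesz_proj p f = (THE g. g \<in> Hp p \<and> f - g \<in> cnj_fun ` Hp0 p)"

definition riesz_proj_neg :: "real \<Rightarrow> circle_fun \<Rightarrow> circle_fun" where
  "riesz_proj_neg p f = f - riesz_proj p f"

definition model_proj :: "real \<Rightarrow> circle_fun \<Rightarrow> circle_fun \<Rightarrow> circle_fun" where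
  "model_proj p I f = I * riesz_proj_neg p (cnj_fun I * f)"

definition compressed_shift :: "real \<Rightarrow> circle_fun \<Rightarrow> circle_fun \<Rightarrow> circle_fun" where
  "compressed_shift p I f = model_proj p I (id_fun * f)"

definition compression :: "real \<Rightarrow> circle_fun \<Rightarrow> circle_fun \<Rightarrow> circle_fun \<Rightarrow> circle_fun" where
  "compression p I \<phi> f = model_proj p I (\<phi> * f)"

text \<open>The values of \<open>T\<close> outside \<open>V\<close> are irrelevant.\<close>

definition bounded_linear_op_on :: "real \<Rightarrow> circle_fun set \<Rightarrow> (circle_fun \<Rightarrow> circle_fun) \<Rightarrow> bool" where
  "bounded_linear_op_on p V T \<longleftrightarrow>
     (\<forall>f\<in>V. T f \<in> V) \<and>
     (\<forall>f\<in>V. \<forall>g\<in>V. T (f + g) = T f + T g) \<and>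
     (\<forall>c. \<forall>f\<in>V. T (scale_fun c f) = scale_fun c (T f)) \<and>
     (\<exists>C. \<forall>f\<in>V. Lp_norm p (T f) \<le> C * Lp_norm p f)"

end

(*
  Let psi be the image under T of the projection of the constant 1. Commutation with the compressed
  shift gives T (P_I u) = psi u - I h with h in H^p for every polynomial u. As P_I is bounded by
  M. Riesz' theorem, so is the form (u, y) |-> integral of conj(I) psi u y over the circle, with
  respect to the L^p norm of u and the L^q norm of y, for polynomials u, y with y(0) = 0. Writing
  F with F(0) = 0 as f g with |f|^p = |g|^q = |F| on the circle bounds the functional
  F |-> integral of conj(I) psi F by the L^1 norm of F. By Hahn-Banach it extends to the trigonometric
  polynomials, so some chi in L^infinity has the same coefficients of negative index as conj(I) psi,
  that is, conj(I) psi - chi is in H^p. Then phi = I chi is in H^infinity, psi - phi is in I H^p, and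
  T agrees with the compression by phi on projections of polynomials, which are dense.

  M. Riesz' theorem for p <= 2 comes from |w|^p <= A (Re w)^p - B Re (w^p) on the right half plane;
  the exponent p passes to 2 p by squaring. Functions in L^infinity are produced from their Fourier
  coefficients by Riesz-Fischer and by Fatou's theorem for Poisson integrals.
*)
theory Submission
  imports Defs "HOL-Computational_Algebra.Fundamental_Theorem_Algebra"
begin

section \<open>The circle measure\<close>

text \<open>The candidate psi lies only in H^p, so multiplication by it need not be bounded.
  Commutation controls psi modulo I H^p, and the compression sees only this class; finding a bounded
  representative is a problem of Nehari type, which is why a bound on products u y has to be
  upgraded to an L^1 bound on polynomials F. Estimates are mostly kept as integrals of p-th powers
  with multiplicative constants. So the bilinear bound has the additive form D int |u|^p + int |y|^q
  coming from Young's inequality. It is not homogeneous, but loses nothing after the factorization,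
  where both integrals are at most int |F|, whence the constant D + 1. Only polynomials are
  factored: removing a finite Blaschke product and taking a p-th root of a zero-free polynomial
  replaces outer functions. Likewise, a functional bounded in the L^1 norm is turned into a bounded
  function without duality of Lebesgue spaces: its values on truncated Poisson kernels bound a
  Poisson integral, and radial limits carry the bound to the circle.\<close>

lemma borel_measurable_cis [measurable]: "cis \<in> borel_measurable borel"
  by (intro borel_measurable_continuous_onI continuous_intros)

lemma borel_measurable_cnj [measurable (raw)]:
  "f \<in> borel_measurable M \<Longrightarrow> (\<lambda>x. cnj (f x)) \<in> borel_measurable M"
  by (rule measurable_compose[of f M borel cnj borel])
     (auto intro!: borel_measurable_continuous_onI continuous_intros)

lemma borel_measurable_power_int [measurable (raw)]:
  fixes f :: "'a \<Rightarrow> complex"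
  assumes [measurable]: "f \<in> borel_measurable M"
  shows "(\<lambda>x. f x powi n) \<in> borel_measurable M"
  by (cases "n \<ge> 0") (simp_all add: power_int_def)

lemma circle_eq_distr_density:
  "circle = distr (density lborel (\<lambda>t. ennreal (indicator {0..2*pi} t / (2*pi)))) borel cis"
proof -
  have "uniform_measure lborel {0..2*pi} =
      density lborel (\<lambda>t. ennreal (indicator {0..2*pi} t / (2*pi)))"
    unfolding uniform_measure_def
    by (intro density_cong)
       (auto simp: divide_ennreal ennreal_1[symmetric] simp del: ennreal_1 split: split_indicator)
  then show ?thesis by (simp add: circle_def)
qed

lemma integrable_circle_iff:
  fixes f :: "complex \<Rightarrow> 'a::{banach, second_countable_topology}"
  assumes [measurable]: "f \<in> borel_measurable borel"
  shows "integrable circle f \<longleftrightarrow> set_integrable lborel {0..2*pi} (\<lambda>t. f (cis t))"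
proof -
  have "integrable circle f \<longleftrightarrow>
      integrable lborel (\<lambda>t. (indicator {0..2*pi} t / (2*pi)) *\<^sub>R f (cis t))"
    unfolding circle_eq_distr_density
    by (simp add: integrable_distr_eq integrable_density)
  also have "\<dots> \<longleftrightarrow> integrable lborel (\<lambda>t. (1 / (2*pi)) *\<^sub>R (indicator {0..2*pi} t *\<^sub>R f (cis t)))"
    by simp
  also have "\<dots> \<longleftrightarrow> set_integrable lborel {0..2*pi} (\<lambda>t. f (cis t))"
    unfolding set_integrable_def 
    using integrable_scaleR_right[of "2*pi" lborel "\<lambda>t. (1 / (2*pi)) *\<^sub>R (indicator {0..2*pi} t *\<^sub>R f (cis t))"]
      integrable_scaleR_right[of "1 / (2*pi)" lborel "\<lambda>t. indicator {0..2*pi} t *\<^sub>R f (cis t)"] by auto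
  finally show ?thesis .
qed

lemma integral_circle_eq:
  fixes f :: "complex \<Rightarrow> 'a::{banach, second_countable_topology}"
  assumes [measurable]: "f \<in> borel_measurable borel"
  shows "integral\<^sup>L circle f = (1 / (2*pi)) *\<^sub>R (LINT t:{0..2*pi}|lborel. f (cis t))"
proof -
  have "integral\<^sup>L circle f =
      (LINT t|lborel. (indicator {0..2*pi} t / (2*pi)) *\<^sub>R f (cis t))"
    unfolding circle_eq_distr_density
    by (simp add: integral_distr integral_density)
  also have "\<dots> = (LINT t|lborel. (1 / (2*pi)) *\<^sub>R (indicator {0..2*pi} t *\<^sub>R f (cis t)))"
    by simp
  also have "\<dots> = (1 / (2*pi)) *\<^sub>R (LINT t:{0..2*pi}|lborel. f (cis t))"
    unfolding set_lebesgue_integral_def by (subst integral_scaleR_right) simp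
  finally show ?thesis .
qed

lemma AE_circle_iff:
  assumes "{z. P z} \<in> sets borel"
  shows "(AE z in circle. P z) \<longleftrightarrow> (AE t in lborel. t \<in> {0..2*pi} \<longrightarrow> P (cis t))"
  unfolding circle_eq_distr_density using assms
  by (subst AE_distr_iff) (auto simp: AE_density indicator_def)

lemma AE_circle_norm: "AE z in circle. norm z = 1"
  by (subst AE_circle_iff) auto

text \<open>\<open>AE_circle_iff\<close> asks for a Borel set \<open>{z. P z}\<close>, which is
  awkward for a statement about radial limits. Here the bad angles lie in a Borel null set already,
  and its preimage under a measurable argument function is a Borel null set for
  \<open>circle\<close>.\<close>

lemma AE_circleI:
  assumes "AE t in lborel. 0 < t \<and> t < 2*pi \<longrightarrow> P (cis t)"
  shows "AE z in circle. P z"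
proof -
  obtain N where N: "\<And>t. t \<notin> N \<Longrightarrow> 0 < t \<and> t < 2*pi \<longrightarrow> P (cis t)" "N \<in> null_sets lborel"
    by (rule AE_E3[OF assms]) auto
  \<comment> \<open>\<open>Arg2pi\<close> jumps along the nonnegative reals, so it is reset there;
    on the circle this touches only the point 1, which is null.\<close>
  define A :: "complex \<Rightarrow> real" where "A z = (if z \<in> - \<real>\<^sub>\<ge>\<^sub>0 then Arg2pi z else 0)" for z
  have "continuous_on (- \<real>\<^sub>\<ge>\<^sub>0) Arg2pi"
    by (intro continuous_at_imp_continuous_on ballI continuous_at_Arg2pi) auto
  then have A_meas [measurable]: "A \<in> borel_measurable borel"
    unfolding A_def by (intro borel_measurable_continuous_on_if) auto
  have A_cis: "A (cis t) = t" if "0 < t" "t < 2*pi" for t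
  proof -
    have "Arg2pi (cis t) = t"
      using that by (intro Arg2pi_unique[of 1]) (auto simp: cis_conv_exp)
    moreover from this have "cis t \<notin> \<real>\<^sub>\<ge>\<^sub>0"
      using that Arg2pi_eq_0[of "cis t"] by (auto simp: complex_nonneg_Reals_iff complex_is_Real_iff)
    ultimately show ?thesis by (simp add: A_def)
  qed
  have Nb [measurable]: "N \<in> sets borel" using N(2) by auto
  have "AE t in lborel. t \<notin> N"
    using N(2) by (rule AE_not_in)
  moreover have "AE t in lborel. t \<noteq> 0 \<and> t \<noteq> 2*pi"
    by (auto intro: AE_lborel_singleton)
  ultimately have "AE t in lborel. t \<in> {0..2*pi} \<longrightarrow> \<not> (A (cis t) \<in> N)"
  proof eventually_elim
    case (elim t)
    then show ?case using A_cis[of t] by auto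
  qed
  then have "AE z in circle. \<not> (A z \<in> N)"
    by (subst AE_circle_iff) auto
  moreover have "AE z in circle. z \<noteq> 1"
  proof (subst AE_circle_iff)
    have "AE t in lborel. t \<noteq> 0 \<and> t \<noteq> 2*pi"
      by (auto intro: AE_lborel_singleton)
    then show "AE t in lborel. t \<in> {0..2*pi} \<longrightarrow> cis t \<noteq> 1"
    proof eventually_elim
      case (elim t)
      show ?case
      proof (intro impI notI)
        assume *: "t \<in> {0..2*pi}" "cis t = 1"
        then have "t > 0" "t < 2*pi" using elim by auto
        from A_cis[OF this] * show False using \<open>t > 0\<close> by (simp add: A_def)
      qed
    qed
  qed auto
  moreover note AE_circle_norm
  ultimately show ?thesis
  proof eventually_elim
    case (elim z)
    obtain t where t: "z = cis t" "0 \<le> t" "t < 2*pi"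
      using that[of "Arg2pi z"] Arg2pi_eq[of z] Arg2pi_ge_0[of z] Arg2pi_lt_2pi[of z] elim(3)
      by (simp add: cis_conv_exp)
    with elim(2) have "t > 0" by (cases "t = 0") auto
    with t elim(1) A_cis[of t] N(1) show ?case by auto
  qed
qed

interpretation circle: prob_space circle
  by (rule prob_space_circle)

lemma space_circle [simp]: "space circle = UNIV"
  by (simp add: circle_def)

text \<open>Cauchy's integral formula at the centre. Measurability is a separate hypothesis because
  \<open>G\<close> is unconstrained off the closed disc, while \<open>circle\<close> is a measure on
  the whole plane.\<close>

lemma integral_circle_holomorphic:
  assumes "G holomorphic_on ball 0 1" "continuous_on (cball 0 1) G" 
    and [measurable]: "G \<in> borel_measurable borel"
  shows "integral\<^sup>L circle G = G 0"
proof -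
  have "((\<lambda>u. G u/(u-0)) has_contour_integral (2 * of_real pi * \<i> * G 0)) (circlepath 0 1)"
    using assms by (intro Cauchy_integral_circlepath) auto
  then have "((\<lambda>t. G (0 + 1 * cis t) / (0 + 1 * cis t - 0) * 1 * \<i> * cis t) 
      has_integral (2 * of_real pi * \<i> * G 0)) {0..2*pi}"
    unfolding circlepath_def
    by (subst (asm) has_contour_integral_part_circlepath_iff) auto
  then have *: "((\<lambda>t. G (cis t) * \<i>) has_integral (2 * of_real pi * G 0 * \<i>)) {0..2*pi}"
    by (simp add: field_simps)
  have "((\<lambda>t. G (cis t)) has_integral (2 * of_real pi * G 0)) {0..2*pi}"
    using has_integral_mult_left[OF *, of "- \<i>"] by (simp add: mult.assoc)
  moreover have "continuous_on {0..2*pi} (\<lambda>t. G (cis t))"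
    by (rule continuous_on_compose2[OF assms(2)]) (auto intro!: continuous_intros)
  then have "set_integrable lborel {0..2*pi} (\<lambda>t. G (cis t))"
    by (rule borel_integrable_atLeastAtMost')
  ultimately have "(LINT t:{0..2*pi}|lborel. G (cis t)) = 2 * of_real pi * G 0"
    using set_borel_integral_eq_integral(2) integral_unique by metis
  then show ?thesis
    by (subst integral_circle_eq) (simp_all add: scaleR_conv_of_real)
qed

lemma integrable_circle_bounded:
  fixes f :: "complex \<Rightarrow> 'a::{banach, second_countable_topology}"
  assumes "f \<in> borel_measurable borel" "AE z in circle. norm (f z) \<le> B"
  shows "integrable circle f"
  by (rule circle.integrable_const_bound[OF assms(2)]) (use assms in simp)

lemma integral_circle_powi: "(LINT z|circle. z powi n) = (if n = 0 then 1 else 0)"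
proof -
  have pos: "(LINT z|circle. z ^ m) = 0" if "m > 0" for m :: nat
    using that by (subst integral_circle_holomorphic) (auto intro!: holomorphic_intros continuous_intros)
  consider "n = 0" | "n > 0" | "n < 0" by linarith
  then show ?thesis
  proof cases
    case 1
    then show ?thesis by (simp add: circle.prob_space[simplified])
  next
    case 2
    then show ?thesis using pos[of "nat n"] by (simp add: power_int_def)
  next
    case 3
    have "(LINT z|circle. z powi n) = (LINT z|circle. cnj (z ^ nat (- n)))"
    proof (rule integral_cong_AE)
      show "AE z in circle. z powi n = cnj (z ^ nat (- n))"
        using AE_circle_norm
      proof eventually_elim
        case (elim z)
        then have "inverse z = cnj z"
          by (metis complex_mod_cnj inverse_unique complex_norm_square of_real_1 power_one)
        with 3 show ?case by (simp add: power_int_def)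
      qed
    qed auto
    also have "\<dots> = cnj (LINT z|circle. z ^ nat (- n))"
      by (rule Bochner_Integration.integral_cnj)
    also have "\<dots> = 0" using pos[of "nat (- n)"] 3 by simp
    finally show ?thesis using 3 by simp
  qed
qed

section \<open>Lebesgue's differentiation theorem on the line\<close>

text \<open>A downward closed subset of \<open>{0..d}\<close> is an interval from 0 to its supremum,
  up to the endpoint, which is null. The superlevel sets of a decreasing weight have exactly this
  shape.\<close>

lemma norm_integral_down_set_le:
  fixes k :: "real \<Rightarrow> complex"
  assumes k: "\<And>x. 0 \<le> x \<Longrightarrow> x \<le> d \<Longrightarrow> norm (LINT s:{0..x}|lborel. k s) \<le> e * x"
    and [measurable]: "A \<in> sets borel" and "A \<subseteq> {0..d}"
    and down: "\<And>x y. x \<in> A \<Longrightarrow> 0 \<le> y \<Longrightarrow> y \<le> x \<Longrightarrow> y \<in> A"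
    and [measurable]: "k \<in> borel_measurable borel"
  shows "norm (LINT s|lborel. indicator A s *\<^sub>R k s) \<le> e * (LINT s|lborel. indicator A s)"
proof (cases "A = {}")
  case True
  then show ?thesis by simp
next
  case False
  define x where "x = Sup A"
  have bdd: "bdd_above A" using assms(3) by (meson bdd_above_Icc bdd_above_mono)
  have x: "0 \<le> x" "x \<le> d"
    using False assms(3) unfolding x_def
    by (force intro: cSup_upper2[OF _ _ bdd], intro cSup_least, auto)
  have AE: "AE s in lborel. indicator A s = (indicator {0..x} s :: real)"
    using AE_lborel_singleton[of x]
  proof eventually_elim
    case (elim s)
    have "s \<le> x" if "s \<in> A" using that cSup_upper[OF _ bdd] by (auto simp: x_def)
    moreover have "s \<in> A" if "0 \<le> s" "s \<le> x"
    proof -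
      have "s < Sup A" using that elim by (auto simp: x_def)
      then obtain a where "a \<in> A" "s < a" using less_cSupE[OF _ False] by blast
      then show ?thesis using down[of a s] that by auto
    qed
    ultimately show ?case using assms(3) by (auto simp: indicator_def)
  qed
  have "(LINT s|lborel. indicator A s *\<^sub>R k s) = (LINT s:{0..x}|lborel. k s)"
    unfolding set_lebesgue_integral_def
    by (rule integral_cong_AE) (use AE in auto)
  moreover have "(LINT s|lborel. indicator A s) = (LINT s|lborel. indicator {0..x} s :: real)"
    by (rule integral_cong_AE) (use AE in auto)
  moreover have "(LINT s|lborel. indicator {0..x} s :: real) = x" using x by simp
  ultimately show ?thesis using k[OF x] by simp
qed

text \<open>Layer-cake replacement for an integration by parts: \<open>P\<close> is an average of indicators of
  intervals starting at \<open>0\<close>.\<close>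

lemma norm_integral_decreasing_weight_le:
  fixes k :: "real \<Rightarrow> complex" and P :: "real \<Rightarrow> real"
  assumes k: "\<And>x. 0 \<le> x \<Longrightarrow> x \<le> d \<Longrightarrow> norm (LINT s:{0..x}|lborel. k s) \<le> e * x"
    and int: "set_integrable lborel {0..d} k"
    and [measurable]: "k \<in> borel_measurable borel" "P \<in> borel_measurable borel"
    and P0: "\<And>x. 0 \<le> x \<Longrightarrow> x \<le> d \<Longrightarrow> 0 \<le> P x"
    and Pdec: "\<And>x y. 0 \<le> x \<Longrightarrow> x \<le> y \<Longrightarrow> y \<le> d \<Longrightarrow> P y \<le> P x"
  shows "norm (LINT s:{0..d}|lborel. P s *\<^sub>R k s) \<le> e * (LINT s:{0..d}|lborel. P s)"
proof -
  \<comment> \<open>\<open>lc s y\<close> indicates the region under the graph of \<open>P\<close>: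
    integrating over \<open>y\<close> returns \<open>P s\<close>, while for fixed \<open>y\<close>
    the set of \<open>s\<close> is downward closed, so that \<open>norm_integral_down_set_le\<close>
    applies after Fubini.\<close>
  define lc where "lc = (\<lambda>s y. indicator {0..d} s * (if 0 \<le> y \<and> y < P s then 1 else 0 :: real))"
  have lc_meas [measurable]: "case_prod lc \<in> borel_measurable (lborel \<Otimes>\<^sub>M lborel)"
    unfolding lc_def by measurable
  have lc_eq: "lc s y = indicator {0..d} s * indicator {0..<P s} y" for s y
    by (auto simp: lc_def indicator_def)
  have lc_int: "(LINT y|lborel. lc s y) = indicator {0..d} s * P s" for s
  proof -
    have "(LINT y|lborel. indicator {0..<P s} y :: real) = P s" if "0 \<le> P s"
      using that by simp
    then show ?thesis using P0[of s] unfolding lc_eq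
      by (cases "s \<in> {0..d}") (auto simp del: integral_indicator)
  qed
  have lc_integrable: "integrable lborel (lc s)" for s
    unfolding lc_eq
    by (intro integrable_mult_right, cases "0 \<le> P s") (auto simp: integrable_indicator_iff)
  have key: "integrable (lborel \<Otimes>\<^sub>M lborel) (\<lambda>(s, y). lc s y *\<^sub>R m s)"
    if [measurable]: "m \<in> borel_measurable borel" and m: "set_integrable lborel {0..d} m" for m :: "real \<Rightarrow> complex"
  proof (rule lborel_pair.Fubini_integrable)
    have "integrable lborel (\<lambda>s. P 0 * norm (indicator {0..d} s *\<^sub>R m s))"
      by (intro integrable_mult_right integrable_norm) (use m in \<open>simp add: set_integrable_def\<close>)
    then have "integrable lborel (\<lambda>s. (indicator {0..d} s * P s) * norm (m s))"
      by (rule Bochner_Integration.integrable_bound)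
         (use P0 Pdec[of 0] in \<open>auto intro!: AE_I2 mult_right_mono simp: indicator_def abs_mult\<close>)
    moreover have "(LINT y|lborel. norm (case (s, y) of (s, y) \<Rightarrow> lc s y *\<^sub>R m s)) = (indicator {0..d} s * P s) * norm (m s)" for s
    proof -
      have "(LINT y|lborel. norm (case (s, y) of (s, y) \<Rightarrow> lc s y *\<^sub>R m s)) = (LINT y|lborel. lc s y * norm (m s))"
        by (intro Bochner_Integration.integral_cong) (auto simp: lc_def)
      then show ?thesis by (simp add: lc_int)
    qed
    ultimately show "integrable lborel (\<lambda>s. LINT y|lborel. norm (case (s, y) of (s, y) \<Rightarrow> lc s y *\<^sub>R m s))"
      by (simp only:)
  qed (use lc_integrable in auto)
  have "(LINT s:{0..d}|lborel. P s *\<^sub>R k s) = (LINT s|lborel. LINT y|lborel. lc s y *\<^sub>R k s)"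
    unfolding set_lebesgue_integral_def
    by (intro Bochner_Integration.integral_cong refl) (simp add: lc_int lc_integrable)
  also have "\<dots> = (LINT y|lborel. LINT s|lborel. lc s y *\<^sub>R k s)"
    by (rule lborel_pair.Fubini_integral[symmetric, OF key[OF _ int]]) auto
  finally have 1: "(LINT s:{0..d}|lborel. P s *\<^sub>R k s) = (LINT y|lborel. LINT s|lborel. lc s y *\<^sub>R k s)" .
  have intr1: "integrable (lborel \<Otimes>\<^sub>M lborel) (\<lambda>(s, y). lc s y)"
  proof -
    have "set_integrable lborel {0..d} (\<lambda>_. 1 :: complex)"
      by (rule borel_integrable_atLeastAtMost') auto
    from integrable_norm[OF key[OF _ this]] show ?thesis
      by (simp add: case_prod_unfold lc_eq)
  qed
  have 2: "(LINT s:{0..d}|lborel. P s) = (LINT y|lborel. LINT s|lborel. lc s y)"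
  proof -
    have "(LINT s:{0..d}|lborel. P s) = (LINT s|lborel. LINT y|lborel. lc s y)"
      unfolding set_lebesgue_integral_def
      by (intro Bochner_Integration.integral_cong refl) (simp add: lc_int)
    also have "\<dots> = (LINT y|lborel. LINT s|lborel. lc s y)"
      by (rule lborel_pair.Fubini_integral[symmetric, OF intr1])
    finally show ?thesis .
  qed
  have 3: "norm (LINT s|lborel. lc s y *\<^sub>R k s) \<le> e * (LINT s|lborel. lc s y)" for y
  proof (cases "y \<ge> 0")
    case True
    have "norm (LINT s|lborel. indicator {s\<in>{0..d}. y < P s} s *\<^sub>R k s) \<le>
        e * (LINT s|lborel. indicator {s\<in>{0..d}. y < P s} s)"
      using Pdec by (intro norm_integral_down_set_le[OF k]) (auto intro: less_le_trans)
    moreover have "lc s y = indicator {s\<in>{0..d}. y < P s} s" for s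
      using True by (auto simp: lc_def indicator_def)
    ultimately show ?thesis by simp
  qed (simp add: lc_def)
  have "norm (LINT y|lborel. LINT s|lborel. lc s y *\<^sub>R k s) \<le>
      (LINT y|lborel. norm (LINT s|lborel. lc s y *\<^sub>R k s))"
    by (rule integral_norm_bound)
  also have "\<dots> \<le> (LINT y|lborel. e * (LINT s|lborel. lc s y))"
    using 3 lborel_pair.integrable_snd[OF key[OF _ int]] lborel_pair.integrable_snd[OF intr1]
    by (intro integral_mono) auto
  finally show ?thesis unfolding 1 2 by simp
qed

text \<open>One-sided and in integrated form, since this is the hypothesis on \<open>k\<close> in
  \<open>norm_integral_decreasing_weight_le\<close>, which is later used on each side of a point
  separately.\<close>

lemma Lebesgue_differentiation_right:
  fixes f :: "real \<Rightarrow> complex"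
  assumes f: "integrable lborel f" and [measurable]: "f \<in> borel_measurable borel"
  shows "AE t in lborel. \<forall>e>0. \<exists>d>0. \<forall>h. 0 \<le> h \<and> h < d \<longrightarrow>
    norm (LINT s:{0..h}|lborel. f (t + s) - f t) \<le> e * h"
proof -
  have si: "set_integrable lborel A f" if "A \<in> sets borel" for A
    unfolding set_integrable_def using that by (intro integrable_mult_indicator f) auto
  have "f integrable_on cbox a b" for a b
    using set_borel_integral_eq_integral(1)[OF si[of "cbox a b"]] by simp
  then obtain N where N: "negligible N" 
    "\<And>x e. \<lbrakk>x \<notin> N; 0 < e\<rbrakk> \<Longrightarrow> \<exists>d>0. \<forall>h. 0 < h \<and> h < d \<longrightarrow>
      norm (integral (cbox x (x + h *\<^sub>R One)) f /\<^sub>R h ^ DIM(real) - f x) < e"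
    using integrable_ccontinuous_explicit by metis
  have "AE t in lborel. t \<notin> N"
    using N(1) by (metis AE_completion_iff AE_not_in negligible_iff_null_sets lborel_eq_real AE_completion)
  then show ?thesis
  proof eventually_elim
    case (elim t)
    show ?case
    proof (intro allI impI)
      fix e :: real assume "e > 0"
      then obtain d where d: "d > 0" "\<And>h. 0 < h \<Longrightarrow> h < d \<Longrightarrow> 
          norm (integral {t..t + h} f /\<^sub>R h - f t) < e"
        using N(2)[OF elim, of e] by auto
      have "norm (LINT s:{0..h}|lborel. f (t + s) - f t) \<le> e * h" if h: "0 \<le> h" "h < d" for h
      proof (cases "h = 0")
        case True
        have "AE s in lborel. indicator {0} s *\<^sub>R (f (t + s) - f t) = 0"
          using AE_lborel_singleton[of "0::real"] by eventually_elim simp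
        then have "(LINT s:{0}|lborel. f (t + s) - f t) = 0"
          unfolding set_lebesgue_integral_def by (rule integral_eq_zero_AE)
        then show ?thesis using True by simp
      next
        case False
        with h have "h > 0" by simp
        have "(LINT s:{0..h}|lborel. f (t + s) - f t) = (LINT s:{0..h}|lborel. f (t + s)) - h *\<^sub>R f t"
        proof -
          have "set_integrable lborel {0..h} (\<lambda>s. f (t + s))"
            unfolding set_integrable_def using lborel_integrable_real_affine[OF f, of 1 t]
            by (intro integrable_mult_indicator) auto
          then show ?thesis
            using h by (subst set_integral_diff) (auto simp: set_integrable_def integrable_indicator_iff set_lebesgue_integral_def)
        qed
        also have "(LINT s:{0..h}|lborel. f (t + s)) = (LINT s:{t..t+h}|lborel. f s)"
          unfolding set_lebesgue_integral_def
          by (subst (2) lborel_integral_real_affine[of 1 _ t])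
             (auto intro!: Bochner_Integration.integral_cong simp: indicator_def)
        also have "\<dots> = integral {t..t+h} f"
          by (rule set_borel_integral_eq_integral(2)[OF si]) auto
        also have "integral {t..t+h} f - h *\<^sub>R f t = h *\<^sub>R (integral {t..t + h} f /\<^sub>R h - f t)"
          using \<open>h > 0\<close> by (simp add: scaleR_diff_right)
        finally show ?thesis
          using d(2)[OF \<open>h > 0\<close> h(2)] \<open>h > 0\<close> by (simp add: mult.commute)
      qed
      with d(1) show "\<exists>d>0. \<forall>h. 0 \<le> h \<and> h < d \<longrightarrow> norm (LINT s:{0..h}|lborel. f (t + s) - f t) \<le> e * h"
        by blast
    qed
  qed
qed

text \<open>The right-hand version for \<open>f (- x)\<close>, as \<open>lborel\<close> is invariant
  under reflection.\<close>

lemma Lebesgue_differentiation_left: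
  fixes f :: "real \<Rightarrow> complex"
  assumes f: "integrable lborel f" and [measurable]: "f \<in> borel_measurable borel"
  shows "AE t in lborel. \<forall>e>0. \<exists>d>0. \<forall>h. 0 \<le> h \<and> h < d \<longrightarrow>
    norm (LINT s:{0..h}|lborel. f (t - s) - f t) \<le> e * h"
proof -
  have "integrable lborel (\<lambda>x. f (- x))"
    using lborel_integrable_real_affine[OF f, of "-1" 0] by simp
  then have "AE t in lborel. \<forall>e>0. \<exists>d>0. \<forall>h. 0 \<le> h \<and> h < d \<longrightarrow>
    norm (LINT s:{0..h}|lborel. f (- (t + s)) - f (- t)) \<le> e * h"
    by (rule Lebesgue_differentiation_right) simp
  then have "AE t in distr lborel borel uminus. \<forall>e>0. \<exists>d>0. \<forall>h. 0 \<le> h \<and> h < d \<longrightarrow>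
    norm (LINT s:{0..h}|lborel. f (- (t + s)) - f (- t)) \<le> e * h"
    unfolding lborel_distr_uminus .
  then have "AE t in lborel. \<forall>e>0. \<exists>d>0. \<forall>h. 0 \<le> h \<and> h < d \<longrightarrow>
    norm (LINT s:{0..h}|lborel. f (- (- t + s)) - f (- (- t))) \<le> e * h"
    by (rule AE_distrD[rotated]) simp
  then show ?thesis by simp
qed

section \<open>The Poisson kernel and Fatou's theorem\<close>

text \<open>For zeta on the circle and \<open>w\<close> in the disc, the value at
  \<open>w * cnj zeta\<close> is the Poisson kernel of the point \<open>w\<close>, so a kernel of
  two variables is encoded by a function of one.\<close>

definition poisson_kernel :: "complex \<Rightarrow> real" where
  "poisson_kernel w = (1 - (norm w)\<^sup>2) / (norm (1 - w))\<^sup>2"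

lemma borel_measurable_poisson_kernel [measurable]: "poisson_kernel \<in> borel_measurable borel"
  unfolding poisson_kernel_def by measurable

lemma poisson_kernel_nonneg: "norm w \<le> 1 \<Longrightarrow> 0 \<le> poisson_kernel w"
  by (simp add: poisson_kernel_def power_le_one)

lemma poisson_kernel_eq_Re:
  assumes "norm w < 1"
  shows "poisson_kernel w = Re (2 / (1 - w) - 1)"
proof -
  have "w \<noteq> 1" using assms by auto
  have "2 / (1 - w) - 1 = (1 + w) / (1 - w)"
    using \<open>w \<noteq> 1\<close> by (simp add: field_simps)
  also have "Re \<dots> = poisson_kernel w"
    unfolding poisson_kernel_def cmod_power2 Re_divide
    by (rule arg_cong2[where f = "(/)"]) (simp_all add: power2_eq_square algebra_simps)
  finally show ?thesis by simp
qed

lemma poisson_kernel_cnj: "poisson_kernel (cnj w) = poisson_kernel w"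
  by (simp add: poisson_kernel_def) (metis complex_cnj_diff complex_cnj_one complex_mod_cnj)

lemma poisson_kernel_le:
  assumes "norm w \<le> r" "r < 1"
  shows "poisson_kernel w \<le> 1 / (1 - r)\<^sup>2"
proof -
  have "norm (1 - w) \<ge> 1 - r"
    using norm_triangle_ineq2[of 1 w] assms by simp
  then have "(1 - r)\<^sup>2 \<le> (norm (1 - w))\<^sup>2" using assms by (intro power_mono) auto
  moreover have "1 - (norm w)\<^sup>2 \<le> 1" by simp
  moreover have "0 < (1 - r)\<^sup>2" using assms by simp
  ultimately show ?thesis unfolding poisson_kernel_def
    by (intro frac_le) auto
qed

text \<open>On the circle the kernel is the real part of the function \<open>G\<close> of zeta,
  which is holomorphic on the closed disc because |w| < 1 and has \<open>G 0 = 1\<close>.\<close>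

lemma integral_poisson_kernel:
  assumes "norm w < 1"
  shows "(LINT \<zeta>|circle. poisson_kernel (w * cnj \<zeta>)) = 1"
proof -
  define G where "G = (\<lambda>\<zeta>. 2 / (1 - cnj w * \<zeta>) - 1)"
  have nz: "cnj w * \<zeta> \<noteq> 1" if "norm \<zeta> \<le> 1" for \<zeta>
  proof
    assume "cnj w * \<zeta> = 1"
    then have "norm w * norm \<zeta> = 1" by (metis complex_mod_cnj norm_mult norm_one)
    moreover have "norm w * norm \<zeta> \<le> norm w * 1" using that by (intro mult_left_mono) auto
    ultimately show False using assms by simp
  qed
  have [measurable]: "G \<in> borel_measurable borel" unfolding G_def by measurable
  have cont: "continuous_on (cball 0 1) G"
    unfolding G_def using nz by (auto intro!: continuous_intros)
  have "integral\<^sup>L circle G = G 0"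
    unfolding G_def using nz cont[unfolded G_def]
    by (intro integral_circle_holomorphic) (auto intro!: holomorphic_intros)
  have "bounded (G ` cball 0 1)"
    by (intro compact_imp_bounded compact_continuous_image cont) auto
  then obtain B where B: "\<And>z. norm z \<le> 1 \<Longrightarrow> norm (G z) \<le> B"
    by (metis bounded_iff imageI mem_cball_0)
  have "integrable circle G"
    by (rule integrable_circle_bounded[where B = B]) (use AE_circle_norm B in \<open>auto elim!: eventually_mono\<close>)
  then have "(LINT \<zeta>|circle. Re (G \<zeta>)) = Re (integral\<^sup>L circle G)"
    by simp
  also have "\<dots> = 1" using \<open>integral\<^sup>L circle G = G 0\<close> by (simp add: G_def)
  also have "(LINT \<zeta>|circle. Re (G \<zeta>)) = (LINT \<zeta>|circle. poisson_kernel (w * cnj \<zeta>))"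
  proof (rule integral_cong_AE)
    show "AE \<zeta> in circle. Re (G \<zeta>) = poisson_kernel (w * cnj \<zeta>)"
      using AE_circle_norm
    proof eventually_elim
      case (elim \<zeta>)
      have "poisson_kernel (cnj (cnj w * \<zeta>)) = Re (G \<zeta>)"
        unfolding poisson_kernel_cnj G_def using elim assms
        by (intro poisson_kernel_eq_Re) (simp add: norm_mult)
      then show ?case by simp
    qed
  qed auto
  finally show ?thesis .
qed

definition poisson :: "(complex \<Rightarrow> complex) \<Rightarrow> complex \<Rightarrow> complex" where
  "poisson f w = (LINT \<zeta>|circle. poisson_kernel (w * cnj \<zeta>) *\<^sub>R f \<zeta>)"

lemma AE_poisson_kernel_bound:
  assumes "norm w < 1"
  shows "AE \<zeta> in circle. 0 \<le> poisson_kernel (w * cnj \<zeta>) \<and> poisson_kernel (w * cnj \<zeta>) \<le> 1 / (1 - norm w)\<^sup>2"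
  using AE_circle_norm
  by eventually_elim (use assms in \<open>auto intro!: poisson_kernel_nonneg poisson_kernel_le simp: norm_mult\<close>)

lemma integrable_poisson_kernel_mult:
  fixes f :: "complex \<Rightarrow> 'a::{banach, second_countable_topology}"
  assumes "norm w < 1" "integrable circle f"
  shows "integrable circle (\<lambda>\<zeta>. poisson_kernel (w * cnj \<zeta>) *\<^sub>R f \<zeta>)"
proof (rule Bochner_Integration.integrable_bound)
  show "integrable circle (\<lambda>\<zeta>. (1 / (1 - norm w)\<^sup>2) *\<^sub>R f \<zeta>)"
    using assms by (intro integrable_scaleR_right)
  have [measurable]: "f \<in> borel_measurable circle" using assms by auto
  show "(\<lambda>\<zeta>. poisson_kernel (w * cnj \<zeta>) *\<^sub>R f \<zeta>) \<in> borel_measurable circle" by measurable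
  show "AE \<zeta> in circle. norm (poisson_kernel (w * cnj \<zeta>) *\<^sub>R f \<zeta>) \<le> norm ((1 / (1 - norm w)\<^sup>2) *\<^sub>R f \<zeta>)"
    using AE_poisson_kernel_bound[OF assms(1)]
  proof eventually_elim
    case (elim \<zeta>)
    have "norm (poisson_kernel (w * cnj \<zeta>) *\<^sub>R f \<zeta>) = poisson_kernel (w * cnj \<zeta>) * norm (f \<zeta>)"
      using elim by simp
    also have "\<dots> \<le> 1 / (1 - norm w)\<^sup>2 * norm (f \<zeta>)"
      using elim by (intro mult_right_mono) auto
    finally show ?case by simp
  qed
qed

section \<open>The kernel as a function of the angle\<close>

abbreviation poisson_angle :: "real \<Rightarrow> real \<Rightarrow> real" where
  "poisson_angle r x \<equiv> poisson_kernel (of_real r * cis x)"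

lemma poisson_angle_eq:
  "poisson_angle r x = (1 - r\<^sup>2) / (1 - 2 * r * cos x + r\<^sup>2)"
proof -
  have alg: "(1 - r * c)\<^sup>2 + (r * s)\<^sup>2 = 1 - 2 * r * c + r\<^sup>2 * (c\<^sup>2 + s\<^sup>2)" for c s :: real
    by (simp add: power2_eq_square algebra_simps)
  have "(norm (1 - of_real r * cis x))\<^sup>2 = (1 - r * cos x)\<^sup>2 + (r * sin x)\<^sup>2"
    by (simp add: cmod_power2)
  also have "\<dots> = 1 - 2 * r * cos x + r\<^sup>2 * ((cos x)\<^sup>2 + (sin x)\<^sup>2)"
    by (rule alg)
  finally show ?thesis by (simp add: poisson_kernel_def norm_mult)
qed

text \<open>The denominator at the angle \<open>d\<close> equals (r - cos d)^2 + (sin d)^2, so away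
  from angle 0 the kernel is O(1 - r^2).\<close>

lemma poisson_angle_outer:
  assumes r: "0 \<le> r" "r < 1" and d: "cos x \<le> cos d" "sin d \<noteq> 0"
  shows "poisson_angle r x \<le> (1 - r\<^sup>2) / (sin d)\<^sup>2"
proof -
  have "(sin d)\<^sup>2 \<le> (r - cos d)\<^sup>2 + (sin d)\<^sup>2" by simp
  also have "\<dots> = 1 - 2 * r * cos d + r\<^sup>2"
    using sin_cos_squared_add[of d] by (simp add: power2_eq_square algebra_simps)
  also have "\<dots> \<le> 1 - 2 * r * cos x + r\<^sup>2" using r d by (simp add: mult_left_mono)
  finally show ?thesis unfolding poisson_angle_eq
    using r d by (intro frac_le) (auto simp: power_le_one)
qed

lemma poisson_angle_antimono:
  assumes r: "0 \<le> r" "r < 1" and "0 \<le> x" "x \<le> y" "y \<le> pi"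
  shows "poisson_angle r y \<le> poisson_angle r x"
proof -
  have "cos y \<le> cos x" using assms by (intro cos_monotone_0_pi_le) auto
  then have 1: "r * cos y \<le> r * cos x" using r by (intro mult_left_mono)
  have "r * cos x \<le> r * 1" using r by (intro mult_left_mono) auto
  moreover have "0 < (1 - r)\<^sup>2" using r by simp
  moreover have "(1 - r)\<^sup>2 = 1 - 2 * r + r\<^sup>2" by (simp add: power2_eq_square algebra_simps)
  ultimately have "0 < 1 - 2 * r * cos x + r\<^sup>2" by simp
  then show ?thesis unfolding poisson_angle_eq using r 1
    by (intro frac_le) (auto simp: power_le_one)
qed

lemma set_integral_poisson_angle:
  assumes "0 \<le> r" "r < 1"
  shows "set_integrable lborel {0..2*pi} (poisson_angle r)"
    "(LINT x:{0..2*pi}|lborel. poisson_angle r x) = 2*pi"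
proof -
  have "integrable circle (\<lambda>\<zeta>. poisson_kernel (of_real r * cnj \<zeta>) *\<^sub>R (1::real))"
    by (rule integrable_poisson_kernel_mult) (use assms in auto)
  then have "set_integrable lborel {0..2*pi} (\<lambda>t. poisson_kernel (of_real r * cnj (cis t)))"
    by (subst (asm) integrable_circle_iff) auto
  moreover have eq: "poisson_kernel (of_real r * cnj (cis t)) = poisson_angle r t" for t
    by (metis complex_cnj_complex_of_real complex_cnj_mult poisson_kernel_cnj)
  ultimately show "set_integrable lborel {0..2*pi} (poisson_angle r)" by simp
  have "1 = (LINT \<zeta>|circle. poisson_kernel (of_real r * cnj \<zeta>))"
    by (rule integral_poisson_kernel[symmetric]) (use assms in auto)
  also have "\<dots> = (1 / (2*pi)) * (LINT t:{0..2*pi}|lborel. poisson_angle r t)"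
    by (subst integral_circle_eq) (auto simp: eq)
  finally show "(LINT x:{0..2*pi}|lborel. poisson_angle r x) = 2*pi"
    by (simp add: field_simps)
qed

text \<open>Here \<open>u\<close> stands for the deviation from the value at the point
  \<open>t\<close>, with the circle cut open so that this point sits at angle 0. Within distance
  \<open>d\<close> the kernel is a decreasing weight on either side, and smallness of
  \<open>u\<close> in the mean suffices; farther away the kernel itself tends to 0.\<close>

lemma poisson_at_differentiation_point:
  fixes u :: "real \<Rightarrow> complex"
  assumes u: "integrable lborel u" and [measurable]: "u \<in> borel_measurable borel"
    and supp: "\<And>x. x \<notin> {-t..2*pi - t} \<Longrightarrow> u x = 0" and t: "0 < t" "t < 2*pi"
    and R: "\<forall>e>0. \<exists>d>0. \<forall>h. 0 \<le> h \<and> h < d \<longrightarrow> norm (LINT s:{0..h}|lborel. u s) \<le> e * h"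
    and L: "\<forall>e>0. \<exists>d>0. \<forall>h. 0 \<le> h \<and> h < d \<longrightarrow> norm (LINT s:{0..h}|lborel. u (- s)) \<le> e * h"
  shows "((\<lambda>r. LINT x|lborel. poisson_angle r x *\<^sub>R u x) \<longlongrightarrow> 0) (at_left 1)"
proof (rule tendstoI)
  fix e0 :: real assume "e0 > 0"
  \<comment> \<open>The weight has integral at most 2 pi, so each side of the point contributes at
    most e * 2 pi = e0 / 4.\<close>
  define e where "e = e0 / (8 * pi)"
  have "e > 0" using \<open>e0 > 0\<close> by (simp add: e_def)
  obtain d1 where d1: "d1 > 0" "\<And>h. 0 \<le> h \<Longrightarrow> h < d1 \<Longrightarrow> norm (LINT s:{0..h}|lborel. u s) \<le> e * h"
    using R \<open>e > 0\<close> by blast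
  obtain d2 where d2: "d2 > 0" "\<And>h. 0 \<le> h \<Longrightarrow> h < d2 \<Longrightarrow> norm (LINT s:{0..h}|lborel. u (- s)) \<le> e * h"
    using L \<open>e > 0\<close> by blast
  \<comment> \<open>The halves make all comparisons strict. The bounds by \<open>t\<close> and
    \<open>2*pi - t\<close> keep the outer angles at distance more than \<open>d\<close> from the
    other multiples of 2 pi, where the kernel has peaks as well.\<close>
  define d where "d = Min {d1 / 2, d2 / 2, t / 2, (2*pi - t) / 2, pi / 2}"
  have d: "d > 0" "d < d1" "d < d2" "d < t" "d < 2*pi - t" "d < pi"
    using d1 d2 t by (auto simp: d_def min_def)
  have ui: "integrable lborel (\<lambda>x. u (- x))"
    using lborel_integrable_real_affine[OF u, of "-1" 0] by simp
  define K where "K = (LINT x|lborel. norm (u x)) / (sin d)\<^sup>2"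
  have "sin d > 0" using d by (intro sin_gt_zero) auto
  have bound: "norm (LINT x|lborel. poisson_angle r x *\<^sub>R u x) \<le> e0 / 2 + (1 - r\<^sup>2) * K"
    if r: "0 \<le> r" "r < 1" for r
  proof -
    have Pnn: "0 \<le> poisson_angle r x" for x
      using r by (intro poisson_kernel_nonneg) (simp add: norm_mult)
    have Pint: "integrable lborel (\<lambda>x. indicator A x *\<^sub>R (poisson_angle r x *\<^sub>R v x))" 
      if [measurable]: "A \<in> sets borel" "v \<in> borel_measurable borel" and v: "integrable lborel v" for A and v :: "real \<Rightarrow> complex"
    proof (intro integrable_mult_indicator)
      show "integrable lborel (\<lambda>x. poisson_angle r x *\<^sub>R v x)"
      proof (rule Bochner_Integration.integrable_bound)
        show "integrable lborel (\<lambda>x. (1 / (1 - r)\<^sup>2) *\<^sub>R v x)" by (intro integrable_scaleR_right v)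
        show "AE x in lborel. norm (poisson_angle r x *\<^sub>R v x) \<le> norm ((1 / (1 - r)\<^sup>2) *\<^sub>R v x)"
        proof (rule AE_I2)
          fix x
          have "poisson_angle r x \<le> 1 / (1 - r)\<^sup>2"
            using r by (intro poisson_kernel_le) (auto simp: norm_mult)
          from mult_right_mono[OF this norm_ge_zero[of "v x"]] Pnn[of x]
          show "norm (poisson_angle r x *\<^sub>R v x) \<le> norm ((1 / (1 - r)\<^sup>2) *\<^sub>R v x)" by simp
        qed
      qed auto
    qed auto
    define O' where "O' = - {- d..d}"
    have [measurable]: "O' \<in> sets borel" by (simp add: O'_def)
    have split: "indicator {0..d} x + indicator {-d..<0} x + indicator O' x = (1::real)" for x
      using d by (auto simp: O'_def indicator_def)
    have "(LINT x|lborel. poisson_angle r x *\<^sub>R u x) = 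
       (LINT x|lborel. (indicator {0..d} x *\<^sub>R (poisson_angle r x *\<^sub>R u x) + indicator {-d..<0} x *\<^sub>R (poisson_angle r x *\<^sub>R u x)) 
         + indicator O' x *\<^sub>R (poisson_angle r x *\<^sub>R u x))"
      by (intro Bochner_Integration.integral_cong refl) (simp only: split scaleR_one flip: scaleR_add_left)
    also have "\<dots> = (LINT x:{0..d}|lborel. poisson_angle r x *\<^sub>R u x) 
        + (LINT x|lborel. indicator {-d..<0} x *\<^sub>R (poisson_angle r x *\<^sub>R u x))
        + (LINT x|lborel. indicator O' x *\<^sub>R (poisson_angle r x *\<^sub>R u x))"
      unfolding set_lebesgue_integral_def using Pint[OF _ _ u]
      by (subst Bochner_Integration.integral_add; simp)+
    also have "(LINT x|lborel. indicator {-d..<0} x *\<^sub>R (poisson_angle r x *\<^sub>R u x)) = 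
        (LINT x|lborel. indicator {-d..<0} (- x) *\<^sub>R (poisson_angle r (- x) *\<^sub>R u (- x)))"
      by (subst lborel_integral_real_affine[of "-1" _ 0]) auto
    also have "\<dots> = (LINT x:{0..d}|lborel. poisson_angle r x *\<^sub>R u (- x))"
      unfolding set_lebesgue_integral_def
    proof (rule integral_cong_AE)
      show "AE x in lborel. indicator {-d..<0} (- x) *\<^sub>R (poisson_angle r (- x) *\<^sub>R u (- x)) = 
         indicator {0..d} x *\<^sub>R (poisson_angle r x *\<^sub>R u (- x))"
        using AE_lborel_singleton[of "0::real"]
        by eventually_elim (auto simp: indicator_def poisson_angle_eq)
    qed auto
    finally have eq: "(LINT x|lborel. poisson_angle r x *\<^sub>R u x) = 
        (LINT x:{0..d}|lborel. poisson_angle r x *\<^sub>R u x) + (LINT x:{0..d}|lborel. poisson_angle r x *\<^sub>R u (- x))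
        + (LINT x|lborel. indicator O' x *\<^sub>R (poisson_angle r x *\<^sub>R u x))" .
    have "(LINT x:{0..d}|lborel. poisson_angle r x) \<le> (LINT x:{0..2*pi}|lborel. poisson_angle r x)"
      unfolding set_lebesgue_integral_def
      using d Pnn set_integral_poisson_angle(1)[OF r] set_integrable_subset[OF set_integral_poisson_angle(1)[OF r], of "{0..d}"]
      by (intro integral_mono) (auto simp: set_integrable_def indicator_def)
    then have m: "e * (LINT x:{0..d}|lborel. poisson_angle r x) \<le> e * (2*pi)"
      using set_integral_poisson_angle(2)[OF r] \<open>e > 0\<close> by (intro mult_left_mono) auto
    have b1: "norm (LINT x:{0..d}|lborel. poisson_angle r x *\<^sub>R u x) \<le> e * (LINT x:{0..d}|lborel. poisson_angle r x)"
      using d d1 r Pnn u by (intro norm_integral_decreasing_weight_le)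
        (auto intro!: poisson_angle_antimono integrable_mult_indicator simp: set_integrable_def)
    have b2: "norm (LINT x:{0..d}|lborel. poisson_angle r x *\<^sub>R u (- x)) \<le> e * (LINT x:{0..d}|lborel. poisson_angle r x)"
      using d d2 r Pnn ui by (intro norm_integral_decreasing_weight_le)
        (auto intro!: poisson_angle_antimono integrable_mult_indicator simp: set_integrable_def)
    have "norm (LINT x|lborel. indicator O' x *\<^sub>R (poisson_angle r x *\<^sub>R u x)) \<le> (LINT x|lborel. norm (indicator O' x *\<^sub>R (poisson_angle r x *\<^sub>R u x)))"
      by (rule integral_norm_bound)
    also have "\<dots> \<le> (LINT x|lborel. ((1 - r\<^sup>2) / (sin d)\<^sup>2) * norm (u x))"
    proof (rule integral_mono)
      show "integrable lborel (\<lambda>x. norm (indicator O' x *\<^sub>R (poisson_angle r x *\<^sub>R u x)))"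
        using Pint[OF _ _ u] by (intro integrable_norm) simp
      fix x
      show "norm (indicator O' x *\<^sub>R (poisson_angle r x *\<^sub>R u x)) \<le> ((1 - r\<^sup>2) / (sin d)\<^sup>2) * norm (u x)"
      proof (cases "x \<in> O' \<and> x \<in> {-t..2*pi - t}")
        case True
        have "cos x = cos \<bar>x\<bar>" by (simp add: abs_if)
        also have "\<dots> \<le> cos d"
        proof (cases "\<bar>x\<bar> \<le> pi")
          case True' : True
          then show ?thesis using True d by (intro cos_monotone_0_pi_le) (auto simp: O'_def)
        next
          case False
          have "cos \<bar>x\<bar> = cos (2*pi - \<bar>x\<bar>)" by (simp add: cos_diff)
          also have "\<dots> \<le> cos d" using True d False by (intro cos_monotone_0_pi_le) auto
          finally show ?thesis .
        qed
        finally have "poisson_angle r x \<le> (1 - r\<^sup>2) / (sin d)\<^sup>2"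
          using r \<open>sin d > 0\<close> by (intro poisson_angle_outer) auto
        from mult_right_mono[OF this norm_ge_zero[of "u x"]] show ?thesis
          using True Pnn[of x] by simp
      next
        case False
        have "0 \<le> (1 - r\<^sup>2) / (sin d)\<^sup>2" using r by (simp add: power_le_one)
        from mult_nonneg_nonneg[OF this norm_ge_zero[of "u x"]] show ?thesis
          using False supp[of x] by (auto simp: O'_def simp del: times_divide_eq_left)
      qed
    qed (use u in auto)
    also have "\<dots> = (1 - r\<^sup>2) * K" by (simp add: K_def)
    finally have b3: "norm (LINT x|lborel. indicator O' x *\<^sub>R (poisson_angle r x *\<^sub>R u x)) \<le> (1 - r\<^sup>2) * K" .
    have "e * (2*pi) = e0 / 4" by (simp add: e_def)
    then show ?thesis unfolding eq
      using b1 b2 b3 m norm_triangle_ineq[of "(LINT x:{0..d}|lborel. poisson_angle r x *\<^sub>R u x) + (LINT x:{0..d}|lborel. poisson_angle r x *\<^sub>R u (- x))" "(LINT x|lborel. indicator O' x *\<^sub>R (poisson_angle r x *\<^sub>R u x))"]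
        norm_triangle_ineq[of "(LINT x:{0..d}|lborel. poisson_angle r x *\<^sub>R u x)" "(LINT x:{0..d}|lborel. poisson_angle r x *\<^sub>R u (- x))"]
      by linarith
  qed
  have "((\<lambda>r. e0 / 2 + (1 - r\<^sup>2) * K) \<longlongrightarrow> e0 / 2 + (1 - 1\<^sup>2) * K) (at_left (1::real))"
    by (intro tendsto_intros)
  from order_tendstoD(2)[OF this, of e0]
  have "eventually (\<lambda>r. e0 / 2 + (1 - r\<^sup>2) * K < e0) (at_left (1::real))"
    using \<open>e0 > 0\<close> by simp
  moreover have "eventually (\<lambda>r::real. 0 \<le> r \<and> r < 1) (at_left 1)"
    using eventually_at_left_real[of 0 1] by (auto elim!: eventually_mono)
  ultimately show "eventually (\<lambda>r. dist (LINT x|lborel. poisson_angle r x *\<^sub>R u x) 0 < e0) (at_left 1)"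
    by eventually_elim (use bound in \<open>force simp: dist_norm\<close>)
qed

text \<open>The kernel has mean 1, so the error at the point z is the kernel integrated against f -
  f(z). By Lebesgue's differentiation theorem, \<open>poisson_at_differentiation_point\<close>
  applies to it at almost every angle.\<close>

theorem Fatou_radial_limit:
  assumes f: "integrable circle f"
  shows "AE z in circle. ((\<lambda>r. poisson f (of_real r * z)) \<longlongrightarrow> f z) (at_left (1::real))"
proof (rule AE_circleI)
  have [measurable]: "f \<in> borel_measurable borel"
    using borel_measurable_integrable[OF f] by simp
  define g where "g t = indicator {0..2*pi} t *\<^sub>R f (cis t)" for t :: real
  have g: "integrable lborel g"
    using f unfolding g_def by (subst (asm) integrable_circle_iff) (auto simp: set_integrable_def)
  have [measurable]: "g \<in> borel_measurable borel" unfolding g_def by measurable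
  show "AE t in lborel. 0 < t \<and> t < 2*pi \<longrightarrow> ((\<lambda>r. poisson f (of_real r * cis t)) \<longlongrightarrow> f (cis t)) (at_left 1)"
    using Lebesgue_differentiation_right[OF g \<open>g \<in> _\<close>] Lebesgue_differentiation_left[OF g \<open>g \<in> _\<close>]
  proof (eventually_elim, safe)
    fix t :: real
    assume R: "\<forall>e>0. \<exists>d>0. \<forall>h. 0 \<le> h \<and> h < d \<longrightarrow> norm (LINT s:{0..h}|lborel. g (t + s) - g t) \<le> e * h"
      and L: "\<forall>e>0. \<exists>d>0. \<forall>h. 0 \<le> h \<and> h < d \<longrightarrow> norm (LINT s:{0..h}|lborel. g (t - s) - g t) \<le> e * h"
      and t: "0 < t" "t < 2*pi"
    \<comment> \<open>Translated so that the point has angle 0; the window of length 2 pi is one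
      full turn of the circle.\<close>
    define u where "u x = indicator {-t..2*pi - t} x *\<^sub>R (g (t + x) - g t)" for x
    have [measurable]: "u \<in> borel_measurable borel" unfolding u_def by measurable
    have uint: "integrable lborel u"
      unfolding u_def scaleR_diff_right using lborel_integrable_real_affine[OF g, of 1 t]
      by (intro Bochner_Integration.integrable_diff integrable_mult_indicator integrable_scaleR_left) (auto simp: integrable_indicator_iff)
    \<comment> \<open>The differentiation property involves small \<open>h\<close> only, so it
      survives the truncation to the window, which contains 0 in its interior.\<close>
    have local: "\<forall>e>0. \<exists>d>0. \<forall>h. 0 \<le> h \<and> h < d \<longrightarrow> norm (LINT s:{0..h}|lborel. v' s) \<le> e * h"
      if *: "\<forall>e>0. \<exists>d>0. \<forall>h. 0 \<le> h \<and> h < d \<longrightarrow> norm (LINT s:{0..h}|lborel. v s) \<le> e * h"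
       and eq: "\<And>s. 0 \<le> s \<Longrightarrow> s < min t (2*pi - t) \<Longrightarrow> v' s = v s" for v v' :: "real \<Rightarrow> complex"
    proof (intro allI impI)
      fix e :: real assume "e > 0"
      then obtain d where d: "d > 0" "\<And>h. 0 \<le> h \<Longrightarrow> h < d \<Longrightarrow> norm (LINT s:{0..h}|lborel. v s) \<le> e * h"
        using * by blast
      have "(LINT s:{0..h}|lborel. v' s) = (LINT s:{0..h}|lborel. v s)" if "h < min t (2*pi - t)" for h
        unfolding set_lebesgue_integral_def
        using that eq by (intro Bochner_Integration.integral_cong) (auto simp: indicator_def)
      then show "\<exists>d>0. \<forall>h. 0 \<le> h \<and> h < d \<longrightarrow> norm (LINT s:{0..h}|lborel. v' s) \<le> e * h"
        using d t by (intro exI[of _ "min d (min t (2*pi - t))"]) auto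
    qed
    have lim: "((\<lambda>r. LINT x|lborel. poisson_angle r x *\<^sub>R u x) \<longlongrightarrow> 0) (at_left 1)"
      using t by (intro poisson_at_differentiation_point[OF uint, of t] local[OF R] local[OF L]) (auto simp: u_def indicator_def)
    have eq: "poisson f (of_real r * cis t) = f (cis t) + (1 / (2*pi)) *\<^sub>R (LINT x|lborel. poisson_angle r x *\<^sub>R u x)"
      if r: "0 \<le> r" "r < 1" for r
    proof -
      let ?w = "of_real r * cis t"
      have w: "norm ?w < 1" using r by (simp add: norm_mult)
      have "poisson f ?w - f (cis t) = (LINT \<zeta>|circle. poisson_kernel (?w * cnj \<zeta>) *\<^sub>R f \<zeta>) - (LINT \<zeta>|circle. poisson_kernel (?w * cnj \<zeta>) *\<^sub>R f (cis t))"
        using integral_poisson_kernel[OF w] integrable_poisson_kernel_mult[OF w, of "\<lambda>_. 1::real"]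
        by (simp add: poisson_def)
      also have "\<dots> = (LINT \<zeta>|circle. poisson_kernel (?w * cnj \<zeta>) *\<^sub>R (f \<zeta> - f (cis t)))"
        unfolding scaleR_diff_right
        by (subst Bochner_Integration.integral_diff) (auto intro!: integrable_poisson_kernel_mult w f)
      also have "\<dots> = (1 / (2*pi)) *\<^sub>R (LINT s:{0..2*pi}|lborel. poisson_kernel (?w * cnj (cis s)) *\<^sub>R (f (cis s) - f (cis t)))"
        by (subst integral_circle_eq) auto
      also have "(LINT s:{0..2*pi}|lborel. poisson_kernel (?w * cnj (cis s)) *\<^sub>R (f (cis s) - f (cis t))) = (LINT x|lborel. poisson_angle r x *\<^sub>R u x)"
        unfolding set_lebesgue_integral_def
      proof (subst lborel_integral_real_affine[of 1 _ t], goal_cases)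
        case 2
        have "indicator {0..2*pi} (t + x) *\<^sub>R (poisson_kernel (?w * cnj (cis (t + x))) *\<^sub>R (f (cis (t + x)) - f (cis t)))
            = poisson_angle r x *\<^sub>R u x" for x
        proof -
          have eq: "?w * cnj (cis (t + x)) = cnj (of_real r * cis x)"
            by (simp add: cis_cnj cis_mult mult.assoc)
          show ?thesis
            unfolding eq poisson_kernel_cnj u_def g_def using t by (auto simp: indicator_def)
        qed
        then show ?case by simp
      qed auto
      finally show ?thesis by (simp add: algebra_simps)
    qed
    have "((\<lambda>r. f (cis t) + (1 / (2*pi)) *\<^sub>R (LINT x|lborel. poisson_angle r x *\<^sub>R u x)) \<longlongrightarrow> f (cis t) + (1 / (2*pi)) *\<^sub>R 0) (at_left 1)"
      by (intro tendsto_intros lim)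
    moreover have "eventually (\<lambda>r. f (cis t) + (1 / (2*pi)) *\<^sub>R (LINT x|lborel. poisson_angle r x *\<^sub>R u x) = poisson f (of_real r * cis t)) (at_left 1)"
      using eventually_at_left_real[of 0 1] by (auto elim!: eventually_mono simp: eq)
    ultimately have "((\<lambda>r. poisson f (of_real r * cis t)) \<longlongrightarrow> f (cis t) + (1 / (2*pi)) *\<^sub>R 0) (at_left 1)"
      by (rule Lim_transform_eventually)
    then show "((\<lambda>r. poisson f (of_real r * cis t)) \<longlongrightarrow> f (cis t)) (at_left 1)"
      by simp
  qed
qed

section \<open>Fourier coefficients\<close>

text \<open>The counterpart of \<open>fourier_coeff\<close> on representatives: the analysis takes
  place on functions, and classes reappear only through \<open>abs_circle_fun\<close>.\<close>

definition coef :: "(complex \<Rightarrow> complex) \<Rightarrow> int \<Rightarrow> complex" where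
  "coef f n = (LINT z|circle. f z * z powi (- n))"

lemma circle_measurable [simp]:
  "borel_measurable circle = borel_measurable borel" 
  by (rule measurable_cong_sets) auto

lemma integrable_circle_measurable:
  "integrable circle f \<Longrightarrow> f \<in> borel_measurable borel"
  using borel_measurable_integrable[of circle f] by simp

lemma integrable_circle_mult_bounded:
  fixes f g :: "complex \<Rightarrow> complex"
  assumes f: "integrable circle f" and [measurable]: "g \<in> borel_measurable borel"
    and g: "AE z in circle. norm (g z) \<le> B"
  shows "integrable circle (\<lambda>z. f z * g z)"
proof (rule Bochner_Integration.integrable_bound)
  note [measurable] = integrable_circle_measurable[OF f]
  show "integrable circle (\<lambda>z. of_real B * f z)" using f by (intro integrable_mult_right)
  show "(\<lambda>z. f z * g z) \<in> borel_measurable circle" by simp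
  show "AE z in circle. norm (f z * g z) \<le> norm (of_real B * f z)"
    using g
  proof eventually_elim
    case (elim z)
    have "norm (f z) * norm (g z) \<le> norm (f z) * \<bar>B\<bar>"
      using elim by (intro mult_left_mono) auto
    then show ?case by (simp add: norm_mult mult.commute)
  qed
qed

lemma AE_norm_powi: "AE z in circle. norm (z powi n) = 1"
  using AE_circle_norm by eventually_elim (simp add: norm_power_int)

lemma integrable_mult_powi:
  assumes "integrable circle f"
  shows "integrable circle (\<lambda>z. f z * z powi n)"
  by (rule integrable_circle_mult_bounded[OF assms, where B = 1])
     (use AE_norm_powi[of n] in \<open>auto elim: eventually_mono\<close>)

lemma norm_coef_le:
  assumes "integrable circle f"
  shows "norm (coef f n) \<le> (LINT z|circle. norm (f z))"
proof -
  have "norm (coef f n) \<le> (LINT z|circle. norm (f z * z powi (- n)))"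
    unfolding coef_def by (rule integral_norm_bound)
  also have "\<dots> = (LINT z|circle. norm (f z))"
    using integrable_circle_measurable[OF assms]
    by (intro integral_cong_AE) (use AE_norm_powi[of "- n"] in \<open>auto elim!: eventually_mono simp: norm_mult\<close>)
  finally show ?thesis .
qed

lemma coef_add:
  assumes "integrable circle f" "integrable circle g"
  shows "coef (\<lambda>z. f z + g z) n = coef f n + coef g n"
  using assms unfolding coef_def by (simp add: distrib_right integrable_mult_powi)

lemma coef_diff:
  assumes "integrable circle f" "integrable circle g"
  shows "coef (\<lambda>z. f z - g z) n = coef f n - coef g n"
  using assms unfolding coef_def by (simp add: left_diff_distrib integrable_mult_powi)

lemma coef_cmult: "coef (\<lambda>z. c * f z) n = c * coef f n"
  unfolding coef_def by (simp add: mult.assoc)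

lemma coef_cong_AE:
  assumes "f \<in> borel_measurable borel" "g \<in> borel_measurable borel" "AE z in circle. f z = g z"
  shows "coef f n = coef g n"
  unfolding coef_def by (rule integral_cong_AE) (use assms in auto)

lemma norm_1_cnj: "norm z = 1 \<Longrightarrow> cnj z = inverse (z::complex)"
  by (metis inverse_unique complex_norm_square of_real_1 power_one)

lemma coef_cnj:
  assumes "f \<in> borel_measurable borel"
  shows "coef (\<lambda>z. cnj (f z)) n = cnj (coef f (- n))"
proof -
  have "coef (\<lambda>z. cnj (f z)) n = (LINT z|circle. cnj (f z * z powi n))"
    unfolding coef_def
  proof (rule integral_cong_AE)
    show "AE z in circle. cnj (f z) * z powi (- n) = cnj (f z * z powi n)"
      using AE_circle_norm 
    proof eventually_elim
      case (elim z)
      have "cnj (z powi n) = cnj z powi n" by (simp add: power_int_def)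
      also have "\<dots> = z powi (- n)" using norm_1_cnj[OF elim] by (simp add: power_int_minus power_int_inverse)
      finally show ?case by simp
    qed
  qed (use assms in measurable)
  also have "\<dots> = cnj (coef f (- n))"
    unfolding coef_def by (simp del: complex_cnj_mult)
  finally show ?thesis .
qed

lemma coef_powi_mult:
  assumes "f \<in> borel_measurable borel"
  shows "coef (\<lambda>z. z powi k * f z) n = coef f (n - k)"
  unfolding coef_def
proof (rule integral_cong_AE)
  show "AE z in circle. z powi k * f z * z powi - n = f z * z powi - (n - k)"
    using AE_circle_norm
  proof eventually_elim
    case (elim z)
    then have "z \<noteq> 0" by auto
    then show ?case by (simp add: power_int_diff power_int_minus field_simps)
  qed
qed (use assms in measurable)

lemma coef_mult_z:
  assumes "f \<in> borel_measurable borel"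
  shows "coef (\<lambda>z. z * f z) n = coef f (n - 1)"
  using coef_powi_mult[OF assms, of 1 n] by simp

lemma coef_powi: "coef (\<lambda>z. z powi k) n = (if n = k then 1 else 0)"
proof -
  have "coef (\<lambda>z. z powi k * 1) n = coef (\<lambda>_. 1) (n - k)" by (rule coef_powi_mult) auto
  then show ?thesis by (simp add: coef_def integral_circle_powi)
qed

lemma coef_const: "coef (\<lambda>z. c) n = (if n = 0 then c else 0)"
  using coef_cmult[of c "\<lambda>z. z powi 0" n] coef_powi[of 0 n] by simp

section \<open>Polynomials on the circle\<close>

lemma bounded_poly_circle: "\<exists>B. \<forall>z. norm z = 1 \<longrightarrow> norm (poly u (z::complex)) \<le> B"
proof -
  have "compact (poly u ` sphere 0 1)"
    by (intro compact_continuous_image continuous_intros) auto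
  then show ?thesis by (metis bounded_iff compact_imp_bounded imageI mem_sphere_0)
qed

lemma borel_measurable_poly [measurable]: "poly (u::complex poly) \<in> borel_measurable borel"
  by (intro borel_measurable_continuous_onI continuous_intros)

lemma AE_bounded_poly: "\<exists>B. AE z in circle. norm (poly u z) \<le> B"
  using bounded_poly_circle[of u] AE_circle_norm by (auto elim!: eventually_mono)

lemma integrable_poly [simp]: "integrable circle (poly u)"
  using AE_bounded_poly[of u] by (auto intro: integrable_circle_bounded)

lemma coef_poly: "coef (poly u) n = (if n < 0 then 0 else coeff u (nat n))"
proof (induction u arbitrary: n)
  case 0
  then show ?case using coef_const[of 0 n] by simp
next
  case (pCons a u)
  have "integrable circle (\<lambda>z. z * poly u z)"
    using integrable_poly[of "pCons 0 u"] by (simp add: poly_pCons[abs_def])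
  moreover have eq: "poly (pCons a u) = (\<lambda>z. a + z * poly u z)" by (rule ext) simp
  ultimately have "coef (poly (pCons a u)) n = coef (\<lambda>z. a) n + coef (\<lambda>z. z * poly u z) n"
    unfolding eq by (subst coef_add) auto
  also have "\<dots> = (if n = 0 then a else 0) + coef (poly u) (n - 1)"
    by (simp add: coef_const coef_mult_z)
  finally show ?case
    by (auto simp: pCons.IH coeff_pCons nat_diff_distrib' split: nat.split simp del: poly_pCons)
qed

text \<open>On the circle 1 / (1 - w conj z) is the sum of the powers (w / z)^n. The L^1 norms of
  the terms form a geometric series, so summation and integration may be exchanged.\<close>

lemma geometric_sums_kernel:
  assumes f: "integrable circle f" and w: "norm w < 1"
  shows "(\<lambda>n. coef f (int n) * w ^ n) sums (LINT z|circle. f z / (1 - w * cnj z))"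
proof -
  note [measurable] = integrable_circle_measurable[OF f]
  define h where "h = (\<lambda>n z. f z * (z powi (- int n) * w ^ n))"
  have hint: "integrable circle (h n)" for n
    using integrable_mult_left[OF integrable_mult_powi[OF f], of "- int n" "w ^ n"]
    by (simp add: h_def mult.assoc)
  have "(\<lambda>n. integral\<^sup>L circle (h n)) sums (LINT z|circle. (\<Sum>n. h n z))"
  proof (rule sums_integral)
    show "AE z in circle. summable (\<lambda>n. norm (h n z))"
      using AE_circle_norm
    proof eventually_elim
      case (elim z)
      then have "norm (h n z) = norm (f z) * norm w ^ n" for n
        by (simp add: h_def norm_mult norm_power norm_power_int)
      then show ?case using w by (simp add: summable_geometric summable_mult)
    qed
    have "(LINT z|circle. norm (h n z)) = (LINT z|circle. norm (f z)) * norm w ^ n" for n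
    proof -
      have "(LINT z|circle. norm (h n z)) = (LINT z|circle. norm (f z) * norm w ^ n)"
        by (rule integral_cong_AE)
          (use AE_norm_powi[of "- int n"] in \<open>auto elim!: eventually_mono simp: h_def norm_mult norm_power\<close>)
      then show ?thesis by simp
    qed
    then show "summable (\<lambda>n. LINT z|circle. norm (h n z))"
      using w by (simp add: summable_geometric summable_mult)
  qed (rule hint)
  moreover have "integral\<^sup>L circle (h n) = coef f (int n) * w ^ n" for n
    by (simp add: h_def coef_def mult.assoc[symmetric])
  moreover have "(LINT z|circle. (\<Sum>n. h n z)) = (LINT z|circle. f z / (1 - w * cnj z))"
  proof (rule integral_cong_AE)
    show "AE z in circle. (\<Sum>n. h n z) = f z / (1 - w * cnj z)"
      using AE_circle_norm
    proof eventually_elim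
      case (elim z)
      have "h n z = f z * (w * cnj z) ^ n" for n
        unfolding h_def norm_1_cnj[OF elim] by (simp add: power_int_minus power_mult_distrib power_inverse)
      moreover have "norm (w * cnj z) < 1" using elim w by (simp add: norm_mult)
      ultimately show ?case
        by (simp add: suminf_mult summable_geometric suminf_geometric)
    qed
  qed (auto simp: h_def)
  ultimately show ?thesis by simp
qed

text \<open>On the circle the kernel is 1 / (1 - w conj z) + 1 / (1 - conj(w) z) - 1. The first term
  is expanded by \<open>geometric_sums_kernel\<close>, the second by the same lemma for conj f, and
  the -1 makes the coefficient of index 0 count once.\<close>

lemma poisson_sums:
  assumes f: "integrable circle f" and w: "norm w < 1"
  shows "(\<lambda>n. coef f (int n) * w ^ n + (if n = 0 then 0 else coef f (- int n) * cnj w ^ n)) sums poisson f w"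
proof -
  note [measurable] = integrable_circle_measurable[OF f]
  have "integrable circle (\<lambda>z. cnj (f z))" using f by simp
  from geometric_sums_kernel[OF this w]
  have "(\<lambda>n. cnj (coef f (- int n)) * w ^ n) sums (LINT z|circle. cnj (f z) / (1 - w * cnj z))"
    by (simp add: coef_cnj)
  then have "(\<lambda>n. cnj (cnj (coef f (- int n)) * w ^ n)) sums cnj (LINT z|circle. cnj (f z) / (1 - w * cnj z))"
    by (simp only: sums_cnj)
  then have B: "(\<lambda>n. coef f (- int n) * cnj w ^ n) sums (LINT z|circle. f z / (1 - cnj w * z))"
    by (simp flip: Bochner_Integration.integral_cnj)
  have C: "(\<lambda>n. if n = 0 then coef f 0 else 0) sums coef f 0"
    using sums_single[of 0 "\<lambda>_. coef f 0"] by simp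
  have nz: "norm (1 - w * cnj z) \<ge> 1 - norm w" "norm (1 - cnj w * z) \<ge> 1 - norm w" if "norm z = 1" for z
    using norm_triangle_ineq2[of 1 "w * cnj z"] norm_triangle_ineq2[of 1 "cnj w * z"] that by (simp_all add: norm_mult)
  have inv: "norm (inverse (1 - w * cnj z)) \<le> 1 / (1 - norm w)" "norm (inverse (1 - cnj w * z)) \<le> 1 / (1 - norm w)" if "norm z = 1" for z
    using nz[OF that] w by (auto simp: norm_divide inverse_eq_divide intro!: frac_le)
  have i1: "integrable circle (\<lambda>z. f z / (1 - w * cnj z))"
    unfolding divide_inverse
    by (rule integrable_circle_mult_bounded[OF f, where B = "1 / (1 - norm w)"])
       (use AE_circle_norm inv in \<open>auto elim!: eventually_mono\<close>)
  have i2: "integrable circle (\<lambda>z. f z / (1 - cnj w * z))"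
    unfolding divide_inverse
    by (rule integrable_circle_mult_bounded[OF f, where B = "1 / (1 - norm w)"])
       (use AE_circle_norm inv in \<open>auto elim!: eventually_mono\<close>)
  have "poisson f w = (LINT z|circle. f z / (1 - w * cnj z) + f z / (1 - cnj w * z) - f z)"
    unfolding poisson_def
  proof (rule integral_cong_AE)
    show "AE z in circle. poisson_kernel (w * cnj z) *\<^sub>R f z = f z / (1 - w * cnj z) + f z / (1 - cnj w * z) - f z"
      using AE_circle_norm
    proof eventually_elim
      case (elim z)
      have n1: "norm (w * cnj z) < 1" using elim w by (simp add: norm_mult)
      have "2 * of_real (Re (1 / (1 - w * cnj z))) = 1 / (1 - w * cnj z) + cnj (1 / (1 - w * cnj z))"
        using complex_add_cnj[of "1 / (1 - w * cnj z)"] by simp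
      then have "complex_of_real (poisson_kernel (w * cnj z)) = 1 / (1 - w * cnj z) + 1 / (1 - cnj w * z) - 1"
        unfolding poisson_kernel_eq_Re[OF n1] by (simp add: Re_divide)
      then show ?case unfolding scaleR_conv_of_real by (simp only:) (simp add: algebra_simps)
    qed
  qed auto
  also have "\<dots> = (LINT z|circle. f z / (1 - w * cnj z)) + (LINT z|circle. f z / (1 - cnj w * z)) - coef f 0"
    using i1 i2 f by (simp add: coef_def)
  finally have "(\<lambda>n. coef f (int n) * w ^ n + coef f (- int n) * cnj w ^ n - (if n = 0 then coef f 0 else 0)) sums poisson f w"
    using sums_diff[OF sums_add[OF geometric_sums_kernel[OF f w] B] C] by simp
  moreover have "coef f (int n) * w ^ n + coef f (- int n) * cnj w ^ n - (if n = 0 then coef f 0 else 0) =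
     coef f (int n) * w ^ n + (if n = 0 then 0 else coef f (- int n) * cnj w ^ n)" for n
    by auto
  ultimately show ?thesis by simp
qed

text \<open>All Poisson integrals vanish by \<open>poisson_sums\<close>, and \<open>f\<close> is
  recovered from them as a radial limit.\<close>

lemma Fourier_uniqueness:
  assumes f: "integrable circle f" and 0: "\<And>n. coef f n = 0"
  shows "AE z in circle. f z = 0"
  using Fatou_radial_limit[OF f] AE_circle_norm
proof eventually_elim
  case (elim z)
  have "poisson f (of_real r * z) = 0" if "0 < r" "r < 1" for r
  proof -
    have "norm (of_real r * z) < 1" using that elim by (simp add: norm_mult)
    from poisson_sums[OF f this] show ?thesis by (simp add: 0 sums_iff cong: if_cong)
  qed
  then have "eventually (\<lambda>r. poisson f (of_real r * z) = 0) (at_left 1)"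
    using eventually_at_left_real[of 0 1] by (auto elim: eventually_mono)
  then have "((\<lambda>r. poisson f (of_real r * z)) \<longlongrightarrow> 0) (at_left (1::real))"
    by (rule tendsto_eventually)
  then show ?case using elim tendsto_unique trivial_limit_at_left_real by blast
qed

section \<open>Poisson integrals in Lebesgue spaces\<close>

lemma powr_add_le:
  fixes a b :: real
  assumes "a \<ge> 0" "b \<ge> 0" "p \<ge> 0"
  shows "(a + b) powr p \<le> 2 powr p * (a powr p + b powr p)"
proof -
  have "(a + b) powr p \<le> (2 * max a b) powr p"
    using assms by (intro powr_mono2) auto
  also have "\<dots> = 2 powr p * (max a b) powr p"
    using assms by (simp add: powr_mult)
  also have "(max a b) powr p \<le> a powr p + b powr p"
    by (auto simp: max_def)
  finally show ?thesis by simp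
qed

lemma norm_add_powr_le:
  fixes a b :: "'a::real_normed_vector"
  assumes "p \<ge> 0"
  shows "norm (a + b) powr p \<le> 2 powr p * (norm a powr p + norm b powr p)"
proof -
  have "norm (a + b) powr p \<le> (norm a + norm b) powr p"
    using assms by (intro powr_mono2 norm_triangle_ineq) auto
  also have "\<dots> \<le> 2 powr p * (norm a powr p + norm b powr p)"
    using assms by (intro powr_add_le) auto
  finally show ?thesis .
qed

lemma norm_diff_powr_le:
  fixes a b :: "'a::real_normed_vector"
  assumes "p \<ge> 0"
  shows "norm (a - b) powr p \<le> 2 powr p * (norm a powr p + norm b powr p)"
  using norm_add_powr_le[OF assms, of a "- b"] by simp

text \<open>The function t^p lies above its tangent at \<open>s\<close>; this is Young's inequality
  for \<open>t\<close> and s^(p - 1).\<close>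

lemma powr_tangent:
  fixes s t p :: real
  assumes "p > 1" "s \<ge> 0" "t \<ge> 0"
  shows "p * s powr (p - 1) * t \<le> t powr p + (p - 1) * s powr p"
proof -
  define q where "q = p / (p - 1)"
  have q: "q > 1" "1 / p + 1 / q = 1" using assms by (auto simp: q_def field_simps)
  have "t * s powr (p - 1) \<le> t powr p / p + (s powr (p - 1)) powr q / q"
    using assms q by (intro Youngs_inequality) auto
  also have "(s powr (p - 1)) powr q = s powr p"
    using assms by (simp add: powr_powr q_def)
  finally have "p * (t * s powr (p - 1)) \<le> p * (t powr p / p + s powr p / q)"
    using assms by (intro mult_left_mono) auto
  also have "\<dots> = t powr p + (p - 1) * s powr p"
    using assms by (simp add: q_def field_simps)
  finally show ?thesis by (simp add: mult_ac)
qed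

text \<open>The tangent inequality at \<open>s\<close>, the modulus of the mean, is integrated
  against the probability density \<open>k\<close>.\<close>

lemma weighted_Jensen_powr:
  fixes f :: "'a \<Rightarrow> complex" and k :: "'a \<Rightarrow> real"
  assumes p: "p > 1" and k: "integrable M k" "AE x in M. 0 \<le> k x" "integral\<^sup>L M k = 1"
    and f: "integrable M (\<lambda>x. k x *\<^sub>R f x)" "integrable M (\<lambda>x. k x * norm (f x) powr p)"
  shows "norm (LINT x|M. k x *\<^sub>R f x) powr p \<le> (LINT x|M. k x * norm (f x) powr p)"
proof -
  define s where "s = norm (LINT x|M. k x *\<^sub>R f x)"
  have s: "s \<ge> 0" by (simp add: s_def)
  have "s \<le> (LINT x|M. norm (k x *\<^sub>R f x))"
    unfolding s_def by (rule integral_norm_bound)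
  then have "(p * s powr (p - 1)) * s \<le> (p * s powr (p - 1)) * (LINT x|M. norm (k x *\<^sub>R f x))"
    using p by (intro mult_left_mono) auto
  also have "\<dots> = (LINT x|M. (p * s powr (p - 1)) * norm (k x *\<^sub>R f x))"
    by simp
  also have "\<dots> \<le> (LINT x|M. k x * norm (f x) powr p + ((p - 1) * s powr p) * k x)"
  proof (rule integral_mono_AE)
    show "AE x in M. (p * s powr (p - 1)) * norm (k x *\<^sub>R f x) \<le> k x * norm (f x) powr p + ((p - 1) * s powr p) * k x"
      using k(2)
    proof eventually_elim
      case (elim x)
      have "k x * (p * s powr (p - 1) * norm (f x)) \<le> k x * (norm (f x) powr p + (p - 1) * s powr p)"
        using elim p s by (intro mult_left_mono powr_tangent) auto
      then show ?case using elim by (simp add: algebra_simps)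
    qed
  qed (use f k in \<open>auto intro!: integrable_norm Bochner_Integration.integrable_add integrable_mult_right simp del: norm_scaleR\<close>)
  also have "\<dots> = (LINT x|M. k x * norm (f x) powr p) + (p - 1) * s powr p"
    using f k by simp
  finally have "p * (s powr (p - 1) * s) \<le> (LINT x|M. k x * norm (f x) powr p) + (p - 1) * s powr p"
    by (simp add: mult.assoc)
  moreover have "s powr (p - 1) * s = s powr p"
    using s by (cases "s = 0") (auto simp: powr_diff)
  ultimately show ?thesis by (simp add: s_def algebra_simps)
qed

lemma integrable_of_powr:
  fixes f :: "complex \<Rightarrow> complex"
  assumes "p \<ge> 1" and [measurable]: "f \<in> borel_measurable borel"
    and "integrable circle (\<lambda>z. norm (f z) powr p)"
  shows "integrable circle f"
proof (rule Bochner_Integration.integrable_bound)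
  show "integrable circle (\<lambda>z. 1 + norm (f z) powr p)" using assms by auto
  have "norm (f z) \<le> 1 + norm (f z) powr p" for z
  proof (cases "norm (f z) \<le> 1")
    case True
    then show ?thesis by (simp add: add_increasing2)
  next
    case False
    then have "norm (f z) powr 1 \<le> norm (f z) powr p" using assms by (intro powr_mono) auto
    then show ?thesis using False by simp
  qed
  then show "AE z in circle. norm (f z) \<le> norm (1 + norm (f z) powr p)" by auto
qed auto

lemma integrable_powr_bounded:
  fixes f :: "complex \<Rightarrow> complex"
  assumes [measurable]: "f \<in> borel_measurable borel" and "AE z in circle. norm (f z) \<le> B" "p \<ge> 0"
  shows "integrable circle (\<lambda>z. norm (f z) powr p)"
  by (rule integrable_circle_bounded[where B = "B powr p"])
     (use assms in \<open>auto elim!: eventually_mono intro!: powr_mono2\<close>)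

lemma integrable_powr_add:
  fixes f g :: "complex \<Rightarrow> complex"
  assumes [measurable]: "f \<in> borel_measurable borel" "g \<in> borel_measurable borel" and "p \<ge> 0"
    and "integrable circle (\<lambda>z. norm (f z) powr p)" "integrable circle (\<lambda>z. norm (g z) powr p)"
  shows "integrable circle (\<lambda>z. norm (f z + g z) powr p)"
proof (rule Bochner_Integration.integrable_bound)
  show "integrable circle (\<lambda>z. 2 powr p * (norm (f z) powr p + norm (g z) powr p))"
    using assms by auto
qed (use norm_add_powr_le[OF \<open>p \<ge> 0\<close>] in auto)

lemma integral_powr_add_le:
  fixes f g :: "complex \<Rightarrow> complex"
  assumes [measurable]: "f \<in> borel_measurable borel" "g \<in> borel_measurable borel" and "p \<ge> 0"
    and "integrable circle (\<lambda>z. norm (f z) powr p)" "integrable circle (\<lambda>z. norm (g z) powr p)"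
  shows "(LINT z|circle. norm (f z + g z) powr p) \<le>
    2 powr p * ((LINT z|circle. norm (f z) powr p) + (LINT z|circle. norm (g z) powr p))"
proof -
  have "(LINT z|circle. norm (f z + g z) powr p) \<le> (LINT z|circle. 2 powr p * (norm (f z) powr p + norm (g z) powr p))"
    using assms norm_add_powr_le[OF \<open>p \<ge> 0\<close>] by (intro integral_mono integrable_powr_add) auto
  then show ?thesis using assms by simp
qed

lemma integrable_powr_diff:
  fixes f g :: "complex \<Rightarrow> complex"
  assumes "f \<in> borel_measurable borel" and [measurable]: "g \<in> borel_measurable borel" and "p \<ge> 0"
    and "integrable circle (\<lambda>z. norm (f z) powr p)" "integrable circle (\<lambda>z. norm (g z) powr p)"
  shows "integrable circle (\<lambda>z. norm (f z - g z) powr p)"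
  using integrable_powr_add[of f "\<lambda>z. - g z" p] assms by simp

lemma integral_powr_diff_le:
  fixes f g :: "complex \<Rightarrow> complex"
  assumes "f \<in> borel_measurable borel" and [measurable]: "g \<in> borel_measurable borel" and "p \<ge> 0"
    and "integrable circle (\<lambda>z. norm (f z) powr p)" "integrable circle (\<lambda>z. norm (g z) powr p)"
  shows "(LINT z|circle. norm (f z - g z) powr p) \<le>
    2 powr p * ((LINT z|circle. norm (f z) powr p) + (LINT z|circle. norm (g z) powr p))"
  using integral_powr_add_le[of f "\<lambda>z. - g z" p] assms by simp

lemma tendsto_integral_powr_bounded:
  fixes f :: "nat \<Rightarrow> complex \<Rightarrow> complex"
  assumes [measurable]: "\<And>n. f n \<in> borel_measurable borel" "g \<in> borel_measurable borel" and "p > 0"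
    and lim: "AE z in circle. (\<lambda>n. f n z) \<longlonglongrightarrow> g z" and B: "\<And>n. AE z in circle. norm (f n z) \<le> B"
  shows "(\<lambda>n. LINT z|circle. norm (f n z) powr p) \<longlonglongrightarrow> (LINT z|circle. norm (g z) powr p)"
proof (rule integral_dominated_convergence)
  show "integrable circle (\<lambda>_. B powr p)" by simp
  show "AE z in circle. (\<lambda>n. norm (f n z) powr p) \<longlonglongrightarrow> norm (g z) powr p"
    using lim by eventually_elim (use \<open>p > 0\<close> in \<open>auto intro!: tendsto_intros tendsto_powr'\<close>)
  show "AE z in circle. norm (norm (f n z) powr p) \<le> B powr p" for n
    using B[of n] by eventually_elim (use \<open>p > 0\<close> in \<open>auto intro!: powr_mono2\<close>)
qed auto

lemma borel_measurable_poisson [measurable]: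
  assumes [measurable]: "f \<in> borel_measurable borel"
  shows "poisson f \<in> borel_measurable borel"
proof -
  have "(\<lambda>(w, \<zeta>). poisson_kernel (w * cnj \<zeta>) *\<^sub>R f \<zeta>) \<in> borel_measurable (borel \<Otimes>\<^sub>M circle)"
    by measurable
  then show ?thesis unfolding poisson_def[abs_def]
    by (rule circle.borel_measurable_lebesgue_integral)
qed

lemma norm_poisson_le_max:
  assumes "norm w < 1" "AE \<zeta> in circle. norm (f \<zeta>) \<le> B" and [measurable]: "f \<in> borel_measurable borel"
  shows "norm (poisson f w) \<le> B"
proof -
  have f: "integrable circle f" using assms by (intro integrable_circle_bounded[of f B]) auto
  have "norm (poisson f w) \<le> (LINT \<zeta>|circle. norm (poisson_kernel (w * cnj \<zeta>) *\<^sub>R f \<zeta>))"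
    unfolding poisson_def by (rule integral_norm_bound)
  also have "\<dots> \<le> (LINT \<zeta>|circle. poisson_kernel (w * cnj \<zeta>) * B)"
  proof (rule integral_mono_AE)
    show "integrable circle (\<lambda>\<zeta>. norm (poisson_kernel (w * cnj \<zeta>) *\<^sub>R f \<zeta>))"
      by (intro integrable_norm integrable_poisson_kernel_mult assms f)
    show "integrable circle (\<lambda>\<zeta>. poisson_kernel (w * cnj \<zeta>) * B)"
      using integrable_poisson_kernel_mult[OF assms(1), of "\<lambda>_. B"] by simp
    show "AE \<zeta> in circle. norm (poisson_kernel (w * cnj \<zeta>) *\<^sub>R f \<zeta>) \<le> poisson_kernel (w * cnj \<zeta>) * B"
      using AE_poisson_kernel_bound[OF assms(1)] assms(2)
      by eventually_elim (auto intro!: mult_left_mono)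
  qed
  also have "\<dots> = B" using integral_poisson_kernel[OF assms(1)] by simp
  finally show ?thesis .
qed

lemma norm_poisson_le_integral:
  assumes w: "norm w < 1" "norm w \<le> r" "r < 1" and f: "integrable circle f"
  shows "norm (poisson f w) \<le> (LINT \<zeta>|circle. norm (f \<zeta>)) / (1 - r)\<^sup>2"
proof -
  have "norm (poisson f w) \<le> (LINT \<zeta>|circle. norm (poisson_kernel (w * cnj \<zeta>) *\<^sub>R f \<zeta>))"
    unfolding poisson_def by (rule integral_norm_bound)
  also have "\<dots> \<le> (LINT \<zeta>|circle. 1 / (1 - r)\<^sup>2 * norm (f \<zeta>))"
  proof (rule integral_mono_AE)
    show "integrable circle (\<lambda>\<zeta>. norm (poisson_kernel (w * cnj \<zeta>) *\<^sub>R f \<zeta>))"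
      by (intro integrable_norm integrable_poisson_kernel_mult w f)
    show "AE \<zeta> in circle. norm (poisson_kernel (w * cnj \<zeta>) *\<^sub>R f \<zeta>) \<le> 1 / (1 - r)\<^sup>2 * norm (f \<zeta>)"
      using AE_circle_norm
    proof eventually_elim
      case (elim \<zeta>)
      have "0 \<le> poisson_kernel (w * cnj \<zeta>)" "poisson_kernel (w * cnj \<zeta>) \<le> 1 / (1 - r)\<^sup>2"
        using w elim by (auto intro!: poisson_kernel_nonneg poisson_kernel_le simp: norm_mult)
      then show ?case by (simp only: norm_scaleR abs_of_nonneg) (rule mult_right_mono, auto)
    qed
  qed (use f in auto)
  finally show ?thesis by simp
qed

text \<open>For real r, conjugation exchanges the roles of z and zeta in the kernel, so its integral
  over z is also 1, and Fubini shows that mass is preserved. This yields both the contractivity of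
  dilation in L^p and the equality of masses that Scheffe's lemma needs.\<close>

lemma integral_poisson_kernel_swap:
  fixes h :: "complex \<Rightarrow> real"
  assumes r: "0 \<le> r" "r < 1" and h: "integrable circle h"
  shows "integrable circle (\<lambda>z. LINT \<zeta>|circle. poisson_kernel (of_real r * z * cnj \<zeta>) * h \<zeta>)"
    and "(LINT z|circle. LINT \<zeta>|circle. poisson_kernel (of_real r * z * cnj \<zeta>) * h \<zeta>) = integral\<^sup>L circle h"
proof -
  interpret P: pair_sigma_finite circle circle ..
  have [measurable]: "h \<in> borel_measurable borel" using borel_measurable_integrable[OF h] by simp
  define k where "k = (\<lambda>\<zeta> z. poisson_kernel (of_real r * z * cnj \<zeta>) * h \<zeta>)"
  have inner: "integrable circle (\<lambda>z. poisson_kernel (of_real r * z * cnj \<zeta>))"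
    "(LINT z|circle. poisson_kernel (of_real r * z * cnj \<zeta>)) = 1"
    "AE z in circle. 0 \<le> poisson_kernel (of_real r * z * cnj \<zeta>)" if "norm \<zeta> = 1" for \<zeta>
  proof -
    have w: "norm (of_real r * \<zeta>) < 1" using that r by (simp add: norm_mult)
    have eq: "poisson_kernel (of_real r * z * cnj \<zeta>) = poisson_kernel (of_real r * \<zeta> * cnj z)" for z
      using poisson_kernel_cnj[of "of_real r * z * cnj \<zeta>"] by (simp add: mult_ac)
    show "integrable circle (\<lambda>z. poisson_kernel (of_real r * z * cnj \<zeta>))"
      unfolding eq using integrable_poisson_kernel_mult[OF w, of "\<lambda>_. 1::real"] by simp
    show "(LINT z|circle. poisson_kernel (of_real r * z * cnj \<zeta>)) = 1"
      unfolding eq by (rule integral_poisson_kernel[OF w])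
    show "AE z in circle. 0 \<le> poisson_kernel (of_real r * z * cnj \<zeta>)"
      unfolding eq using AE_poisson_kernel_bound[OF w] by eventually_elim auto
  qed
  have int: "integrable (circle \<Otimes>\<^sub>M circle) (case_prod k)"
  proof (rule P.Fubini_integrable)
    show "case_prod k \<in> borel_measurable (circle \<Otimes>\<^sub>M circle)"
      unfolding k_def by measurable
    have "integrable circle (\<lambda>\<zeta>. norm (h \<zeta>))" using h by simp
    moreover have "AE \<zeta> in circle. (LINT z|circle. norm (case (\<zeta>, z) of (\<zeta>, z) \<Rightarrow> k \<zeta> z)) = norm (h \<zeta>)"
      using AE_circle_norm
    proof eventually_elim
      case (elim \<zeta>)
      have "(LINT z|circle. norm (case (\<zeta>, z) of (\<zeta>, z) \<Rightarrow> k \<zeta> z)) =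
          (LINT z|circle. poisson_kernel (of_real r * z * cnj \<zeta>) * norm (h \<zeta>))"
      proof (rule integral_cong_AE)
        show "AE z in circle. norm (case (\<zeta>, z) of (\<zeta>, z) \<Rightarrow> k \<zeta> z) = poisson_kernel (of_real r * z * cnj \<zeta>) * norm (h \<zeta>)"
          using inner(3)[OF elim] by eventually_elim (simp add: k_def abs_mult)
      qed (auto simp: k_def)
      then show ?case using inner[OF elim] by simp
    qed
    ultimately show "integrable circle (\<lambda>\<zeta>. LINT z|circle. norm (case (\<zeta>, z) of (\<zeta>, z) \<Rightarrow> k \<zeta> z))"
      by (subst integrable_cong_AE[where g = "\<lambda>\<zeta>. norm (h \<zeta>)"]) (auto simp: k_def)
    show "AE \<zeta> in circle. integrable circle (\<lambda>z. case (\<zeta>, z) of (\<zeta>, z) \<Rightarrow> k \<zeta> z)"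
      using AE_circle_norm by eventually_elim (use inner in \<open>auto simp: k_def\<close>)
  qed
  show "integrable circle (\<lambda>z. LINT \<zeta>|circle. poisson_kernel (of_real r * z * cnj \<zeta>) * h \<zeta>)"
    using P.integrable_snd[OF int] by (simp add: k_def)
  have "(LINT z|circle. LINT \<zeta>|circle. k \<zeta> z) = (LINT \<zeta>|circle. LINT z|circle. k \<zeta> z)"
    by (rule P.Fubini_integral[OF int])
  also have "\<dots> = integral\<^sup>L circle h"
  proof (rule integral_cong_AE)
    show "AE \<zeta> in circle. (LINT z|circle. k \<zeta> z) = h \<zeta>"
      using AE_circle_norm by eventually_elim (use inner in \<open>auto simp: k_def\<close>)
  qed (auto simp: k_def)
  finally show "(LINT z|circle. LINT \<zeta>|circle. poisson_kernel (of_real r * z * cnj \<zeta>) * h \<zeta>) = integral\<^sup>L circle h"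
    by (simp add: k_def)
qed

lemma poisson_powr_le:
  assumes p: "p > 1" and [measurable]: "f \<in> borel_measurable borel"
    and fp: "integrable circle (\<lambda>z. norm (f z) powr p)" and w: "norm w < 1"
  shows "norm (poisson f w) powr p \<le> (LINT \<zeta>|circle. poisson_kernel (w * cnj \<zeta>) * norm (f \<zeta>) powr p)"
  unfolding poisson_def
proof (rule weighted_Jensen_powr[OF p])
  show "integrable circle (\<lambda>\<zeta>. poisson_kernel (w * cnj \<zeta>))"
    using integrable_poisson_kernel_mult[OF w, of "\<lambda>_. 1::real"] by simp
  show "AE \<zeta> in circle. 0 \<le> poisson_kernel (w * cnj \<zeta>)"
    using AE_poisson_kernel_bound[OF w] by eventually_elim auto
  show "integrable circle (\<lambda>\<zeta>. poisson_kernel (w * cnj \<zeta>) *\<^sub>R f \<zeta>)"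
    using p by (intro integrable_poisson_kernel_mult[OF w] integrable_of_powr[OF _ _ fp]) auto
  show "integrable circle (\<lambda>\<zeta>. poisson_kernel (w * cnj \<zeta>) * norm (f \<zeta>) powr p)"
    using integrable_poisson_kernel_mult[OF w fp] by simp
qed (rule integral_poisson_kernel[OF w])

lemma integral_poisson_powr_le:
  assumes p: "p > 1" and [measurable]: "f \<in> borel_measurable borel"
    and fp: "integrable circle (\<lambda>z. norm (f z) powr p)" and r: "0 \<le> r" "r < 1"
  shows "integrable circle (\<lambda>z. norm (poisson f (of_real r * z)) powr p)"
    and "(LINT z|circle. norm (poisson f (of_real r * z)) powr p) \<le> (LINT z|circle. norm (f z) powr p)"
proof -
  have le: "AE z in circle. norm (poisson f (of_real r * z)) powr p \<le>
      (LINT \<zeta>|circle. poisson_kernel (of_real r * z * cnj \<zeta>) * norm (f \<zeta>) powr p)"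
    using AE_circle_norm
    by eventually_elim (use r in \<open>auto intro!: poisson_powr_le[OF p _ fp] simp: norm_mult\<close>)
  note sw = integral_poisson_kernel_swap[OF r fp]
  show "integrable circle (\<lambda>z. norm (poisson f (of_real r * z)) powr p)"
    by (rule Bochner_Integration.integrable_bound[OF sw(1)]) (use le in \<open>auto elim!: eventually_mono\<close>)
  then show "(LINT z|circle. norm (poisson f (of_real r * z)) powr p) \<le> (LINT z|circle. norm (f z) powr p)"
    unfolding sw(2)[symmetric] using le sw(1) by (intro integral_mono_AE) auto
qed

text \<open>With \<open>X\<close> = |f|^p and \<open>F n\<close> its Poisson integrals, Jensen
  bounds the p-th power of the difference by C (F n + X). This bound moves with n, but
  \<open>F n\<close> tends to \<open>X\<close> in L^1 by Scheffe's lemma, because the masses agree;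
  so a dominated convergence argument with converging majorants applies.\<close>

lemma poisson_tendsto_Lp:
  assumes p: "p > 1" and [measurable]: "f \<in> borel_measurable borel"
    and fp: "integrable circle (\<lambda>z. norm (f z) powr p)" 
    and r: "\<And>n. 0 \<le> r n" "\<And>n. r n < 1" "r \<longlonglongrightarrow> 1"
  shows "(\<lambda>n. LINT z|circle. norm (poisson f (of_real (r n) * z) - f z) powr p) \<longlonglongrightarrow> 0"
proof -
  define X where "X = (\<lambda>z. norm (f z) powr p)"
  have [measurable]: "X \<in> borel_measurable borel" by (simp add: X_def)
  have X: "integrable circle X" using fp by (simp add: X_def)
  define F where "F n = (\<lambda>z. LINT \<zeta>|circle. poisson_kernel (of_real (r n) * z * cnj \<zeta>) * X \<zeta>)" for n
  have F: "integrable circle (F n)" "integral\<^sup>L circle (F n) = integral\<^sup>L circle X" for n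
    using integral_poisson_kernel_swap[OF r(1,2) X, of n] by (auto simp: F_def)
  have filt: "filterlim r (at_left 1) sequentially"
    unfolding filterlim_at using r by (auto intro!: always_eventually simp: less_le)
  have f: "integrable circle f" using p by (intro integrable_of_powr[OF _ _ fp]) auto
  have fconv: "AE z in circle. (\<lambda>n. poisson f (of_real (r n) * z)) \<longlonglongrightarrow> f z"
    using Fatou_radial_limit[OF f] by eventually_elim (rule filterlim_compose[OF _ filt])
  have "AE z in circle. (\<lambda>n. poisson (\<lambda>z. of_real (X z)) (of_real (r n) * z)) \<longlonglongrightarrow> of_real (X z)"
    using Fatou_radial_limit[of "\<lambda>z. of_real (X z)"] X by (auto elim!: eventually_mono intro: filterlim_compose[OF _ filt])
  moreover have "poisson (\<lambda>z. of_real (X z)) (of_real (r n) * z) = of_real (F n z)" for n z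
    unfolding poisson_def F_def by (simp add: scaleR_conv_of_real flip: of_real_mult)
  ultimately have Fconv: "AE z in circle. (\<lambda>n. F n z) \<longlonglongrightarrow> X z"
    by (simp add: tendsto_of_real_iff)
  have Fnn: "AE z in circle. 0 \<le> F n z" for n
    using AE_circle_norm
  proof eventually_elim
    case (elim z)
    have "norm (of_real (r n) * z) < 1" using r elim by (simp add: norm_mult)
    from AE_poisson_kernel_bound[OF this] show ?case
      unfolding F_def by (intro integral_nonneg_AE) (auto elim!: eventually_mono simp: X_def)
  qed
  have "(\<lambda>n. \<integral>\<^sup>+ z. norm (F n z - X z) \<partial>circle) \<longlonglongrightarrow> 0"
  proof (rule Scheffe_lemma1[OF F(1) X Fconv])
    have "(\<integral>\<^sup>+ z. norm (F n z) \<partial>circle) = (\<integral>\<^sup>+ z. norm (X z) \<partial>circle)" for n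
    proof -
      have "(\<integral>\<^sup>+ z. norm (F n z) \<partial>circle) = ennreal (LINT z|circle. norm (F n z))"
        by (rule nn_integral_eq_integral) (use F in auto)
      also have "(LINT z|circle. norm (F n z)) = integral\<^sup>L circle (F n)"
      proof (rule integral_cong_AE)
        show "AE z in circle. norm (F n z) = F n z"
          using Fnn[of n] by eventually_elim simp
      qed (use borel_measurable_integrable[OF F(1)[of n]] in auto)
      also have "\<dots> = (LINT z|circle. norm (X z))" unfolding F(2) by (simp add: X_def)
      also have "ennreal \<dots> = (\<integral>\<^sup>+ z. norm (X z) \<partial>circle)"
        by (rule nn_integral_eq_integral[symmetric]) (use X in auto)
      finally show ?thesis .
    qed
    then show "limsup (\<lambda>n. \<integral>\<^sup>+ z. norm (F n z) \<partial>circle) \<le> (\<integral>\<^sup>+ z. norm (X z) \<partial>circle)"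
      by (simp add: Limsup_const)
  qed
  moreover have "(\<integral>\<^sup>+ z. norm (F n z - X z) \<partial>circle) = ennreal (LINT z|circle. norm (F n z - X z))" for n
    by (rule nn_integral_eq_integral) (use F X in auto)
  ultimately have L1: "(\<lambda>n. LINT z|circle. norm (F n z - X z)) \<longlonglongrightarrow> 0"
    by (simp add: tendsto_ennreal_iff[where x = 0, simplified])
  define a where "a n = (\<lambda>z. norm (poisson f (of_real (r n) * z) - f z) powr p)" for n
  define C where "C = 2 powr p"
  have C: "C > 0" by (simp add: C_def)
  \<comment> \<open>\<open>a n\<close> is at most C |F n - X| + 2 C X. The excess over the first
    term is thus dominated by the fixed function 2 C X, and the first term goes to 0 in L^1.\<close>
  define b where "b n = (\<lambda>z. max 0 (a n z - C * norm (F n z - X z)))" for n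
  have [measurable]: "a n \<in> borel_measurable borel" "F n \<in> borel_measurable borel" for n
    using borel_measurable_integrable[OF F(1)[of n]] by (auto simp: a_def)
  have [measurable]: "b n \<in> borel_measurable borel" for n
    unfolding b_def by measurable
  have a_le: "AE z in circle. a n z \<le> C * (F n z + X z)" for n
    using AE_circle_norm
  proof eventually_elim
    case (elim z)
    have "norm (of_real (r n) * z) < 1" using r elim by (simp add: norm_mult)
    from poisson_powr_le[OF p \<open>f \<in> _\<close> fp this] have "norm (poisson f (of_real (r n) * z)) powr p \<le> F n z"
      by (simp add: F_def X_def)
    then have "C * (norm (poisson f (of_real (r n) * z)) powr p + norm (f z) powr p) \<le> C * (F n z + X z)"
      using C by (intro mult_left_mono) (auto simp: X_def)
    then show ?case unfolding a_def C_def using norm_diff_powr_le[of p "poisson f (of_real (r n) * z)" "f z"] p by linarith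
  qed
  have b: "(\<lambda>n. integral\<^sup>L circle (b n)) \<longlonglongrightarrow> (LINT z|circle. 0)"
  proof (rule integral_dominated_convergence)
    show "integrable circle (\<lambda>z. 2 * C * X z)" using X by simp
    show "AE z in circle. (\<lambda>n. b n z) \<longlonglongrightarrow> 0"
      using fconv Fconv
    proof eventually_elim
      case (elim z)
      have "(\<lambda>n. a n z) \<longlonglongrightarrow> norm (f z - f z) powr p"
        unfolding a_def using elim p by (intro tendsto_intros tendsto_powr') auto
      moreover have "(\<lambda>n. C * norm (F n z - X z)) \<longlonglongrightarrow> C * norm (X z - X z)"
        using elim by (intro tendsto_intros)
      ultimately have "(\<lambda>n. b n z) \<longlonglongrightarrow> max 0 (norm (f z - f z) powr p - C * norm (X z - X z))"
        unfolding b_def by (intro tendsto_max tendsto_const tendsto_diff)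
      then show ?case by simp
    qed
    show "AE z in circle. norm (b n z) \<le> 2 * C * X z" for n
      using a_le[of n]
    proof eventually_elim
      case (elim z)
      have "C * (F n z + X z) \<le> C * (norm (F n z - X z) + 2 * X z)"
        using C by (intro mult_left_mono) auto
      then show ?case using elim C by (simp add: b_def X_def algebra_simps)
    qed
  qed auto
  have bint: "integrable circle (b n)" for n
  proof (rule Bochner_Integration.integrable_bound)
    show "integrable circle (\<lambda>z. 2 * C * X z)" using X by simp
    show "AE z in circle. norm (b n z) \<le> norm (2 * C * X z)"
      using a_le[of n]
    proof eventually_elim
      case (elim z)
      have "C * (F n z + X z) \<le> C * (norm (F n z - X z) + 2 * X z)"
        using C by (intro mult_left_mono) auto
      then show ?case using elim C by (simp add: b_def X_def algebra_simps)
    qed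
  qed auto
  have le: "integral\<^sup>L circle (a n) \<le> integral\<^sup>L circle (b n) + C * (LINT z|circle. norm (F n z - X z))" for n
  proof -
    have "integral\<^sup>L circle (a n) \<le> (LINT z|circle. b n z + C * norm (F n z - X z))"
    proof (rule integral_mono)
      show "integrable circle (a n)" unfolding a_def
        using p r by (intro integrable_powr_diff integral_poisson_powr_le fp) auto
    qed (use bint F X in \<open>auto simp: b_def\<close>)
    then show ?thesis using bint F X by simp
  qed
  have "(\<lambda>n. integral\<^sup>L circle (b n) + C * (LINT z|circle. norm (F n z - X z))) \<longlonglongrightarrow> 0 + C * 0"
    using b L1 by (intro tendsto_intros) auto
  then have up: "(\<lambda>n. integral\<^sup>L circle (b n) + C * (LINT z|circle. norm (F n z - X z))) \<longlonglongrightarrow> 0" by simp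
  have "(\<lambda>n. integral\<^sup>L circle (a n)) \<longlonglongrightarrow> 0"
    by (rule tendsto_sandwich[OF _ _ tendsto_const up]) (use le in \<open>auto simp: a_def\<close>)
  then show ?thesis by (simp add: a_def)
qed

section \<open>M. Riesz' theorem\<close>

text \<open>The radius is absorbed into the coefficients, so that the partial sums of a power series
  at r z are polynomials in z.\<close>

definition dilated_partial_sum :: "(nat \<Rightarrow> complex) \<Rightarrow> real \<Rightarrow> nat \<Rightarrow> complex poly" where
  "dilated_partial_sum c r N = (\<Sum>n<N. monom (c n * of_real r ^ n) n)"

lemma poly_dilated_partial_sum:
  "poly (dilated_partial_sum c r N) z = (\<Sum>n<N. c n * (of_real r * z) ^ n)"
  by (simp add: dilated_partial_sum_def poly_sum poly_monom power_mult_distrib mult.assoc)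

text \<open>All coefficients are bounded by the L^1 norm, so the tail after \<open>N\<close> terms
  is geometric; the factor 2 counts positive and negative indices. The negative part is written as
  the conjugate of a polynomial vanishing at 0, the form used in
  \<open>Riesz_trig_poly\<close>.\<close>

lemma poisson_trig_approx:
  assumes f: "integrable circle f" and r: "0 \<le> r" "r < 1" and z: "norm z = 1"
  shows "norm (poisson f (of_real r * z) -
      (poly (dilated_partial_sum (\<lambda>n. coef f (int n)) r N) z +
       cnj (poly (dilated_partial_sum (\<lambda>n. if n = 0 then 0 else cnj (coef f (- int n))) r N) z)))
    \<le> 2 * (LINT z|circle. norm (f z)) * r ^ N / (1 - r)"
proof -
  define w where "w = of_real r * z"
  define M where "M = (LINT z|circle. norm (f z))"
  have w: "norm w = r" using r z by (simp add: w_def norm_mult)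
  define t where "t = (\<lambda>n. coef f (int n) * w ^ n + (if n = 0 then 0 else coef f (- int n) * cnj w ^ n))"
  have t: "t sums poisson f w"
    using poisson_sums[OF f, of w] w r by (simp add: t_def)
  have M: "M \<ge> 0" by (simp add: M_def)
  have tn: "norm (t n) \<le> 2 * M * r ^ n" for n
  proof -
    have "norm (coef f (int n) * w ^ n) \<le> M * r ^ n"
      unfolding norm_mult norm_power w using norm_coef_le[OF f, of "int n"] r
      by (intro mult_right_mono) (auto simp: M_def)
    moreover have "norm (coef f (- int n) * cnj w ^ n) \<le> M * r ^ n"
      unfolding norm_mult norm_power complex_mod_cnj w using norm_coef_le[OF f, of "- int n"] r
      by (intro mult_right_mono) (auto simp: M_def)
    moreover have "0 \<le> M * r ^ n" using M r by simp
    ultimately show ?thesis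
      unfolding t_def using norm_triangle_ineq[of "coef f (int n) * w ^ n" "if n = 0 then 0 else coef f (- int n) * cnj w ^ n"]
      by (cases "n = 0") auto
  qed
  have "(\<lambda>n. t (n + N)) sums (poisson f w - (\<Sum>n<N. t n))"
    using t by (rule sums_split_initial_segment)
  moreover have "(\<lambda>n. 2 * M * r ^ N * r ^ n) sums (2 * M * r ^ N * (1 / (1 - r)))"
    using r by (intro sums_mult geometric_sums) auto
  ultimately have "norm (poisson f w - (\<Sum>n<N. t n)) \<le> 2 * M * r ^ N * (1 / (1 - r))"
    by (rule norm_sums_le) (use tn[of "_ + N"] in \<open>simp add: power_add mult_ac\<close>)
  moreover have "(\<Sum>n<N. t n) = poly (dilated_partial_sum (\<lambda>n. coef f (int n)) r N) z +
       cnj (poly (dilated_partial_sum (\<lambda>n. if n = 0 then 0 else cnj (coef f (- int n))) r N) z)"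
    unfolding t_def w_def poly_dilated_partial_sum sum.distrib cnj_sum
    by (intro arg_cong2[where f = "(+)"] sum.cong) auto
  ultimately show ?thesis by (simp add: w_def M_def)
qed

text \<open>Splitting off the constant coefficients leaves the product of the remainders with the
  factor z conj z = 1, to which the induction hypothesis applies. It makes the sums of a polynomial
  and a conjugate polynomial closed under products on the circle.\<close>

lemma cnj_poly_mult_circle:
  "\<exists>e f. \<forall>z. norm z = 1 \<longrightarrow> poly a z * cnj (poly d z) = poly e z + cnj (poly f z)"
proof (induction a arbitrary: d)
  case 0
  show ?case by (intro exI[of _ 0]) simp
next
  case (pCons a0 a)
  obtain d0 d' where d: "d = pCons d0 d'" by (cases d)
  obtain e f where ef: "\<And>z. norm z = 1 \<Longrightarrow> poly a z * cnj (poly d' z) = poly e z + cnj (poly f z)"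
    using pCons.IH[of d'] by blast
  have "poly (pCons a0 a) z * cnj (poly d z) =
      poly (e + smult (cnj d0) (pCons 0 a)) z + cnj (poly (f + smult (cnj a0) d) z)" if "norm z = 1" for z
  proof -
    have "z * cnj z = 1" using that by (metis complex_norm_square of_real_1 power_one)
    then have "poly (pCons a0 a) z * cnj (poly d z) =
        a0 * cnj (poly d z) + cnj d0 * (z * poly a z) + poly a z * cnj (poly d' z)"
      by (simp add: d algebra_simps)
    then show ?thesis by (simp add: ef[OF that] algebra_simps)
  qed
  then show ?case by blast
qed

lemma real_polynomial_function_circle:
  fixes g :: "complex \<Rightarrow> real"
  assumes "real_polynomial_function g"
  shows "\<exists>a b. \<forall>z. norm z = 1 \<longrightarrow> of_real (g z) = poly a z + cnj (poly b z)"
  using assms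
proof (induction rule: real_polynomial_function.induct)
  case (linear g)
  interpret bounded_linear g by fact
  \<comment> \<open>A real linear functional on the plane has the form Re (2 c z) = c z + conj (c
    z), with this \<open>c\<close>.\<close>
  define c where "c = Complex (g 1) (- g \<i>) / 2"
  have "of_real (g z) = poly [:0, c:] z + cnj (poly [:0, c:] z)" for z
  proof -
    have "z = Re z *\<^sub>R 1 + Im z *\<^sub>R \<i>" by (simp add: complex_eq_iff)
    then have "g z = g (Re z *\<^sub>R 1 + Im z *\<^sub>R \<i>)" by simp
    also have "\<dots> = Re z * g 1 + Im z * g \<i>" unfolding add scaleR by simp
    finally have "g z = Re z * g 1 + Im z * g \<i>" .
    then show ?thesis by (auto simp: c_def complex_eq_iff field_simps)
  qed
  then show ?case by blast
next
  case (const c)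
  show ?case by (intro exI[of _ "[:of_real c:]"] exI[of _ 0]) simp
next
  case (add f g)
  obtain a b c d where "\<And>z. norm z = 1 \<Longrightarrow> of_real (f z) = poly a z + cnj (poly b z)"
      "\<And>z. norm z = 1 \<Longrightarrow> of_real (g z) = poly c z + cnj (poly d z)"
    using add.IH by blast
  then show ?case by (intro exI[of _ "a + c"] exI[of _ "b + d"]) simp
next
  case (mult f g)
  obtain a b c d where 1: "\<And>z. norm z = 1 \<Longrightarrow> of_real (f z) = poly a z + cnj (poly b z)"
      "\<And>z. norm z = 1 \<Longrightarrow> of_real (g z) = poly c z + cnj (poly d z)"
    using mult.IH by blast
  obtain e1 f1 where 2: "\<And>z. norm z = 1 \<Longrightarrow> poly a z * cnj (poly d z) = poly e1 z + cnj (poly f1 z)"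
    using cnj_poly_mult_circle[of a d] by blast
  obtain e2 f2 where 3: "\<And>z. norm z = 1 \<Longrightarrow> poly c z * cnj (poly b z) = poly e2 z + cnj (poly f2 z)"
    using cnj_poly_mult_circle[of c b] by blast
  show ?case
  proof (intro exI allI impI)
    fix z :: complex assume z: "norm z = 1"
    have "complex_of_real (f z * g z) = poly a z * poly c z + cnj (poly b z) * cnj (poly d z) + 
        poly a z * cnj (poly d z) + poly c z * cnj (poly b z)"
      using 1[OF z] by (simp add: algebra_simps)
    then show "complex_of_real (f z * g z) = poly (a * c + e1 + e2) z + cnj (poly (b * d + f1 + f2) z)"
      by (simp add: 2[OF z] 3[OF z])
  qed
qed

text \<open>Stone-Weierstrass gives a real trigonometric polynomial a + conj b, and its real part is
  that of a + b. It serves to majorize |Re f| by the real part of a polynomial.\<close>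

lemma Re_poly_approx:
  fixes h :: "complex \<Rightarrow> real"
  assumes "continuous_on (sphere 0 1) h" "e > 0"
  shows "\<exists>f. \<forall>z. norm z = 1 \<longrightarrow> \<bar>Re (poly f z) - h z\<bar> < e"
proof -
  obtain g where g: "real_polynomial_function g" "\<And>z. z \<in> sphere 0 1 \<Longrightarrow> \<bar>h z - g z\<bar> < e"
    using Stone_Weierstrass_real_polynomial_function[OF compact_sphere assms] by blast
  obtain a b where ab: "\<And>z. norm z = 1 \<Longrightarrow> complex_of_real (g z) = poly a z + cnj (poly b z)"
    using real_polynomial_function_circle[OF g(1)] by blast
  have "\<bar>Re (poly (a + b) z) - h z\<bar> < e" if "norm z = 1" for z
  proof -
    have "Re (poly (a + b) z) = g z" using arg_cong[OF ab[OF that], of Re] by simp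
    then show ?thesis using g(2)[of z] that by (simp add: abs_minus_commute)
  qed
  then show ?thesis by blast
qed

section \<open>Bounding a polynomial by its real part in L^p\<close>

lemma Re_powr_complex:
  assumes "w \<noteq> 0"
  shows "Re (w powr of_real p) = norm w powr p * cos (p * Im (Ln w))"
  using assms by (simp add: powr_def Re_exp)

text \<open>For \<open>1 < p \<le> 2\<close> the cosine of \<open>p \<theta>\<close> is negative near \<open>\<theta> = \<plusminus>\<pi>/2\<close>, which is exactly where
  \<open>Re w\<close> fails to control \<open>\<bar>w\<bar>\<close>.\<close>

lemma half_plane_powr_inequality:
  assumes p: "1 < p" "p \<le> 2"
  shows "\<exists>A\<ge>0. \<exists>B\<ge>0. \<forall>w. 0 < Re w \<longrightarrow> norm w powr p \<le> A * Re w powr p - B * Re (w powr of_real p)"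
proof -
  \<comment> \<open>The midpoint of pi / (2 p) and pi / 2, so that p times it lies beyond pi / 2,
    where the cosine is negative. The bound p <= 2 keeps p theta within [0, pi], where the cosine
    decreases.\<close>
  define \<theta>0 where "\<theta>0 = (pi / (2 * p) + pi / 2) / 2"
  have 1: "pi / (2 * p) < pi / 2" using p by (simp add: field_simps)
  have \<theta>0: "0 < \<theta>0" "\<theta>0 < pi / 2" "pi / 2 < p * \<theta>0"
  proof -
    show "0 < \<theta>0" using p by (simp add: \<theta>0_def add_pos_pos)
    show "\<theta>0 < pi / 2" using 1 by (simp add: \<theta>0_def)
    have "pi / (2 * p) < \<theta>0" using 1 by (simp add: \<theta>0_def)
    then show "pi / 2 < p * \<theta>0" using p by (simp add: field_simps)
  qed
  have p\<theta>: "p * \<theta> \<le> pi" if "\<theta> \<le> pi / 2" "0 \<le> \<theta>" for \<theta>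
    using mult_mono[of p 2 \<theta> "pi / 2"] p that by simp
  have "cos (p * \<theta>0) < 0"
  proof -
    have "cos (p * \<theta>0) < cos (pi / 2)"
      using \<theta>0 p\<theta>[of \<theta>0] by (intro cos_monotone_0_pi) auto
    then show ?thesis by simp
  qed
  \<comment> \<open>Up to theta0 the \<open>A\<close> term is at least 1 + B and the
    \<open>B\<close> term takes away at most B; beyond theta0 the \<open>B\<close> term alone
    contributes at least 1.\<close>
  define B where "B = - 1 / cos (p * \<theta>0)"
  have B: "B \<ge> 0" "B * cos (p * \<theta>0) = - 1" using \<open>cos (p * \<theta>0) < 0\<close> by (auto simp: B_def divide_nonneg_neg)
  have c0: "cos \<theta>0 > 0" using \<theta>0 by (intro cos_gt_zero_pi) auto
  define A where "A = (1 + B) / cos \<theta>0 powr p"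
  have A: "A \<ge> 0" "A * cos \<theta>0 powr p = 1 + B" using B c0 by (auto simp: A_def)
  have key: "1 \<le> A * cos \<theta> powr p - B * cos (p * \<theta>)" if "0 \<le> \<theta>" "\<theta> < pi / 2" for \<theta>
  proof (cases "\<theta> \<le> \<theta>0")
    case True
    have "cos \<theta>0 powr p \<le> cos \<theta> powr p"
      using True that \<theta>0 c0 p by (intro powr_mono2 cos_monotone_0_pi_le) auto
    from mult_left_mono[OF this A(1)] have "1 + B \<le> A * cos \<theta> powr p" unfolding A(2) .
    moreover have "B * cos (p * \<theta>) \<le> B * 1" using B by (intro mult_left_mono) auto
    ultimately show ?thesis by simp
  next
    case False
    have "cos (p * \<theta>) \<le> cos (p * \<theta>0)"
      using False that \<theta>0 p p\<theta>[of \<theta>] by (intro cos_monotone_0_pi_le) auto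
    from mult_left_mono[OF this B(1)] have "B * cos (p * \<theta>) \<le> - 1" unfolding B(2) .
    moreover have "0 \<le> A * cos \<theta> powr p" using A by simp
    ultimately show ?thesis by linarith
  qed
  have "norm w powr p \<le> A * Re w powr p - B * Re (w powr of_real p)" if w: "0 < Re w" for w
  proof -
    have "w \<noteq> 0" using w by auto
    define \<theta> where "\<theta> = \<bar>Im (Ln w)\<bar>"
    have "\<theta> < pi / 2" using Re_Ln_pos_lt[OF \<open>w \<noteq> 0\<close>] w by (simp add: \<theta>_def)
    have cosp: "cos (p * Im (Ln w)) = cos (p * \<theta>)"
      using p by (cases "Im (Ln w) \<ge> 0") (auto simp: \<theta>_def)
    have "Re w = Re (exp (Ln w))" using \<open>w \<noteq> 0\<close> by simp
    also have "\<dots> = norm w * cos (Im (Ln w))" using \<open>w \<noteq> 0\<close> unfolding Re_exp by simp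
    finally have Rew: "Re w = norm w * cos \<theta>" by (simp add: \<theta>_def)
    have "cos \<theta> \<ge> 0" using \<open>\<theta> < pi / 2\<close> by (intro cos_ge_zero) (auto simp: \<theta>_def)
    have "norm w powr p * 1 \<le> norm w powr p * (A * cos \<theta> powr p - B * cos (p * \<theta>))"
      using key[of \<theta>] \<open>\<theta> < pi / 2\<close> by (intro mult_left_mono) (auto simp: \<theta>_def)
    then show ?thesis
      unfolding Re_powr_complex[OF \<open>w \<noteq> 0\<close>] cosp Rew using \<open>cos \<theta> \<ge> 0\<close>
      by (simp add: powr_mult algebra_simps)
  qed
  then show ?thesis using A(1) B(1) by blast
qed

lemma integrable_powr_poly [simp]: "p \<ge> 0 \<Longrightarrow> integrable circle (\<lambda>z. norm (poly u z) powr p)"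
  using AE_bounded_poly[of u] integrable_powr_bounded[of "poly u"] by auto

lemma integrable_powr_Re_poly [simp]: "p \<ge> 0 \<Longrightarrow> integrable circle (\<lambda>z. \<bar>Re (poly u z)\<bar> powr p)"
  by (rule Bochner_Integration.integrable_bound[OF integrable_powr_poly[of p u]])
     (auto intro!: powr_mono2 abs_Re_le_cmod)

text \<open>The maximum principle for -h carries the lower bound on Re h into the disc, so a branch
  of h^p is holomorphic there and its mean over the circle is h(0)^p, a positive number. When the
  pointwise inequality is integrated, the \<open>B\<close> term can therefore be dropped.\<close>

lemma positive_real_part_powr_le:
  assumes p: "1 < p" and AB: "A \<ge> 0" "B \<ge> 0"
    "\<And>w. 0 < Re w \<Longrightarrow> norm w powr p \<le> A * Re w powr p - B * Re (w powr of_real p)"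
    and pos: "\<And>z. norm z = 1 \<Longrightarrow> e \<le> Re (poly h z)" "e > 0" and im: "Im (poly h 0) = 0"
  shows "(LINT z|circle. norm (poly h z) powr p) \<le> A * (LINT z|circle. \<bar>Re (poly h z)\<bar> powr p)"
proof -
  have Re: "Re (poly h z) \<ge> e" if "z \<in> cball 0 1" for z
  proof -
    have "Re (- poly h z) \<le> - e"
    proof (rule maximum_real_frontier[where S = "cball 0 1" and f = "\<lambda>z. - poly h z"])
      show "(\<lambda>z. - poly h z) holomorphic_on interior (cball 0 1)"
        by (intro holomorphic_intros)
      show "continuous_on (closure (cball 0 1)) (\<lambda>z. - poly h z)"
        by (intro continuous_intros)
    qed (use that pos in auto)
    then show ?thesis by simp
  qed
  define G where "G z = indicator (cball 0 1) z *\<^sub>R (poly h z powr of_real p)" for z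
  have Re0: "Re (poly h z) > 0" if "norm z \<le> 1" for z
    using Re[of z] pos(2) that by simp
  have nz: "poly h z \<notin> \<real>\<^sub>\<le>\<^sub>0" if "norm z \<le> 1" for z
    using Re0[OF that] by (auto simp: complex_nonpos_Reals_iff)
  have cont: "continuous_on (cball 0 1) (\<lambda>z. poly h z powr of_real p)"
  proof (intro continuous_on_powr_complex continuous_intros)
    show "cball 0 1 \<subseteq> {z. 0 \<le> Re (poly h z) \<or> Im (poly h z) \<noteq> 0}"
      using Re0 by (auto simp: less_imp_le)
    show "0 < Re (complex_of_real p)" for z using p by simp
  qed
  have hol: "(\<lambda>z. poly h z powr of_real p) holomorphic_on ball 0 1"
    by (intro holomorphic_intros) (use nz in auto)
  have [measurable]: "G \<in> borel_measurable borel"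
    unfolding G_def[abs_def] using cont by (intro borel_measurable_continuous_on_indicator) auto
  have "integral\<^sup>L circle G = G 0"
  proof (rule integral_circle_holomorphic)
    show "G holomorphic_on ball 0 1"
      by (rule holomorphic_transform[OF hol]) (auto simp: G_def)
    show "continuous_on (cball 0 1) G"
      by (rule continuous_on_eq[OF cont]) (auto simp: G_def)
  qed auto
  have "compact ((\<lambda>z. poly h z powr of_real p) ` cball 0 1)"
    by (intro compact_continuous_image cont) auto
  then have "bounded ((\<lambda>z. poly h z powr of_real p) ` cball 0 1)" by (rule compact_imp_bounded)
  then obtain C where "\<forall>y\<in>(\<lambda>z. poly h z powr of_real p) ` cball 0 1. norm y \<le> C"
    unfolding bounded_iff ..
  then have C: "norm (poly h z powr of_real p) \<le> C" if "norm z \<le> 1" for z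
    using that by simp
  have Gint: "integrable circle G"
    by (rule integrable_circle_bounded[where B = C]) (use AE_circle_norm C in \<open>auto elim!: eventually_mono simp: G_def\<close>)
  obtain x where x: "poly h 0 = of_real x" "x > 0"
    using im Re0[of 0] that[of "Re (poly h 0)"] by (auto simp: complex_eq_iff)
  then have "G 0 = of_real (x powr p)"
    using powr_of_real[of x p] by (simp add: G_def)
  then have G0: "(LINT z|circle. Re (G z)) \<ge> 0"
    using \<open>integral\<^sup>L circle G = G 0\<close> Gint by simp
  have "(LINT z|circle. norm (poly h z) powr p) \<le> (LINT z|circle. A * \<bar>Re (poly h z)\<bar> powr p - B * Re (G z))"
  proof (rule integral_mono_AE)
    show "AE z in circle. norm (poly h z) powr p \<le> A * \<bar>Re (poly h z)\<bar> powr p - B * Re (G z)"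
      using AE_circle_norm
    proof eventually_elim
      case (elim z)
      then show ?case using AB(3)[of "poly h z"] Re[of z] pos(2) by (simp add: G_def)
    qed
  qed (use p Gint in auto)
  also have "\<dots> = A * (LINT z|circle. \<bar>Re (poly h z)\<bar> powr p) - B * (LINT z|circle. Re (G z))"
    using p Gint by simp
  also have "\<dots> \<le> A * (LINT z|circle. \<bar>Re (poly h z)\<bar> powr p)" using AB G0 by simp
  finally show ?thesis .
qed

lemma le_add_epsilon_mult:
  fixes a b K :: real
  assumes "K \<ge> 0" and le: "\<And>x. x > 0 \<Longrightarrow> a \<le> b + K * x"
  shows "a \<le> b"
proof (rule field_le_epsilon)
  fix d :: real assume "d > 0"
  define x where "x = d / (K + 1)"
  have "x > 0" using \<open>d > 0\<close> assms(1) by (simp add: x_def)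
  moreover have "(K + 1) * x = d" using assms(1) by (simp add: x_def)
  ultimately show "a \<le> b + d" using le[of x] by (simp add: distrib_right)
qed

text \<open>The normalization at 0 excludes imaginary constants, which have real part 0 and admit no
  such bound. For polynomials all the integrals converge, which permits absorbing one into another
  when the exponent is doubled.\<close>

definition real_part_bound :: "real \<Rightarrow> bool" where
  "real_part_bound p \<longleftrightarrow> (\<exists>C\<ge>0. \<forall>f. Im (poly f 0) = 0 \<longrightarrow>
     (LINT z|circle. norm (poly f z) powr p) \<le> C * (LINT z|circle. \<bar>Re (poly f z)\<bar> powr p))"

text \<open>Positivity of the real part is achieved by writing f as half the difference of f1 + f
  and f1 - f, where Re f1 is slightly above |Re f|. Both then have positive real part, at most 2 |Re
  f| plus a small error.\<close>

lemma real_part_bound_small: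
  assumes p: "1 < p" "p \<le> 2"
  shows "real_part_bound p"
proof -
  obtain A B where AB: "A \<ge> 0" "B \<ge> 0"
    "\<forall>w. 0 < Re w \<longrightarrow> norm w powr p \<le> A * Re w powr p - B * Re (w powr of_real p)"
    using half_plane_powr_inequality[OF p] by (elim exE conjE)
  define D where "D = 2 powr p * 2 powr p"
  have "(LINT z|circle. norm (poly f z) powr p) \<le> (2 * A * D) * (LINT z|circle. \<bar>Re (poly f z)\<bar> powr p)"
    if f: "Im (poly f 0) = 0" for f
  proof -
    define I where "I = (LINT z|circle. \<bar>Re (poly f z)\<bar> powr p)"
    have le: "(LINT z|circle. norm (poly f z) powr p) \<le> 2 * A * D * I + 2 * A * D * (3 / 2 * e) powr p" if "e > 0" for e
    proof -
      obtain f0 where f0: "\<And>z. norm z = 1 \<Longrightarrow> \<bar>Re (poly f0 z) - (\<bar>Re (poly f z)\<bar> + 2 * e)\<bar> < e"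
      proof -
        have "continuous_on (sphere 0 1) (\<lambda>z. \<bar>Re (poly f z)\<bar> + 2 * e)" by (intro continuous_intros)
        from Re_poly_approx[OF this \<open>e > 0\<close>] show ?thesis using that by blast
      qed
      define f1 where "f1 = f0 - [:\<i> * of_real (Im (poly f0 0)):]"
      have f1: "Im (poly f1 0) = 0" "Re (poly f1 z) = Re (poly f0 z)" for z
        by (auto simp: f1_def)
      have bd: "(LINT z|circle. norm (poly h z) powr p) \<le> A * D * I + A * D * (3 / 2 * e) powr p"
        if h: "h = f1 + f \<or> h = f1 - f" for h
      proof -
        have Reh: "e \<le> Re (poly h z)" "\<bar>Re (poly h z)\<bar> \<le> 2 * (\<bar>Re (poly f z)\<bar> + 3 / 2 * e)" if "norm z = 1" for z
        proof -
          have "Re (poly h z) = Re (poly f0 z) + Re (poly f z) \<or> Re (poly h z) = Re (poly f0 z) - Re (poly f z)"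
            using h f1(2)[of z] by auto
          moreover have "Re (poly f0 z) < \<bar>Re (poly f z)\<bar> + 3 * e" "\<bar>Re (poly f z)\<bar> + e < Re (poly f0 z)"
            using f0[OF that] by linarith+
          ultimately have "e \<le> Re (poly h z)" "Re (poly h z) \<le> 2 * \<bar>Re (poly f z)\<bar> + 3 * e"
            by linarith+
          then show "e \<le> Re (poly h z)" "\<bar>Re (poly h z)\<bar> \<le> 2 * (\<bar>Re (poly f z)\<bar> + 3 / 2 * e)"
            using \<open>e > 0\<close> by simp_all
        qed
        have "(LINT z|circle. norm (poly h z) powr p) \<le> A * (LINT z|circle. \<bar>Re (poly h z)\<bar> powr p)"
          using h f f1 Reh(1) \<open>e > 0\<close> p by (intro positive_real_part_powr_le[OF _ AB(1,2) AB(3)[rule_format], of e]) auto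
        also have "(LINT z|circle. \<bar>Re (poly h z)\<bar> powr p) \<le> (LINT z|circle. D * (\<bar>Re (poly f z)\<bar> powr p + (3 / 2 * e) powr p))"
        proof (rule integral_mono_AE)
          show "AE z in circle. \<bar>Re (poly h z)\<bar> powr p \<le> D * (\<bar>Re (poly f z)\<bar> powr p + (3 / 2 * e) powr p)"
            using AE_circle_norm
          proof eventually_elim
            case (elim z)
            have "\<bar>Re (poly h z)\<bar> powr p \<le> (2 * (\<bar>Re (poly f z)\<bar> + 3 / 2 * e)) powr p"
              using Reh(2)[OF elim] p by (intro powr_mono2) auto
            also have "\<dots> = 2 powr p * (\<bar>Re (poly f z)\<bar> + 3 / 2 * e) powr p"
              using \<open>e > 0\<close> by (subst powr_mult) auto
            also have "\<dots> \<le> 2 powr p * (2 powr p * (\<bar>Re (poly f z)\<bar> powr p + (3 / 2 * e) powr p))"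
              using p \<open>e > 0\<close> by (intro mult_left_mono powr_add_le) auto
            finally show ?case by (simp add: D_def)
          qed
        qed (use p in auto)
        also have "\<dots> = D * I + D * (3 / 2 * e) powr p"
          using p circle.prob_space by (simp add: I_def distrib_left)
        finally have "(LINT z|circle. norm (poly h z) powr p) \<le> A * (D * I + D * (3 / 2 * e) powr p)"
          using AB(1) by (simp add: mult_left_mono)
        then show ?thesis by (simp only: distrib_left mult.assoc)
      qed
      have "(LINT z|circle. norm (poly f z) powr p) \<le> (LINT z|circle. norm (poly (f1 + f) z) powr p + norm (poly (f1 - f) z) powr p)"
      proof (rule integral_mono)
        show "integrable circle (\<lambda>z. norm (poly f z) powr p)" using p by simp
        show "integrable circle (\<lambda>z. norm (poly (f1 + f) z) powr p + norm (poly (f1 - f) z) powr p)"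
          by (rule Bochner_Integration.integrable_add; rule integrable_powr_poly) (use p in simp_all)
        fix z
        have "poly f z = (poly (f1 + f) z - poly (f1 - f) z) / 2" by simp
        then have "norm (poly f z) \<le> max (norm (poly (f1 + f) z)) (norm (poly (f1 - f) z))"
        proof -
          assume "poly f z = (poly (f1 + f) z - poly (f1 - f) z) / 2"
          then have "norm (poly f z) = norm (poly (f1 + f) z - poly (f1 - f) z) / 2"
            by (simp only: norm_divide norm_numeral)
          with norm_triangle_ineq4[of "poly (f1 + f) z" "poly (f1 - f) z"] show ?thesis by linarith
        qed
        then have "norm (poly f z) powr p \<le> max (norm (poly (f1 + f) z)) (norm (poly (f1 - f) z)) powr p"
          using p by (intro powr_mono2) auto
        also have "\<dots> \<le> norm (poly (f1 + f) z) powr p + norm (poly (f1 - f) z) powr p"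
          by (auto simp: max_def)
        finally show "norm (poly f z) powr p \<le> norm (poly (f1 + f) z) powr p + norm (poly (f1 - f) z) powr p" .
      qed
      also have "\<dots> = (LINT z|circle. norm (poly (f1 + f) z) powr p) + (LINT z|circle. norm (poly (f1 - f) z) powr p)"
        by (rule Bochner_Integration.integral_add; rule integrable_powr_poly) (use p in simp_all)
      finally show ?thesis
        using bd[of "f1 + f", OF disjI1[OF refl]] bd[of "f1 - f", OF disjI2[OF refl]] by linarith
    qed
    define K where "K = 2 * A * D"
    have K: "K \<ge> 0" using AB by (simp add: D_def K_def)
    \<comment> \<open>As \<open>e\<close> varies, (3 / 2 * e)^p takes every positive value
      \<open>x\<close>, which makes the error linear in \<open>x\<close>.\<close>
    have le': "(LINT z|circle. norm (poly f z) powr p) \<le> K * I + K * x" if "x > 0" for x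
    proof -
      define y where "y = x powr (1 / p)"
      have y: "y > 0" "y powr p = x" using that p by (auto simp: y_def powr_powr)
      have eq: "3 / 2 * (2 / 3 * y) = y" by simp
      have "2 / 3 * y > 0" using y by simp
      from le[OF this] show ?thesis unfolding K_def eq y(2) .
    qed
    have "(LINT z|circle. norm (poly f z) powr p) \<le> K * I"
      by (rule le_add_epsilon_mult[OF K le'])
    then have "(LINT z|circle. norm (poly f z) powr p) \<le> 2 * A * D * I" by (simp add: K_def)
    then show ?thesis by (simp add: I_def)
  qed
  then have "\<forall>f. Im (poly f 0) = 0 \<longrightarrow> (LINT z|circle. norm (poly f z) powr p) \<le> (2 * A * D) * (LINT z|circle. \<bar>Re (poly f z)\<bar> powr p)"
    by (intro allI impI)
  moreover have "2 * A * D \<ge> 0" using AB(1) by (simp add: D_def)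
  ultimately show ?thesis unfolding real_part_bound_def by (intro exI[of _ "2 * A * D"] conjI)
qed

lemma integral_poly: "integral\<^sup>L circle (poly u) = poly u 0"
  using coef_poly[of u 0] by (simp add: coef_def poly_0_coeff_0)

lemma Jensen_circle:
  fixes f :: "complex \<Rightarrow> complex"
  assumes "p > 1" "f \<in> borel_measurable borel" "integrable circle (\<lambda>z. norm (f z) powr p)"
  shows "norm (integral\<^sup>L circle f) powr p \<le> (LINT z|circle. norm (f z) powr p)"
proof -
  have "integrable circle f" using assms by (intro integrable_of_powr[of p f]) simp_all
  then have "norm (LINT x|circle. 1 *\<^sub>R f x) powr p \<le> (LINT x|circle. 1 * norm (f x) powr p)"
    using assms circle.prob_space by (intro weighted_Jensen_powr) simp_all
  then show ?thesis by simp
qed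

lemma powr_double:
  fixes x :: real
  assumes "x \<ge> 0"
  shows "x powr (2 * p) = (x\<^sup>2) powr p"
proof -
  have "x powr (2 * p) = (x powr 2) powr p" by (simp only: powr_powr)
  also have "x powr 2 = x\<^sup>2" using assms by (rule powr_numeral)
  finally show ?thesis .
qed

text \<open>The bound for \<open>p\<close> is applied to -i f^2, whose real part 2 Re f Im f is at
  most 2 |Re f| |f|; the multiple of |f|^(2p) that arises on the right is absorbed into the
  left.\<close>

lemma real_part_bound_double:
  assumes "real_part_bound p" "1 < p"
  shows "real_part_bound (2 * p)"
proof -
  obtain C where C: "C \<ge> 0" and bound: "\<And>f. Im (poly f 0) = 0 \<Longrightarrow>
     (LINT z|circle. norm (poly f z) powr p) \<le> C * (LINT z|circle. \<bar>Re (poly f z)\<bar> powr p)"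
    using assms(1) unfolding real_part_bound_def by auto
  define D where "D = C * 2 powr p * 2 powr p"
  have D: "D \<ge> 0" using C by (simp add: D_def)
  define E where "E = D * (D + 1) + 2 * 2 powr p"
  have "(LINT z|circle. norm (poly f z) powr (2 * p)) \<le> E * (LINT z|circle. \<bar>Re (poly f z)\<bar> powr (2 * p))"
    if im: "Im (poly f 0) = 0" for f
  proof -
    define X where "X = (LINT z|circle. norm (poly f z) powr (2 * p))"
    define U where "U = (LINT z|circle. \<bar>Re (poly f z)\<bar> powr (2 * p))"
    define x0 where "x0 = Re (poly f 0)"
    \<comment> \<open>The constant makes \<open>g\<close> vanish at 0. It is paid for through
      \<open>x0\<close>, which is the mean of Re f and so is controlled by Jensen's
      inequality.\<close>
    define g where "g = smult (- \<i>) (f * f) + [:\<i> * of_real (x0\<^sup>2):]"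
    have g: "poly g z = - \<i> * (poly f z)\<^sup>2 + \<i> * of_real (x0\<^sup>2)" for z
      by (simp add: g_def power2_eq_square)
    have Reg: "Re (poly g z) = 2 * Re (poly f z) * Im (poly f z)" for z
      unfolding g by (simp add: power2_eq_square)
    have "poly f 0 = of_real x0" using im by (simp add: x0_def complex_eq_iff)
    then have Img: "Im (poly g 0) = 0" unfolding g by simp
    have x0: "\<bar>x0\<bar> powr (2 * p) \<le> U"
    proof -
      have "(LINT z|circle. complex_of_real (Re (poly f z))) = of_real x0"
        unfolding x0_def by (simp flip: integral_poly)
      moreover have "norm (LINT z|circle. complex_of_real (Re (poly f z))) powr (2 * p) \<le>
          (LINT z|circle. norm (complex_of_real (Re (poly f z))) powr (2 * p))"
        using assms(2) integrable_powr_Re_poly[of "2 * p" f] by (intro Jensen_circle) simp_all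
      ultimately show ?thesis by (simp add: U_def)
    qed
    have sq: "norm (poly f z) powr (2 * p) = norm ((poly f z)\<^sup>2) powr p" for z
      unfolding powr_double[OF norm_ge_zero] norm_power ..
    have 1: "X \<le> 2 powr p * ((LINT z|circle. norm (poly g z) powr p) + U)"
    proof -
      have "X \<le> (LINT z|circle. 2 powr p * (norm (poly g z) powr p + U))"
        unfolding X_def
      proof (rule integral_mono)
        fix z
        have "norm ((poly f z)\<^sup>2) = norm (poly g z - \<i> * of_real (x0\<^sup>2))"
          by (simp add: g norm_mult)
        then have "norm (poly f z) powr (2 * p) \<le> 2 powr p * (norm (poly g z) powr p + norm (\<i> * of_real (x0\<^sup>2)) powr p)"
          unfolding sq using assms(2) by (simp only:) (rule norm_diff_powr_le, simp)
        also have "norm (\<i> * complex_of_real (x0\<^sup>2)) powr p = \<bar>x0\<bar> powr (2 * p)"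
          by (simp add: powr_double norm_mult norm_power)
        also have "2 powr p * (norm (poly g z) powr p + \<bar>x0\<bar> powr (2 * p)) \<le> 2 powr p * (norm (poly g z) powr p + U)"
          using x0 by simp
        finally show "norm (poly f z) powr (2 * p) \<le> 2 powr p * (norm (poly g z) powr p + U)" .
      qed (use assms(2) in simp_all)
      then show ?thesis using assms(2) circle.prob_space by simp
    qed
    \<comment> \<open>The weight in a b <= eta b^2 + a^2 / (4 eta), chosen such that D eta <= 1 / 2
      and half of \<open>X\<close> remains on the left.\<close>
    define \<eta> where "\<eta> = 1 / (2 * (D + 1))"
    have \<eta>: "\<eta> > 0" "D * \<eta> \<le> 1 / 2" "D / (4 * \<eta>) = D * (D + 1) / 2"
      using D by (auto simp: \<eta>_def divide_simps)
    have 2: "(LINT z|circle. \<bar>Re (poly g z)\<bar> powr p) \<le> 2 powr p * (\<eta> * X + U / (4 * \<eta>))"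
    proof -
      have "(LINT z|circle. \<bar>Re (poly g z)\<bar> powr p) \<le>
          (LINT z|circle. 2 powr p * (\<eta> * norm (poly f z) powr (2 * p) + \<bar>Re (poly f z)\<bar> powr (2 * p) / (4 * \<eta>)))"
      proof (rule integral_mono)
        fix z
        define a b where "a = \<bar>Re (poly f z)\<bar> powr p" and "b = norm (poly f z) powr p"
        have ab: "a \<ge> 0" "b \<ge> 0" "a\<^sup>2 = \<bar>Re (poly f z)\<bar> powr (2 * p)" "b\<^sup>2 = norm (poly f z) powr (2 * p)"
          by (simp_all add: a_def b_def power2_eq_square flip: powr_add)
        have "\<bar>Re (poly g z)\<bar> powr p = (2 * (\<bar>Re (poly f z)\<bar> * \<bar>Im (poly f z)\<bar>)) powr p"
          unfolding Reg by (simp add: abs_mult mult.assoc)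
        also have "\<dots> = 2 powr p * (a * \<bar>Im (poly f z)\<bar> powr p)"
          by (simp add: powr_mult a_def)
        also have "\<bar>Im (poly f z)\<bar> powr p \<le> b"
          unfolding b_def using assms(2) by (intro powr_mono2 abs_Im_le_cmod) auto
        also have "a * b \<le> \<eta> * b\<^sup>2 + a\<^sup>2 / (4 * \<eta>)"
        proof -
          have "0 \<le> (2 * \<eta> * b - a)\<^sup>2 / (4 * \<eta>)" using \<eta> by simp
          also have "\<dots> = \<eta> * b\<^sup>2 + a\<^sup>2 / (4 * \<eta>) - a * b"
            using \<eta>(1) by (simp add: power2_eq_square field_simps)
          finally show ?thesis by simp
        qed
        finally show "\<bar>Re (poly g z)\<bar> powr p \<le> 2 powr p * (\<eta> * norm (poly f z) powr (2 * p) + \<bar>Re (poly f z)\<bar> powr (2 * p) / (4 * \<eta>))"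
          using ab by (simp add: mult_left_mono)
      qed (use assms(2) in simp_all)
      then show ?thesis using assms(2) by (simp add: X_def U_def)
    qed
    have "X \<le> 2 powr p * (C * (2 powr p * (\<eta> * X + U / (4 * \<eta>))) + U)"
    proof -
      have "(LINT z|circle. norm (poly g z) powr p) \<le> C * (2 powr p * (\<eta> * X + U / (4 * \<eta>)))"
        by (rule order_trans[OF bound[OF Img] mult_left_mono[OF 2 C]])
      then have "2 powr p * ((LINT z|circle. norm (poly g z) powr p) + U) \<le> 2 powr p * (C * (2 powr p * (\<eta> * X + U / (4 * \<eta>))) + U)"
        by simp
      with 1 show ?thesis by linarith
    qed
    also have "\<dots> = (D * \<eta>) * X + (D / (4 * \<eta>)) * U + 2 powr p * U"
      by (simp add: D_def algebra_simps)
    also have "(D * \<eta>) * X \<le> 1 / 2 * X"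
      using \<eta>(2) by (rule mult_right_mono) (simp add: X_def)
    finally have "X \<le> 2 * ((D / (4 * \<eta>)) * U + 2 powr p * U)" by simp
    also have "\<dots> = E * U" unfolding \<eta>(3) by (simp add: E_def algebra_simps)
    finally show ?thesis by (simp add: X_def U_def)
  qed
  moreover have "E \<ge> 0" using D by (simp add: E_def)
  ultimately show ?thesis unfolding real_part_bound_def by (intro exI[of _ E] conjI allI impI)
qed

lemma real_part_bound:
  assumes "1 < p"
  shows "real_part_bound p"
proof -
  have "\<forall>p. 1 < p \<and> p \<le> 2 ^ Suc n \<longrightarrow> real_part_bound p" for n
  proof (induction n)
    case 0
    then show ?case using real_part_bound_small by simp
  next
    case (Suc n)
    show ?case
    proof (intro allI impI)
      fix p :: real assume p: "1 < p \<and> p \<le> 2 ^ Suc (Suc n)"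
      show "real_part_bound p"
      proof (cases "p \<le> 2")
        case True
        then show ?thesis using p real_part_bound_small by simp
      next
        case False
        then have "real_part_bound (p / 2)" using Suc p by auto
        from real_part_bound_double[OF this] show ?thesis using False by simp
      qed
    qed
  qed
  moreover obtain n where "p < 2 ^ n" using real_arch_pow[of 2 p] by auto
  then have "p \<le> 2 ^ Suc n" by (simp add: less_imp_le order_trans[of p "2 ^ n"])
  ultimately show ?thesis using assms by blast
qed

text \<open>For h = v + conj w, the polynomials \<open>a\<close> and \<open>b\<close> have real
  parts Re h and Im h and are real at 0, so the bound for real parts applies to both; and 2 v = a +
  i b + v(0).\<close>

lemma Riesz_trig_poly:
  assumes p: "1 < p"
  shows "\<exists>C\<ge>0. \<forall>v w. poly w 0 = 0 \<longrightarrow>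
    (LINT z|circle. norm (poly v z) powr p) \<le> C * (LINT z|circle. norm (poly v z + cnj (poly w z)) powr p)"
proof -
  obtain C where C: "C \<ge> 0" and bound: "\<And>f. Im (poly f 0) = 0 \<Longrightarrow>
     (LINT z|circle. norm (poly f z) powr p) \<le> C * (LINT z|circle. \<bar>Re (poly f z)\<bar> powr p)"
    using real_part_bound[OF p] unfolding real_part_bound_def by auto
  define D where "D = 2 powr p * (C + 2 powr p * (C + 1))"
  have "(LINT z|circle. norm (poly v z) powr p) \<le> D * (LINT z|circle. norm (poly v z + cnj (poly w z)) powr p)"
    if w0: "poly w 0 = 0" for v w
  proof -
    define h where "h = (\<lambda>z. poly v z + cnj (poly w z))"
    have [measurable]: "h \<in> borel_measurable borel" unfolding h_def by measurable
    define X where "X = (LINT z|circle. norm (h z) powr p)"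
    have hp: "integrable circle (\<lambda>z. norm (h z) powr p)"
      using p integrable_powr_poly[of p v] integrable_powr_poly[of p w]
      unfolding h_def by (intro integrable_powr_add) simp_all
    define a where "a = v + w - [:\<i> * of_real (Im (poly v 0)):]"
    define b where "b = smult (- \<i>) (v - w) + [:\<i> * of_real (Re (poly v 0)):]"
    have le: "(LINT z|circle. norm (poly f z) powr p) \<le> C * X"
      if "Im (poly f 0) = 0" "\<And>z. \<bar>Re (poly f z)\<bar> \<le> norm (h z)" for f
    proof -
      have "(LINT z|circle. \<bar>Re (poly f z)\<bar> powr p) \<le> X"
        unfolding X_def using hp that(2) p by (intro integral_mono powr_mono2) simp_all
      from order_trans[OF bound[OF that(1)] mult_left_mono[OF this C]] show ?thesis .
    qed
    have a: "(LINT z|circle. norm (poly a z) powr p) \<le> C * X"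
    proof (rule le)
      fix z
      have "Re (poly a z) = Re (h z)" by (simp add: a_def h_def)
      then show "\<bar>Re (poly a z)\<bar> \<le> norm (h z)" using abs_Re_le_cmod[of "h z"] by simp
    qed (simp add: a_def w0)
    have b: "(LINT z|circle. norm (poly b z) powr p) \<le> C * X"
    proof (rule le)
      fix z
      have "Re (poly b z) = Im (h z)" by (simp add: b_def h_def)
      then show "\<bar>Re (poly b z)\<bar> \<le> norm (h z)" using abs_Im_le_cmod[of "h z"] by simp
    qed (simp add: b_def w0)
    have v0: "norm (poly v 0) powr p \<le> X"
    proof -
      have "integral\<^sup>L circle h = poly v 0"
        unfolding h_def using integral_poly[of v] integral_poly[of w] w0
        by (subst Bochner_Integration.integral_add) simp_all
      then show ?thesis using Jensen_circle[OF p _ hp] by (simp add: X_def)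
    qed
    have "(LINT z|circle. norm (poly v z) powr p) \<le>
        (LINT z|circle. 2 powr p * (norm (poly a z) powr p + 2 powr p * (norm (poly b z) powr p + norm (poly v 0) powr p)))"
    proof (rule integral_mono)
      fix z
      have "2 * poly v z = poly a z + (\<i> * poly b z + poly v 0)"
        by (simp add: a_def b_def complex_eq_iff)
      then have "norm (2 * poly v z) powr p = norm (poly a z + (\<i> * poly b z + poly v 0)) powr p" by simp
      also have "\<dots> \<le> 2 powr p * (norm (poly a z) powr p + norm (\<i> * poly b z + poly v 0) powr p)"
        using p by (intro norm_add_powr_le) simp
      also have "\<dots> \<le> 2 powr p * (norm (poly a z) powr p + 2 powr p * (norm (\<i> * poly b z) powr p + norm (poly v 0) powr p))"
        using p by (intro mult_left_mono add_left_mono norm_add_powr_le) simp_all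
      finally have "norm (2 * poly v z) powr p \<le> 2 powr p * (norm (poly a z) powr p + 2 powr p * (norm (poly b z) powr p + norm (poly v 0) powr p))"
        by (simp add: norm_mult)
      moreover have "norm (poly v z) powr p \<le> norm (2 * poly v z) powr p"
        using p by (intro powr_mono2) (auto simp: norm_mult)
      ultimately show "norm (poly v z) powr p \<le> 2 powr p * (norm (poly a z) powr p + 2 powr p * (norm (poly b z) powr p + norm (poly v 0) powr p))"
        by linarith
    qed (use p in simp_all)
    also have "\<dots> = 2 powr p * ((LINT z|circle. norm (poly a z) powr p) + 2 powr p * ((LINT z|circle. norm (poly b z) powr p) + norm (poly v 0) powr p))"
      using p circle.prob_space by simp
    also have "\<dots> \<le> 2 powr p * (C * X + 2 powr p * (C * X + X))"
      using a b v0 by (intro mult_left_mono add_mono) simp_all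
    also have "\<dots> = D * X" by (simp add: D_def algebra_simps)
    finally show ?thesis by (simp add: X_def h_def)
  qed
  moreover have "D \<ge> 0" using C by (simp add: D_def)
  ultimately show ?thesis by (intro exI[of _ D] conjI allI impI)
qed

text \<open>Functions whose analytic part is a polynomial \<open>v\<close> are the ones met in
  \<open>model_Riesz\<close>. The Poisson integral of \<open>b\<close> on a smaller circle is a
  uniform limit of trigonometric polynomials; dilation is contractive in L^p and is removed by
  letting r tend to 1.\<close>

lemma Riesz_Lp:
  assumes p: "1 < p"
  shows "\<exists>C\<ge>0. \<forall>b v. b \<in> borel_measurable borel \<longrightarrow> integrable circle (\<lambda>z. norm (b z) powr p) \<longrightarrow>
     (\<forall>n. coef b (int n) = coeff v n) \<longrightarrow>
    (LINT z|circle. norm (poly v z) powr p) \<le> C * (LINT z|circle. norm (b z) powr p)"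
proof -
  obtain C where C: "C \<ge> 0" and bound: "\<And>v w. poly w 0 = 0 \<Longrightarrow>
     (LINT z|circle. norm (poly v z) powr p) \<le> C * (LINT z|circle. norm (poly v z + cnj (poly w z)) powr p)"
    using Riesz_trig_poly[OF p] by auto
  have "(LINT z|circle. norm (poly v z) powr p) \<le> C * (LINT z|circle. norm (b z) powr p)"
    if [measurable]: "b \<in> borel_measurable borel" and bp: "integrable circle (\<lambda>z. norm (b z) powr p)"
      and coefs: "\<And>n. coef b (int n) = coeff v n" for b v
  proof -
    have b: "integrable circle b" using p by (intro integrable_of_powr[OF _ _ bp]) auto
    define M where "M = (LINT z|circle. norm (b z))"
    have M: "M \<ge> 0" by (simp add: M_def)
    have dil: "(LINT z|circle. norm (poly v (of_real r * z)) powr p) \<le> C * (LINT z|circle. norm (b z) powr p)"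
      if r: "0 \<le> r" "r < 1" for r
    proof -
      define U where "U N = dilated_partial_sum (\<lambda>n. coef b (int n)) r N" for N
      define V where "V N = dilated_partial_sum (\<lambda>n. if n = 0 then 0 else cnj (coef b (- int n))) r N" for N
      \<comment> \<open>Past the degree of \<open>v\<close> the analytic partial sums no longer
        change, so the left-hand side of the inequality is constant in \<open>N\<close>.\<close>
      have U: "poly (U N) z = poly v (of_real r * z)" if "N > degree v" for N z
      proof -
        have "poly (U N) z = (\<Sum>n<N. coeff v n * (of_real r * z) ^ n)"
          by (simp add: U_def poly_dilated_partial_sum coefs)
        also have "\<dots> = (\<Sum>n\<le>degree v. coeff v n * (of_real r * z) ^ n)"
          using that by (intro sum.mono_neutral_right) (auto simp: coeff_eq_0)
        finally show ?thesis by (simp add: poly_altdef)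
      qed
      have V: "poly (V N) 0 = 0" for N
        by (auto simp: V_def poly_dilated_partial_sum power_0_left intro!: sum.neutral)
      define T where "T N z = poly (U N) z + cnj (poly (V N) z)" for N z
      have approx: "norm (poisson b (of_real r * z) - T N z) \<le> 2 * M * r ^ N / (1 - r)" if "norm z = 1" for N z
        using poisson_trig_approx[OF b r that, of N] by (simp add: T_def U_def V_def M_def)
      have lim: "(\<lambda>N. LINT z|circle. norm (T N z) powr p) \<longlonglongrightarrow> (LINT z|circle. norm (poisson b (of_real r * z)) powr p)"
      proof (rule tendsto_integral_powr_bounded[where B = "2 * M / (1 - r) + M / (1 - r)\<^sup>2"])
        show "(\<lambda>z. poisson b (of_real r * z)) \<in> borel_measurable borel" by measurable
        show "AE z in circle. (\<lambda>N. T N z) \<longlonglongrightarrow> poisson b (of_real r * z)"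
          using AE_circle_norm
        proof eventually_elim
          case (elim z)
          have "(\<lambda>N. 2 * M * r ^ N / (1 - r)) \<longlonglongrightarrow> 2 * M * 0 / (1 - r)"
            using r by (intro tendsto_intros LIMSEQ_power_zero) auto
          then have lim0: "(\<lambda>N. 2 * M * r ^ N / (1 - r)) \<longlonglongrightarrow> 0" by simp
          have "(\<lambda>N. poisson b (of_real r * z) - T N z) \<longlonglongrightarrow> 0"
            by (rule Lim_null_comparison[OF always_eventually lim0]) (intro allI approx elim)
          from tendsto_diff[OF tendsto_const[of "poisson b (of_real r * z)"] this] show ?case by simp
        qed
        show "AE z in circle. norm (T N z) \<le> 2 * M / (1 - r) + M / (1 - r)\<^sup>2" for N
          using AE_circle_norm
        proof eventually_elim
          case (elim z)
          have "norm (poisson b (of_real r * z)) \<le> M / (1 - r)\<^sup>2"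
            unfolding M_def using r elim by (intro norm_poisson_le_integral b) (auto simp: norm_mult)
          moreover have "2 * M * r ^ N / (1 - r) \<le> 2 * M / (1 - r)"
            using r M by (intro divide_right_mono mult_left_le power_le_one) auto
          ultimately show ?case
            using approx[OF elim, of N] norm_triangle_ineq2[of "T N z" "poisson b (of_real r * z)"]
            by (simp add: norm_minus_commute)
        qed
      qed (use p in \<open>simp_all add: T_def[abs_def]\<close>)
      have "(LINT z|circle. norm (poly v (of_real r * z)) powr p) \<le> C * (LINT z|circle. norm (poisson b (of_real r * z)) powr p)"
      proof (rule tendsto_lowerbound[OF tendsto_mult[OF tendsto_const lim]])
        show "eventually (\<lambda>N. (LINT z|circle. norm (poly v (of_real r * z)) powr p) \<le> C * (LINT z|circle. norm (T N z) powr p)) sequentially"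
          using eventually_gt_at_top[of "degree v"]
        proof eventually_elim
          case (elim N)
          show ?case using bound[OF V, of "U N" N] by (simp add: U[OF elim] T_def)
        qed
      qed simp
      also have "\<dots> \<le> C * (LINT z|circle. norm (b z) powr p)"
        using C r by (intro mult_left_mono integral_poisson_powr_le(2)[OF p _ bp]) auto
      finally show ?thesis .
    qed
    define r where "r n = 1 - 1 / real (Suc n)" for n
    have r: "0 \<le> r n" "r n < 1" "r \<longlonglongrightarrow> 1" for n
    proof -
      have "(\<lambda>n. 1 - 1 / real (Suc n)) \<longlonglongrightarrow> 1 - 0"
        by (intro tendsto_diff tendsto_const LIMSEQ_Suc[OF lim_1_over_n])
      then show "r \<longlonglongrightarrow> 1" by (simp add: r_def[abs_def])
    qed (auto simp: r_def)
    obtain B where B: "\<And>z. norm z \<le> 1 \<Longrightarrow> norm (poly v z) \<le> B"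
    proof -
      have "bounded (poly v ` cball 0 1)"
        by (intro compact_imp_bounded compact_continuous_image continuous_intros) simp
      then obtain B where "\<forall>y\<in>poly v ` cball 0 1. norm y \<le> B" unfolding bounded_iff ..
      then show ?thesis by (intro that[of B]) simp
    qed
    have "(\<lambda>n. LINT z|circle. norm (poly v (of_real (r n) * z)) powr p) \<longlonglongrightarrow> (LINT z|circle. norm (poly v z) powr p)"
    proof (rule tendsto_integral_powr_bounded[where B = B])
      have "(\<lambda>n. poly v (of_real (r n) * z)) \<longlonglongrightarrow> poly v (of_real 1 * z)" for z
        by (intro tendsto_intros tendsto_of_real r)
      then show "AE z in circle. (\<lambda>n. poly v (of_real (r n) * z)) \<longlonglongrightarrow> poly v z" by simp
      show "AE z in circle. norm (poly v (of_real (r n) * z)) \<le> B" for n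
        using AE_circle_norm by eventually_elim (use r(1,2)[of n] in \<open>auto intro!: B simp: norm_mult\<close>)
    qed (use p in simp_all)
    then show ?thesis
      by (rule tendsto_upperbound) (use dil r in auto)
  qed
  then have "\<forall>b v. b \<in> borel_measurable borel \<longrightarrow> integrable circle (\<lambda>z. norm (b z) powr p) \<longrightarrow>
     (\<forall>n. coef b (int n) = coeff v n) \<longrightarrow>
    (LINT z|circle. norm (poly v z) powr p) \<le> C * (LINT z|circle. norm (b z) powr p)"
    by (intro allI impI) auto
  with C show ?thesis by (intro exI[of _ C] conjI)
qed

section \<open>The Hahn-Banach theorem\<close>

lemma chain_subset_Union_pair:
  assumes "chain\<^sub>\<subseteq> c" "x \<in> \<Union>c" "y \<in> \<Union>c"
  shows "\<exists>G\<in>c. x \<in> G \<and> y \<in> G"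
proof -
  obtain X Y where XY: "X \<in> c" "x \<in> X" "Y \<in> c" "y \<in> Y" using assms by auto
  then have "X \<subseteq> Y \<or> Y \<subseteq> X" using assms(1) by (simp add: chain_subset_def)
  then show ?thesis using XY by auto
qed

text \<open>Zorn's lemma is applied to graphs of linear functionals that are dominated by \<open>q\<close>.\<close>

theorem Hahn_Banach_dominated:
  fixes E M :: "'a::real_vector set" and f :: "'a \<Rightarrow> real" and q :: "'a \<Rightarrow> real"
  assumes E: "subspace E" and M: "subspace M" "M \<subseteq> E"
    and f_add: "\<And>x y. x \<in> M \<Longrightarrow> y \<in> M \<Longrightarrow> f (x + y) = f x + f y"
    and f_scale: "\<And>r x. x \<in> M \<Longrightarrow> f (r *\<^sub>R x) = r * f x"
    and q_add: "\<And>x y. x \<in> E \<Longrightarrow> y \<in> E \<Longrightarrow> q (x + y) \<le> q x + q y"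
    and q_scale: "\<And>r x. x \<in> E \<Longrightarrow> r > 0 \<Longrightarrow> q (r *\<^sub>R x) = r * q x"
    and f_le: "\<And>x. x \<in> M \<Longrightarrow> f x \<le> q x"
  shows "\<exists>g. (\<forall>x\<in>M. g x = f x) \<and> (\<forall>x\<in>E. \<forall>y\<in>E. g (x + y) = g x + g y) \<and>
    (\<forall>r. \<forall>x\<in>E. g (r *\<^sub>R x) = r * g x) \<and> (\<forall>x\<in>E. g x \<le> q x)"
proof -
  define adm where "adm = (\<lambda>G :: ('a \<times> real) set. subspace G \<and> fst ` G \<subseteq> E \<and> (\<forall>(x, a)\<in>G. a \<le> q x)
     \<and> (\<forall>x\<in>M. (x, f x) \<in> G))"
  define A where "A = Collect adm"
  have G0: "(\<lambda>x. (x, f x)) ` M \<in> A"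
  proof -
    have "f 0 = 0" using f_scale[of 0 0] M(1) by (simp add: subspace_0)
    then have "subspace ((\<lambda>x. (x, f x)) ` M)"
      using M(1) unfolding subspace_def by (auto simp: zero_prod_def f_add f_scale image_iff)
    then show ?thesis using M f_le by (auto simp: A_def adm_def)
  qed
  have "\<exists>G\<in>A. \<forall>X\<in>A. G \<subseteq> X \<longrightarrow> X = G"
  proof (rule subset_Zorn_nonempty)
    show "A \<noteq> {}" using G0 by auto
    fix c assume c: "c \<noteq> {}" "subset.chain A c"
    then have ch: "chain\<^sub>\<subseteq> c" and cA: "\<And>G. G \<in> c \<Longrightarrow> adm G"
      by (auto simp: subset_chain_def chain_subset_def A_def)
    note two = chain_subset_Union_pair[OF ch]
    have "subspace (\<Union>c)"
    proof (rule subspaceI)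
      show "0 \<in> \<Union>c" using c(1) cA by (auto simp: adm_def subspace_0)
      show "x + y \<in> \<Union>c" if "x \<in> \<Union>c" "y \<in> \<Union>c" for x y
        using two[OF that] cA by (auto simp: adm_def intro: subspace_add)
      show "r *\<^sub>R x \<in> \<Union>c" if "x \<in> \<Union>c" for r x
        using that cA by (auto simp: adm_def intro: subspace_scale)
    qed
    moreover have "fst ` \<Union>c \<subseteq> E" "\<forall>(x, a)\<in>\<Union>c. a \<le> q x" "\<forall>x\<in>M. (x, f x) \<in> \<Union>c"
      using cA c(1) unfolding adm_def by fast+
    ultimately show "\<Union>c \<in> A" by (simp add: A_def adm_def)
  qed
  then obtain G where G: "adm G" and max: "\<And>X. adm X \<Longrightarrow> G \<subseteq> X \<Longrightarrow> X = G"
    by (auto simp: A_def)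
  have sG: "subspace G" and GE: "\<And>x a. (x, a) \<in> G \<Longrightarrow> x \<in> E" and Gq: "\<And>x a. (x, a) \<in> G \<Longrightarrow> a \<le> q x"
    and GM: "\<And>x. x \<in> M \<Longrightarrow> (x, f x) \<in> G"
    using G unfolding adm_def by force+
  have Gadd: "(x + y, a + b) \<in> G" if "(x, a) \<in> G" "(y, b) \<in> G" for x y a b
    using subspace_add[OF sG that] by simp
  have Gsc: "(r *\<^sub>R x, r * a) \<in> G" if "(x, a) \<in> G" for r x a
    using subspace_scale[OF sG that, of r] by simp
  have q0: "q 0 = 0" using q_scale[of 0 2] subspace_0[OF E] by simp
  \<comment> \<open>A subspace below \<open>q\<close> contains no vertical vector, since both a and
    -a would be at most q 0 = 0; hence \<open>G\<close> is a graph.\<close>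
  have G0': "a = 0" if "(0, a) \<in> G" for a
    using Gq[OF that] Gq[OF Gsc[OF that, of "-1"]] q0 by simp
  have uniq: "a = b" if "(x, a) \<in> G" "(x, b) \<in> G" for x a b
    using G0'[of "a - b"] Gadd[OF that(1) Gsc[OF that(2), of "-1"]] by simp
  have total: "\<exists>a. (v, a) \<in> G" if v: "v \<in> E" for v
  proof (rule ccontr)
    assume nv: "\<nexists>a. (v, a) \<in> G"
    \<comment> \<open>The admissible values of an extension at \<open>v\<close> lie between all
      left-hand and all right-hand sides of this inequality; the \<open>c\<close> chosen next is the
      least of them.\<close>
    have sep: "a - q (x - v) \<le> q (y + v) - b" if "(x, a) \<in> G" "(y, b) \<in> G" for x y a b
    proof -
      have "a + b \<le> q (x + y)" using Gq[OF Gadd[OF that]] .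
      also have "x + y = (x - v) + (y + v)" by simp
      also have "q \<dots> \<le> q (x - v) + q (y + v)"
        using GE that v by (intro q_add subspace_diff[OF E] subspace_add[OF E]) auto
      finally show ?thesis by simp
    qed
    define S where "S = {a - q (x - v) | x a. (x, a) \<in> G}"
    have "(0, 0) \<in> G" using subspace_0[OF sG] by (simp add: zero_prod_def)
    then have Sne: "S \<noteq> {}" by (auto simp: S_def)
    have Sbdd: "bdd_above S"
      unfolding S_def by (rule bdd_aboveI[of _ "q (0 + v) - 0"]) (use sep \<open>(0, 0) \<in> G\<close> in blast)
    define c where "c = Sup S"
    have c1: "a - q (x - v) \<le> c" if "(x, a) \<in> G" for x a
      unfolding c_def by (rule cSup_upper[OF _ Sbdd]) (use that in \<open>auto simp: S_def\<close>)
    have c2: "c \<le> q (y + v) - b" if "(y, b) \<in> G" for y b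
      unfolding c_def by (rule cSup_least[OF Sne]) (use sep[OF _ that] in \<open>auto simp: S_def\<close>)
    define G' where "G' = {(x + r *\<^sub>R v, a + r * c) | x a r. (x, a) \<in> G}"
    have G'I: "(x + r *\<^sub>R v, a + r * c) \<in> G'" if "(x, a) \<in> G" for x a r
      using that by (auto simp: G'_def)
    have GG': "G \<subseteq> G'"
    proof
      fix w assume "w \<in> G"
      then show "w \<in> G'" using G'I[of "fst w" "snd w" 0] by simp
    qed
    \<comment> \<open>Scaling by 1 / |r| reduces to r = 1 and r = -1, which are the upper and the
      lower bound for \<open>c\<close>.\<close>
    have dom: "a + r * c \<le> q (x + r *\<^sub>R v)" if "(x, a) \<in> G" for x a r
    proof -
      consider "r = 0" | "r > 0" | "r < 0" by linarith
      then show ?thesis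
      proof cases
        case 1
        then show ?thesis using Gq[OF that] by simp
      next
        case 2
        have "c \<le> q ((1 / r) *\<^sub>R x + v) - (1 / r) * a" by (rule c2[OF Gsc[OF that]])
        then have "r * c \<le> r * (q ((1 / r) *\<^sub>R x + v) - (1 / r) * a)" using 2 by (intro mult_left_mono) auto
        also have "\<dots> = q (r *\<^sub>R ((1 / r) *\<^sub>R x + v)) - a"
          using 2 GE[OF that] v by (subst q_scale) (auto intro!: subspace_add[OF E] subspace_scale[OF E] simp: right_diff_distrib)
        also have "r *\<^sub>R ((1 / r) *\<^sub>R x + v) = x + r *\<^sub>R v" using 2 by (simp add: scaleR_add_right)
        finally show ?thesis by simp
      next
        case 3
        define s where "s = - r"
        have s: "s > 0" using 3 by (simp add: s_def)
        have "(1 / s) * a - q ((1 / s) *\<^sub>R x - v) \<le> c" by (rule c1[OF Gsc[OF that]])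
        then have "s * ((1 / s) * a - q ((1 / s) *\<^sub>R x - v)) \<le> s * c" using s by (intro mult_left_mono) auto
        moreover have "s * ((1 / s) * a - q ((1 / s) *\<^sub>R x - v)) = a - q (s *\<^sub>R ((1 / s) *\<^sub>R x - v))"
          using s GE[OF that] v by (subst q_scale) (auto intro!: subspace_diff[OF E] subspace_scale[OF E] simp: right_diff_distrib)
        moreover have "s *\<^sub>R ((1 / s) *\<^sub>R x - v) = x + r *\<^sub>R v" using s by (simp add: scaleR_diff_right s_def)
        ultimately show ?thesis by (simp add: s_def)
      qed
    qed
    have "subspace G'"
    proof (rule subspaceI)
      show "0 \<in> G'" using GG' subspace_0[OF sG] by auto
      fix w w' assume "w \<in> G'" "w' \<in> G'"
      then obtain x a r x' a' r' where w: "w = (x + r *\<^sub>R v, a + r * c)" "(x, a) \<in> G"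
        "w' = (x' + r' *\<^sub>R v, a' + r' * c)" "(x', a') \<in> G"
        by (auto simp: G'_def)
      have "w + w' = ((x + x') + (r + r') *\<^sub>R v, (a + a') + (r + r') * c)"
        by (simp add: w algebra_simps)
      then show "w + w' \<in> G'" using G'I[OF Gadd[OF w(2,4)]] by simp
    next
      fix s w assume "w \<in> G'"
      then obtain x a r where w: "w = (x + r *\<^sub>R v, a + r * c)" "(x, a) \<in> G" by (auto simp: G'_def)
      have "s *\<^sub>R w = (s *\<^sub>R x + (s * r) *\<^sub>R v, s * a + (s * r) * c)"
        by (simp add: w algebra_simps)
      then show "s *\<^sub>R w \<in> G'" using G'I[OF Gsc[OF w(2)]] by simp
    qed
    moreover have "fst ` G' \<subseteq> E"
      using GE v by (auto simp: G'_def intro!: subspace_add[OF E] subspace_scale[OF E])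
    moreover have "\<forall>(x, a)\<in>G'. a \<le> q x" using dom by (auto simp: G'_def)
    moreover have "\<forall>x\<in>M. (x, f x) \<in> G'" using GM GG' by auto
    ultimately have "adm G'" by (simp add: adm_def)
    from max[OF this GG'] have "(v, c) \<in> G" using G'I[OF \<open>(0, 0) \<in> G\<close>, of 1] by simp
    with nv show False by blast
  qed
  define g where "g x = (THE a. (x, a) \<in> G)" for x
  have g: "(x, g x) \<in> G" if "x \<in> E" for x
    unfolding g_def using total[OF that] uniq by (metis theI)
  have geq: "g x = a" if "(x, a) \<in> G" for x a
    using uniq[OF g[OF GE[OF that]] that] .
  show ?thesis
  proof (intro exI[of _ g] conjI ballI allI)
    show "g x = f x" if "x \<in> M" for x using geq[OF GM[OF that]] .
    show "g (x + y) = g x + g y" if "x \<in> E" "y \<in> E" for x y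
      by (rule geq[OF Gadd[OF g[OF that(1)] g[OF that(2)]]])
    show "g (r *\<^sub>R x) = r * g x" if "x \<in> E" for r x
      by (rule geq[OF Gsc[OF g[OF that]]])
    show "g x \<le> q x" if "x \<in> E" for x by (rule Gq[OF g[OF that]])
  qed
qed

section \<open>Reflecting the zeros of a polynomial\<close>

text \<open>Each zero \<open>a\<close> in the open disc is reflected: 1 - conj(a) z has the modulus
  of z - a on the circle, at least that modulus inside, and no zero in the disc. Thus
  \<open>G\<close> is \<open>F\<close> divided by a finite Blaschke product.\<close>

lemma reflect_zeros:
  fixes F :: "complex poly"
  assumes "F \<noteq> 0"
  shows "\<exists>G. (\<forall>z. norm z < 1 \<longrightarrow> poly G z \<noteq> 0) \<and> (\<forall>z. norm z \<le> 1 \<longrightarrow> norm (poly F z) \<le> norm (poly G z)) \<and>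
    (\<forall>z. norm z = 1 \<longrightarrow> norm (poly G z) = norm (poly F z))"
  using assms
proof (induction "degree F" arbitrary: F)
  case 0
  then obtain c where "F = [:c:]" using degree_eq_zeroE by metis
  with 0 show ?case by (intro exI[of _ F]) auto
next
  case (Suc n)
  then obtain a where "poly F a = 0" using alg_closed_imp_poly_has_root[of F] by auto
  then obtain H where H: "F = [:-a, 1:] * H" by (metis dvdE poly_eq_0_iff_dvd)
  have "H \<noteq> 0" using Suc(3) H by auto
  have "n = degree H"
    using Suc(2) \<open>H \<noteq> 0\<close> unfolding H by (subst (asm) degree_mult_eq) simp_all
  have ev0: "poly ([:-a, 1:] * X) z = (z - a) * poly X z" for X z
    by (simp add: algebra_simps)
  from Suc(1)[OF \<open>n = degree H\<close> \<open>H \<noteq> 0\<close>] obtain G where G: "\<And>z. norm z < 1 \<Longrightarrow> poly G z \<noteq> 0"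
    "\<And>z. norm z \<le> 1 \<Longrightarrow> norm (poly H z) \<le> norm (poly G z)" "\<And>z. norm z = 1 \<Longrightarrow> norm (poly G z) = norm (poly H z)"
    by auto
  show ?case
  proof (cases "norm a < 1")
    case False
    show ?thesis
    proof (intro exI[of _ "[:-a, 1:] * G"] conjI allI impI)
      fix z :: complex
      show "norm z < 1 \<Longrightarrow> poly ([:-a, 1:] * G) z \<noteq> 0" using G(1)[of z] False by auto
      show "norm z \<le> 1 \<Longrightarrow> norm (poly F z) \<le> norm (poly ([:-a, 1:] * G) z)"
        unfolding H ev0 norm_mult using G(2)[of z] by (intro mult_left_mono) auto
      show "norm z = 1 \<Longrightarrow> norm (poly ([:-a, 1:] * G) z) = norm (poly F z)"
        unfolding H ev0 norm_mult using G(3)[of z] by simp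
    qed
  next
    case True
    have sq: "(norm (1 - cnj a * z))\<^sup>2 - (norm (z - a))\<^sup>2 = (1 - (norm a)\<^sup>2) * (1 - (norm z)\<^sup>2)" for z
      unfolding cmod_power2 by (simp add: power2_eq_square algebra_simps)
    have le: "norm (z - a) \<le> norm (1 - cnj a * z)" if "norm z \<le> 1" for z
    proof -
      have "0 \<le> (1 - (norm a)\<^sup>2) * (1 - (norm z)\<^sup>2)" using that True by (intro mult_nonneg_nonneg) (simp_all add: power_le_one)
      then have "(norm (z - a))\<^sup>2 \<le> (norm (1 - cnj a * z))\<^sup>2" using sq[of z] by linarith
      then show ?thesis by (rule power2_le_imp_le) simp
    qed
    have eq: "norm (1 - cnj a * z) = norm (z - a)" if "norm z = 1" for z
    proof -
      have "(norm (1 - cnj a * z))\<^sup>2 = (norm (z - a))\<^sup>2" using sq[of z] that by simp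
      then show ?thesis by (rule power2_eq_imp_eq) simp_all
    qed
    have ev: "poly ([:1, - cnj a:] * G) z = (1 - cnj a * z) * poly G z" "poly F z = (z - a) * poly H z" for z
      by (simp_all add: H algebra_simps)
    show ?thesis
    proof (intro exI[of _ "[:1, - cnj a:] * G"] conjI allI impI)
      fix z :: complex
      show "poly ([:1, - cnj a:] * G) z \<noteq> 0" if "norm z < 1"
      proof -
        have "norm (cnj a * z) < 1 * 1" unfolding norm_mult using that True by (intro mult_strict_mono') auto
        then have "cnj a * z \<noteq> 1" by auto
        then show ?thesis unfolding ev using G(1)[OF that] by simp
      qed
      show "norm (poly F z) \<le> norm (poly ([:1, - cnj a:] * G) z)" if "norm z \<le> 1"
        unfolding ev norm_mult using le[OF that] G(2)[OF that] by (intro mult_mono) auto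
      show "norm (poly ([:1, - cnj a:] * G) z) = norm (poly F z)" if "norm z = 1"
        unfolding ev norm_mult using eq[OF that] G(3)[OF that] by simp
    qed
  qed
qed

text \<open>Taylor polynomials about 0. The value at 0 is kept exactly because the estimate for
  products of polynomials requires one factor to vanish there.\<close>

lemma holomorphic_poly_approx:
  assumes "f holomorphic_on ball 0 R" "R > 1" "e > 0"
  shows "\<exists>u. poly u 0 = f 0 \<and> (\<forall>z. norm z \<le> 1 \<longrightarrow> norm (poly u z - f z) < e)"
proof -
  define a where "a n = (deriv ^^ n) f 0 / fact n" for n
  have "uniform_limit (cball 0 1) (\<lambda>N z. \<Sum>n<N. a n * z ^ n) f sequentially"
  proof -
    have "uniform_limit (cball 0 1) (\<lambda>N z. \<Sum>n<N. a n * (z - 0) ^ n) (\<lambda>z. \<Sum>n. a n * (z - 0) ^ n) sequentially"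
    proof (rule powser_uniform_limit)
      have "ereal R \<le> conv_radius a"
      proof (rule conv_radius_geI_ex')
        fix r :: real assume r: "0 < r" "ereal r < ereal R"
        have "(\<lambda>n. a n * (of_real r - 0) ^ n) sums f (of_real r)"
          unfolding a_def using assms(1) r by (intro holomorphic_power_series) auto
        then show "summable (\<lambda>n. a n * of_real r ^ n)" by (simp add: sums_iff)
      qed
      then show "ereal 1 < conv_radius a" using assms(2) by (meson ereal_less_eq(3) less_ereal.simps(1) less_le_trans)
    qed
    moreover have "(\<Sum>n. a n * (z - 0) ^ n) = f z" if "z \<in> cball 0 1" for z
    proof -
      have "(\<lambda>n. a n * (z - 0) ^ n) sums f z"
        unfolding a_def using assms that by (intro holomorphic_power_series) auto
      then show ?thesis by (rule sums_unique[symmetric])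
    qed
    ultimately show ?thesis by (subst uniform_limit_cong'[where g = "\<lambda>N z. \<Sum>n<N. a n * (z - 0) ^ n" and i = "\<lambda>z. \<Sum>n. a n * (z - 0) ^ n"]) auto
  qed
  then have "eventually (\<lambda>N. \<forall>z\<in>cball 0 1. dist (\<Sum>n<N. a n * z ^ n) (f z) < e) sequentially"
    using assms(3) by (rule uniform_limitD)
  then obtain N0 where N0: "\<And>N. N \<ge> N0 \<Longrightarrow> \<forall>z\<in>cball 0 1. dist (\<Sum>n<N. a n * z ^ n) (f z) < e"
    unfolding eventually_sequentially by blast
  \<comment> \<open>At least one term, so that the constant coefficient is present.\<close>
  define u where "u = (\<Sum>n<Suc N0. monom (a n) n)"
  have u: "poly u z = (\<Sum>n<Suc N0. a n * z ^ n)" for z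
    by (simp add: u_def poly_sum poly_monom del: sum.lessThan_Suc)
  have "poly u 0 = a 0"
    unfolding u by (subst sum.lessThan_Suc_shift) simp
  then have "poly u 0 = f 0" by (simp add: a_def)
  moreover have "norm (poly u z - f z) < e" if "norm z \<le> 1" for z
    using N0[of "Suc N0"] that unfolding u by (simp add: dist_norm del: sum.lessThan_Suc)
  ultimately show ?thesis by blast
qed

section \<open>Trigonometric sums\<close>

definition trig_sum :: "int set \<Rightarrow> (int \<Rightarrow> complex) \<Rightarrow> complex \<Rightarrow> complex" where
  "trig_sum A a z = (\<Sum>n\<in>A. a n * z powi n)"

lemma borel_measurable_trig_sum [measurable]: "trig_sum A a \<in> borel_measurable borel"
  unfolding trig_sum_def[abs_def] by measurable

lemma norm_trig_sum_le: "norm z = 1 \<Longrightarrow> norm (trig_sum A a z) \<le> (\<Sum>n\<in>A. norm (a n))"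
  unfolding trig_sum_def by (rule sum_norm_le) (simp add: norm_mult norm_power_int)

lemma AE_norm_trig_sum: "AE z in circle. norm (trig_sum A a z) \<le> (\<Sum>n\<in>A. norm (a n))"
  using AE_circle_norm by eventually_elim (rule norm_trig_sum_le)

lemma integrable_trig_sum [simp]: "integrable circle (trig_sum A a)"
  using AE_norm_trig_sum by (rule integrable_circle_bounded[rotated]) simp

lemma coef_trig_sum:
  assumes "finite A"
  shows "coef (trig_sum A a) k = (if k \<in> A then a k else 0)"
proof -
  have "coef (trig_sum A a) k = (LINT z|circle. (\<Sum>n\<in>A. a n * (z powi n * z powi (- k))))"
    unfolding coef_def trig_sum_def by (simp add: sum_distrib_right mult.assoc)
  also have "\<dots> = (\<Sum>n\<in>A. LINT z|circle. a n * (z powi n * z powi (- k)))"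
  proof (rule Bochner_Integration.integral_sum)
    fix n
    show "integrable circle (\<lambda>z. a n * (z powi n * z powi - k))"
      using integrable_mult_powi[OF integrable_trig_sum[of "{n}" "\<lambda>_. a n"], of "- k"]
      by (simp add: trig_sum_def mult.assoc)
  qed
  also have "\<dots> = (\<Sum>n\<in>A. a n * coef (\<lambda>z. z powi n) k)"
    by (simp add: coef_def)
  also have "\<dots> = (\<Sum>n\<in>A. if n = k then a n else 0)"
    by (intro sum.cong) (auto simp: coef_powi)
  finally show ?thesis using assms by simp
qed

lemma cnj_powi_circle:
  assumes "norm z = 1"
  shows "cnj (z powi n) = z powi (- n)"
proof -
  have "cnj (z powi n) = cnj z powi n" by (simp add: power_int_def)
  also have "\<dots> = z powi (- n)"
    using norm_1_cnj[OF assms] by (simp add: power_int_minus power_int_inverse)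
  finally show ?thesis .
qed

lemma integral_norm2_trig_sum:
  assumes "finite A"
  shows "integrable circle (\<lambda>z. (norm (trig_sum A a z))\<^sup>2)"
    and "(LINT z|circle. (norm (trig_sum A a z))\<^sup>2) = (\<Sum>n\<in>A. (norm (a n))\<^sup>2)"
proof -
  show int: "integrable circle (\<lambda>z. (norm (trig_sum A a z))\<^sup>2)"
  proof (rule integrable_circle_bounded)
    show "AE z in circle. norm ((norm (trig_sum A a z))\<^sup>2) \<le> (\<Sum>n\<in>A. norm (a n))\<^sup>2"
      using AE_norm_trig_sum[of A a] by eventually_elim (simp add: power_mono)
  qed simp
  have "complex_of_real (LINT z|circle. (norm (trig_sum A a z))\<^sup>2) = (LINT z|circle. of_real ((norm (trig_sum A a z))\<^sup>2))"
    by (rule integral_complex_of_real[symmetric])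
  also have "\<dots> = (LINT z|circle. (\<Sum>n\<in>A. cnj (a n) * (trig_sum A a z * z powi (- n))))"
  proof (rule integral_cong_AE)
    show "AE z in circle. complex_of_real ((norm (trig_sum A a z))\<^sup>2) = (\<Sum>n\<in>A. cnj (a n) * (trig_sum A a z * z powi (- n)))"
      using AE_circle_norm
    proof eventually_elim
      case (elim z)
      have "cnj (trig_sum A a z) = (\<Sum>n\<in>A. cnj (a n) * z powi (- n))"
        unfolding trig_sum_def by (simp only: cnj_sum complex_cnj_mult cnj_powi_circle[OF elim])
      then have eq: "trig_sum A a z * cnj (trig_sum A a z) = (\<Sum>n\<in>A. cnj (a n) * (trig_sum A a z * z powi (- n)))"
        by (simp add: sum_distrib_left mult_ac)
      show ?case unfolding complex_norm_square by (rule eq)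
    qed
  qed (use borel_measurable_trig_sum in measurable)
  also have "\<dots> = (\<Sum>n\<in>A. LINT z|circle. cnj (a n) * (trig_sum A a z * z powi (- n)))"
    by (intro Bochner_Integration.integral_sum integrable_mult_right integrable_mult_powi integrable_trig_sum)
  also have "\<dots> = (\<Sum>n\<in>A. cnj (a n) * coef (trig_sum A a) n)"
    by (simp add: coef_def)
  also have "\<dots> = of_real (\<Sum>n\<in>A. (norm (a n))\<^sup>2)"
    unfolding coef_trig_sum[OF assms] of_real_sum
    by (intro sum.cong) (auto simp: mult.commute complex_norm_square simp flip: of_real_power)
  finally show "(LINT z|circle. (norm (trig_sum A a z))\<^sup>2) = (\<Sum>n\<in>A. (norm (a n))\<^sup>2)"
    by (simp only: of_real_eq_iff)
qed

text \<open>The inequality 2 x <= l x^2 + 1 / l takes the place of Cauchy-Schwarz; \<open>l\<close>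
  is tuned to the size of the square sum at each use.\<close>

lemma integral_norm_trig_sum_le:
  assumes "finite A" "l > 0"
  shows "(LINT z|circle. norm (trig_sum A a z)) \<le> (l * (\<Sum>n\<in>A. (norm (a n))\<^sup>2) + 1 / l) / 2"
proof -
  have "(LINT z|circle. norm (trig_sum A a z)) \<le> (LINT z|circle. (l * (norm (trig_sum A a z))\<^sup>2 + 1 / l) / 2)"
  proof (rule integral_mono)
    fix z
    have "0 \<le> (l * norm (trig_sum A a z) - 1)\<^sup>2 / l" using assms by simp
    also have "\<dots> = l * (norm (trig_sum A a z))\<^sup>2 + 1 / l - 2 * norm (trig_sum A a z)"
      using assms by (simp add: power2_eq_square field_simps)
    finally show "norm (trig_sum A a z) \<le> (l * (norm (trig_sum A a z))\<^sup>2 + 1 / l) / 2" by simp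
  qed (use integral_norm2_trig_sum(1)[OF assms(1)] in auto)
  also have "\<dots> = (l * (\<Sum>n\<in>A. (norm (a n))\<^sup>2) + 1 / l) / 2"
    using integral_norm2_trig_sum[OF assms(1)] circle.prob_space by simp
  finally show ?thesis .
qed

text \<open>Convergence is taken in L^1, which suffices because the coefficients are continuous for
  the L^1 norm. An almost everywhere limit of a subsequence supplies \<open>f\<close>, and Fatou's
  lemma shows that the whole sequence tends to it in L^1.\<close>

lemma Riesz_Fischer:
  assumes B: "\<And>N. (\<Sum>n\<in>{- int N..int N}. (norm (a n))\<^sup>2) \<le> B"
  shows "\<exists>f. integrable circle f \<and> (\<forall>n. coef f n = a n)"
proof -
  define A where "A N = {- int N..int N}" for N
  define s where "s N = trig_sum (A N) a" for N
  define S where "S N = (\<Sum>n\<in>A N. (norm (a n))\<^sup>2)" for N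
  have sint [simp]: "integrable circle (s N)" for N by (simp add: s_def)
  have smeas [measurable]: "s N \<in> borel_measurable borel" for N by (simp add: s_def)
  have "incseq S"
    unfolding incseq_def S_def by (auto intro!: sum_mono2 simp: A_def)
  moreover have "\<forall>N. S N \<le> B" using B by (simp add: S_def A_def)
  ultimately obtain L where "S \<longlonglongrightarrow> L" by (rule incseq_convergent)
  then have "convergent S" by (rule convergentI)
  then have "Cauchy S" by (rule convergent_Cauchy)
  have diff: "(LINT z|circle. norm (s i z - s j z)) \<le> (l * (S i - S j) + 1 / l) / 2" if "j \<le> i" "l > 0" for i j l
  proof -
    have sub: "A j \<subseteq> A i" "finite (A i)" using that by (auto simp: A_def)
    have "s i z - s j z = trig_sum (A i - A j) a z" for z
      unfolding s_def trig_sum_def using sub by (subst sum.subset_diff[of "A j" "A i"]) auto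
    moreover have "S i - S j = (\<Sum>n\<in>A i - A j. (norm (a n))\<^sup>2)"
      unfolding S_def using sub by (simp add: sum.subset_diff[of "A j" "A i"])
    ultimately show ?thesis using integral_norm_trig_sum_le[of "A i - A j" l a] that sub by simp
  qed
  have Cauchy1: "\<exists>N. \<forall>i\<ge>N. \<forall>j\<ge>N. (LINT z|circle. norm (s i z - s j z)) < e" if "e > 0" for e
  proof -
    obtain N where N: "\<And>i j. i \<ge> N \<Longrightarrow> j \<ge> N \<Longrightarrow> \<bar>S i - S j\<bar> < e\<^sup>2"
      using CauchyD[OF \<open>Cauchy S\<close> zero_less_power[OF \<open>e > 0\<close>, of 2]] by auto
    have *: "(LINT z|circle. norm (s i z - s j z)) < e" if "i \<ge> N" "j \<ge> N" "j \<le> i" for i j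
    proof -
      \<comment> \<open>The choice l = 1 / e balances the two terms of \<open>diff\<close>: the
        bound stays below (e + e) / 2.\<close>
      have "(1 / e) * (S i - S j) < (1 / e) * e\<^sup>2"
        using N[OF that(1,2)] \<open>e > 0\<close> by (intro mult_strict_left_mono) auto
      also have "\<dots> = e" using \<open>e > 0\<close> by (simp add: power2_eq_square)
      finally show ?thesis using diff[OF that(3), of "1 / e"] \<open>e > 0\<close> by simp
    qed
    then have "(LINT z|circle. norm (s i z - s j z)) < e" if "i \<ge> N" "j \<ge> N" for i j
    proof (cases "j \<le> i")
      case True
      then show ?thesis by (rule *[OF that])
    next
      case False
      then have "i \<le> j" by simp
      from *[OF that(2,1) this] show ?thesis by (subst norm_minus_commute)
    qed
    then show ?thesis by blast
  qed
  obtain r where r: "strict_mono r" "AE z in circle. Cauchy (\<lambda>i. s (r i) z)"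
    by (rule cauchy_L1_AE_cauchy_subseq[OF sint Cauchy1])
  define f where "f z = lim (\<lambda>i. s (r i) z)" for z
  have conv: "AE z in circle. (\<lambda>i. s (r i) z) \<longlonglongrightarrow> f z"
    using r(2) by eventually_elim (simp add: f_def Cauchy_convergent_iff convergent_LIMSEQ_iff)
  have [measurable]: "f \<in> borel_measurable borel"
    unfolding f_def[abs_def] by (intro borel_measurable_lim_metric) simp
  have L1: "\<exists>N. \<forall>i\<ge>N. (\<integral>\<^sup>+z. norm (s i z - f z) \<partial>circle) \<le> ennreal e" if "e > 0" for e
  proof -
    obtain N where N: "\<And>i j. i \<ge> N \<Longrightarrow> j \<ge> N \<Longrightarrow> (LINT z|circle. norm (s i z - s j z)) < e"
      using Cauchy1[OF \<open>e > 0\<close>] by blast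
    have "(\<integral>\<^sup>+z. norm (s i z - f z) \<partial>circle) \<le> ennreal e" if "i \<ge> N" for i
    proof -
      have "(\<integral>\<^sup>+z. norm (s i z - f z) \<partial>circle) = (\<integral>\<^sup>+z. liminf (\<lambda>k. ennreal (norm (s i z - s (r k) z))) \<partial>circle)"
      proof (rule nn_integral_cong_AE)
        show "AE z in circle. ennreal (norm (s i z - f z)) = liminf (\<lambda>k. ennreal (norm (s i z - s (r k) z)))"
          using conv
        proof eventually_elim
          case (elim z)
          have "(\<lambda>k. ennreal (norm (s i z - s (r k) z))) \<longlonglongrightarrow> ennreal (norm (s i z - f z))"
            by (intro tendsto_ennrealI tendsto_norm tendsto_diff tendsto_const elim)
          then show ?case by (rule lim_imp_Liminf[OF sequentially_bot, symmetric])
        qed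
      qed
      also have "\<dots> \<le> liminf (\<lambda>k. \<integral>\<^sup>+z. ennreal (norm (s i z - s (r k) z)) \<partial>circle)"
        by (rule nn_integral_liminf) simp
      also have "\<dots> \<le> liminf (\<lambda>k. ennreal e)"
      proof (rule Liminf_mono)
        show "eventually (\<lambda>k. (\<integral>\<^sup>+z. ennreal (norm (s i z - s (r k) z)) \<partial>circle) \<le> ennreal e) sequentially"
          using eventually_ge_at_top[of N]
        proof eventually_elim
          case (elim k)
          have "r k \<ge> N" using seq_suble[OF r(1), of k] elim by simp
          then have "(LINT z|circle. norm (s i z - s (r k) z)) \<le> e" using N[OF that, of "r k"] by simp
          moreover have "(\<integral>\<^sup>+z. ennreal (norm (s i z - s (r k) z)) \<partial>circle) = ennreal (LINT z|circle. norm (s i z - s (r k) z))"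
            by (rule nn_integral_eq_integral) auto
          ultimately show ?case by (simp add: ennreal_leI)
        qed
      qed
      also have "\<dots> = ennreal e" by (simp add: Liminf_const)
      finally show ?thesis .
    qed
    then show ?thesis by blast
  qed
  have f: "integrable circle f"
  proof -
    obtain N where "(\<integral>\<^sup>+z. norm (s N z - f z) \<partial>circle) \<le> ennreal 1" using L1[of 1] by auto
    then have "(\<integral>\<^sup>+z. norm (s N z - f z) \<partial>circle) < \<infinity>" by (rule le_less_trans) simp
    then have "integrable circle (\<lambda>z. s N z - f z)" by (intro integrableI_bounded) simp_all
    from Bochner_Integration.integrable_diff[OF sint[of N] this] show ?thesis by simp
  qed
  have "coef f n = a n" for n
  proof -
    have "norm (coef f n - a n) \<le> e" if "e > 0" for e
    proof -
      obtain N where N: "\<And>i. i \<ge> N \<Longrightarrow> (\<integral>\<^sup>+z. norm (s i z - f z) \<partial>circle) \<le> ennreal e"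
        using L1[OF \<open>e > 0\<close>] by blast
      \<comment> \<open>Large enough for the L^1 estimate and for the index \<open>n\<close> to
        occur in the partial sum, whose coefficient is then exactly \<open>a n\<close>.\<close>
      define i where "i = max N (nat \<bar>n\<bar>)"
      have "n \<in> A i" by (auto simp: A_def i_def)
      then have "a n - coef f n = coef (\<lambda>z. s i z - f z) n"
        using coef_diff[OF sint[of i] f, of n] coef_trig_sum[of "A i" a n] by (simp add: s_def A_def)
      also have "norm \<dots> \<le> (LINT z|circle. norm (s i z - f z))"
        using f by (intro norm_coef_le) auto
      also have "\<dots> \<le> e"
      proof -
        have "ennreal (LINT z|circle. norm (s i z - f z)) = (\<integral>\<^sup>+z. norm (s i z - f z) \<partial>circle)"
          using f by (intro nn_integral_eq_integral[symmetric]) auto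
        also have "\<dots> \<le> ennreal e" using N[of i] by (simp add: i_def)
        finally show ?thesis using \<open>e > 0\<close> by (simp add: ennreal_le_iff)
      qed
      finally show ?thesis by (simp add: norm_minus_commute)
    qed
    then have "norm (coef f n - a n) \<le> 0" by (rule field_le_epsilon) simp
    then show ?thesis by simp
  qed
  with f show ?thesis by (intro exI[of _ f]) simp
qed

lemma poisson_kernel_partial_sums:
  assumes "norm w < 1" "norm z = 1"
  shows "(\<lambda>N. \<Sum>n<N. w ^ n * z powi (- int n) + (if n = 0 then 0 else cnj w ^ n * z powi int n))
      \<longlonglongrightarrow> of_real (poisson_kernel (w * cnj z))"
    and "norm (\<Sum>n<N. w ^ n * z powi (- int n) + (if n = 0 then 0 else cnj w ^ n * z powi int n)) \<le> 2 / (1 - norm w)"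
proof -
  have n1: "norm (w * cnj z) < 1" "norm (cnj w * z) < 1" using assms by (simp_all add: norm_mult)
  have summand: "w ^ n * z powi (- int n) + (if n = 0 then 0 else cnj w ^ n * z powi int n) =
      (w * cnj z) ^ n + (cnj w * z) ^ n - (if n = 0 then 1 else 0)" for n
    using norm_1_cnj[OF assms(2)] by (simp add: power_mult_distrib power_int_minus power_inverse)
  have "(\<lambda>n. (w * cnj z) ^ n + (cnj w * z) ^ n - (if n = 0 then 1 else 0)) sums
      (1 / (1 - w * cnj z) + 1 / (1 - cnj w * z) - 1)"
    by (intro sums_diff sums_add geometric_sums n1 sums_single)
  moreover have "1 / (1 - w * cnj z) + 1 / (1 - cnj w * z) - 1 = complex_of_real (poisson_kernel (w * cnj z))"
  proof -
    have "2 * of_real (Re (1 / (1 - w * cnj z))) = 1 / (1 - w * cnj z) + 1 / (1 - cnj w * z)"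
      using complex_add_cnj[of "1 / (1 - w * cnj z)"] by simp
    then show ?thesis unfolding poisson_kernel_eq_Re[OF n1(1)] by (simp add: Re_divide)
  qed
  ultimately show "(\<lambda>N. \<Sum>n<N. w ^ n * z powi (- int n) + (if n = 0 then 0 else cnj w ^ n * z powi int n))
      \<longlonglongrightarrow> of_real (poisson_kernel (w * cnj z))"
    unfolding summand sums_def by simp
  have "norm (\<Sum>n<N. w ^ n * z powi (- int n) + (if n = 0 then 0 else cnj w ^ n * z powi int n)) \<le> (\<Sum>n<N. 2 * norm w ^ n)"
  proof (rule sum_norm_le)
    fix n
    show "norm (w ^ n * z powi (- int n) + (if n = 0 then 0 else cnj w ^ n * z powi int n)) \<le> 2 * norm w ^ n"
      using norm_triangle_ineq[of "w ^ n * z powi (- int n)" "cnj w ^ n * z powi int n"] assms(2)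
      by (auto simp: norm_mult norm_power norm_power_int)
  qed
  also have "\<dots> = 2 * (\<Sum>n<N. norm w ^ n)" by (rule sum_distrib_left[symmetric])
  also have "(\<Sum>n<N. norm w ^ n) \<le> (\<Sum>n. norm w ^ n)"
    using assms(1) by (intro sum_le_suminf summable_geometric) simp_all
  also have "(\<Sum>n. norm w ^ n) = 1 / (1 - norm w)" using assms(1) by (simp add: suminf_geometric)
  finally show "norm (\<Sum>n<N. w ^ n * z powi (- int n) + (if n = 0 then 0 else cnj w ^ n * z powi int n)) \<le> 2 / (1 - norm w)"
    by simp
qed

section \<open>Extension of bounded functionals\<close>

lemma continuous_on_trig_sum [continuous_intros]: "continuous_on (sphere 0 1) (trig_sum A a)"
  unfolding trig_sum_def[abs_def] by (intro continuous_intros) auto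

text \<open>Functions on the circle become 2 pi periodic bounded continuous functions on the line,
  elements of a type that is a real vector space, as \<open>Hahn_Banach_dominated\<close> requires.
  The functional and the seminorm will be integrals over one period, so they make sense on the whole
  type.\<close>

definition circle_bcontfun :: "(complex \<Rightarrow> complex) \<Rightarrow> real \<Rightarrow>\<^sub>C complex" where
  "circle_bcontfun f = Bcontfun (\<lambda>t. f (cis t))"

lemma apply_circle_bcontfun:
  assumes "continuous_on (sphere 0 1) f"
  shows "apply_bcontfun (circle_bcontfun f) t = f (cis t)"
proof -
  have "compact (f ` sphere 0 1)" by (intro compact_continuous_image assms) simp
  then have "bounded (f ` sphere 0 1)" by (rule compact_imp_bounded)
  then obtain B where B: "\<forall>y\<in>f ` sphere 0 1. norm y \<le> B" unfolding bounded_iff ..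
  have "(\<lambda>t. f (cis t)) \<in> bcontfun"
  proof (rule bcontfun_normI)
    show "continuous_on UNIV (\<lambda>t. f (cis t))"
      by (rule continuous_on_compose2[OF assms]) (auto intro!: continuous_intros)
    show "norm (f (cis t)) \<le> B" for t using B by simp
  qed
  then show ?thesis unfolding circle_bcontfun_def by (simp add: Bcontfun_inverse)
qed

definition seg_mean :: "(real \<Rightarrow> real) \<Rightarrow> real" where
  "seg_mean h = (1 / (2 * pi)) * (LINT t:{0..2*pi}|lborel. h t)"

lemma seg_mean_add:
  assumes "set_integrable lborel {0..2*pi} h" "set_integrable lborel {0..2*pi} k"
  shows "seg_mean (\<lambda>t. h t + k t) = seg_mean h + seg_mean k"
  using assms by (simp add: seg_mean_def set_integral_add distrib_left)

lemma seg_mean_cmult: "seg_mean (\<lambda>t. c * h t) = c * seg_mean h"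
  by (simp add: seg_mean_def)

lemma seg_mean_circle:
  assumes "f \<in> borel_measurable borel"
  shows "seg_mean (\<lambda>t. f (cis t)) = integral\<^sup>L circle f"
  using assms by (simp add: seg_mean_def integral_circle_eq)

lemma set_integrable_norm_bcontfun:
  "set_integrable lborel {0..2*pi} (\<lambda>t. norm (apply_bcontfun h t))"
  by (intro borel_integrable_atLeastAtMost' continuous_intros) simp

lemma set_integrable_mult_bcontfun:
  fixes g :: "real \<Rightarrow> complex"
  assumes g: "set_integrable lborel {0..2*pi} g" and [measurable]: "g \<in> borel_measurable borel"
  shows "set_integrable lborel {0..2*pi} (\<lambda>t. Re (g t * apply_bcontfun h t))"
  unfolding set_integrable_def
proof (rule Bochner_Integration.integrable_bound)
  have [measurable]: "apply_bcontfun h \<in> borel_measurable borel"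
    by (intro borel_measurable_continuous_onI) simp
  show "integrable lborel (\<lambda>t. norm h * norm (indicator {0..2*pi} t *\<^sub>R g t))"
    using g unfolding set_integrable_def by (intro integrable_mult_right integrable_norm)
  show "(\<lambda>t. indicator {0..2*pi} t *\<^sub>R Re (g t * apply_bcontfun h t)) \<in> borel_measurable lborel"
    by measurable
  have "norm (Re (g t * apply_bcontfun h t)) \<le> norm h * norm (g t)" for t
  proof -
    have "norm (Re (g t * apply_bcontfun h t)) \<le> norm (g t) * norm (apply_bcontfun h t)"
      using abs_Re_le_cmod[of "g t * apply_bcontfun h t"] by (simp add: norm_mult)
    also have "\<dots> \<le> norm (g t) * norm h" by (intro mult_left_mono norm_bounded) simp
    finally show ?thesis by (simp add: mult.commute)
  qed
  then show "AE t in lborel. norm (indicator {0..2*pi} t *\<^sub>R Re (g t * apply_bcontfun h t)) \<le>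
      norm (norm h * norm (indicator {0..2*pi} t *\<^sub>R g t))"
    by (intro AE_I2) (simp add: indicator_def)
qed

text \<open>The \<open>a n\<close> are the values on z^(-n) of an extension of the functional F ->
  int g F from polynomials vanishing at 0: they behave like Fourier coefficients, but belong to no
  function yet. The real theorem of Hahn and Banach is applied to the real part, from which a
  complex functional is rebuilt.\<close>

lemma complex_linear_extension:
  fixes g :: "complex \<Rightarrow> complex"
  assumes g: "integrable circle g" and C: "C \<ge> 0"
    and bound: "\<And>F. poly F 0 = 0 \<Longrightarrow> norm (LINT z|circle. g z * poly F z) \<le> C * (LINT z|circle. norm (poly F z))"
  shows "\<exists>a. (\<forall>n. n \<ge> 1 \<longrightarrow> a (- int n) = coef g (- int n)) \<and>
    (\<forall>A c. finite A \<longrightarrow> norm (\<Sum>n\<in>A. c n * a (- n)) \<le> C * (LINT z|circle. norm (trig_sum A c z)))"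
proof -
  have [measurable]: "g \<in> borel_measurable borel" by (rule integrable_circle_measurable[OF g])
  have gs: "set_integrable lborel {0..2*pi} (\<lambda>t. g (cis t))"
    using g by (simp add: integrable_circle_iff)
  define f where "f h = seg_mean (\<lambda>t. Re (g (cis t) * apply_bcontfun h t))" for h
  define q where "q h = C * seg_mean (\<lambda>t. norm (apply_bcontfun h t))" for h :: "real \<Rightarrow>\<^sub>C complex"
  define M where "M = (\<lambda>F. circle_bcontfun (poly F)) ` {F. poly F 0 = 0}"
  define TS where "TS = {f :: complex \<Rightarrow> complex. continuous_on (sphere 0 1) f \<and> f \<in> borel_measurable borel}"
  note app = apply_circle_bcontfun
  have pTS: "poly F \<in> TS" for F by (auto simp: TS_def intro!: continuous_intros)
  have add: "circle_bcontfun (\<lambda>z. x z + y z) = circle_bcontfun x + circle_bcontfun y" if "x \<in> TS" "y \<in> TS" for x y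
    using that by (intro bcontfun_eqI) (simp add: TS_def app continuous_on_add)
  have scale: "circle_bcontfun (\<lambda>z. of_real r * x z) = r *\<^sub>R circle_bcontfun x" if "x \<in> TS" for x r
    using that by (intro bcontfun_eqI) (simp add: TS_def app continuous_on_mult continuous_on_const scaleR_conv_of_real)
  have cTS: "(\<lambda>z. c * x z) \<in> TS" if "x \<in> TS" for x c
    using that by (auto simp: TS_def intro!: continuous_intros)
  have aTS: "(\<lambda>z. x z + y z) \<in> TS" if "x \<in> TS" "y \<in> TS" for x y
    using that by (auto simp: TS_def intro!: continuous_intros)
  have fval: "f (circle_bcontfun x) = Re (LINT z|circle. g z * x z)" if "x \<in> TS" for x
  proof -
    have [measurable]: "x \<in> borel_measurable borel" using that by (simp add: TS_def)
    have "bounded (x ` sphere 0 1)"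
      using that by (intro compact_imp_bounded compact_continuous_image) (auto simp: TS_def)
    then obtain B where B: "\<forall>y\<in>x ` sphere 0 1. norm y \<le> B" unfolding bounded_iff ..
    have "integrable circle (\<lambda>z. g z * x z)"
      by (rule integrable_circle_mult_bounded[OF g, where B = B])
         (use AE_circle_norm B in \<open>auto elim!: eventually_mono\<close>)
    then have "Re (LINT z|circle. g z * x z) = (LINT z|circle. Re (g z * x z))"
      by (rule integral_Re[symmetric])
    also have "\<dots> = seg_mean (\<lambda>t. Re (g (cis t) * x (cis t)))"
      by (rule seg_mean_circle[symmetric]) measurable
    finally show ?thesis using that by (simp add: f_def TS_def app)
  qed
  have qval: "q (circle_bcontfun x) = C * (LINT z|circle. norm (x z))" if "x \<in> TS" for x
  proof -
    have [measurable]: "x \<in> borel_measurable borel" using that by (simp add: TS_def)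
    have "seg_mean (\<lambda>t. norm (x (cis t))) = (LINT z|circle. norm (x z))"
      by (rule seg_mean_circle) measurable
    then show ?thesis using that by (simp add: q_def TS_def app)
  qed
  have fadd: "f (x + y) = f x + f y" for x y
    unfolding f_def plus_bcontfun.rep_eq distrib_left plus_complex.sel
    by (intro seg_mean_add set_integrable_mult_bcontfun gs) measurable
  have fscale: "f (r *\<^sub>R x) = r * f x" for r x
    unfolding f_def scaleR_bcontfun.rep_eq by (simp add: seg_mean_cmult)
  have subM: "subspace M"
  proof (rule subspaceI)
    have "circle_bcontfun (poly 0) = 0"
    proof -
      have "poly 0 = (\<lambda>z. 0 :: complex)" by (simp add: fun_eq_iff)
      then show ?thesis using scale[OF pTS[of 0], of 0] by simp
    qed
    then show "0 \<in> M" unfolding M_def by (intro image_eqI[of _ _ 0]) simp_all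
    fix x y assume "x \<in> M" "y \<in> M"
    then obtain F G where "x = circle_bcontfun (poly F)" "y = circle_bcontfun (poly G)" "poly F 0 = 0" "poly G 0 = 0"
      by (auto simp: M_def)
    then show "x + y \<in> M"
      using add[OF pTS[of F] pTS[of G]] unfolding M_def by (intro image_eqI[of _ _ "F + G"]) (simp_all add: poly_add[abs_def])
  next
    fix r x assume "x \<in> M"
    then obtain F where "x = circle_bcontfun (poly F)" "poly F 0 = 0"
      by (auto simp: M_def)
    then show "r *\<^sub>R x \<in> M"
      using scale[OF pTS[of F], of r] unfolding M_def by (intro image_eqI[of _ _ "smult (of_real r) F"]) (simp_all add: poly_smult[abs_def])
  qed
  have fM: "f x \<le> q x" if "x \<in> M" for x
  proof -
    obtain F where F: "x = circle_bcontfun (poly F)" "poly F 0 = 0" using \<open>x \<in> M\<close> by (auto simp: M_def)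
    show ?thesis unfolding F(1) fval[OF pTS] qval[OF pTS]
      using bound[OF F(2)] complex_Re_le_cmod order_trans by blast
  qed
  have qadd: "q (x + y) \<le> q x + q y" for x y
  proof -
    have "(LINT t:{0..2*pi}|lborel. norm (apply_bcontfun (x + y) t)) \<le>
        (LINT t:{0..2*pi}|lborel. norm (apply_bcontfun x t) + norm (apply_bcontfun y t))"
      by (intro set_integral_mono set_integral_add set_integrable_norm_bcontfun) (simp_all add: norm_triangle_ineq)
    also have "\<dots> = (LINT t:{0..2*pi}|lborel. norm (apply_bcontfun x t)) + (LINT t:{0..2*pi}|lborel. norm (apply_bcontfun y t))"
      by (intro set_integral_add set_integrable_norm_bcontfun)
    finally have "seg_mean (\<lambda>t. norm (apply_bcontfun (x + y) t)) \<le> seg_mean (\<lambda>t. norm (apply_bcontfun x t)) + seg_mean (\<lambda>t. norm (apply_bcontfun y t))"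
      unfolding seg_mean_def distrib_left[symmetric] by (rule mult_left_mono) simp
    then show ?thesis unfolding q_def distrib_left[symmetric] using C by (rule mult_left_mono)
  qed
  have qscale: "q (r *\<^sub>R x) = r * q x" if "r > 0" for r x
    using that unfolding q_def scaleR_bcontfun.rep_eq by (simp add: seg_mean_cmult)
  obtain L where L: "\<forall>x\<in>M. L x = f x" "\<forall>x\<in>UNIV. \<forall>y\<in>UNIV. L (x + y) = L x + L y"
    "\<forall>r. \<forall>x\<in>UNIV. L (r *\<^sub>R x) = r * L x" "\<forall>x\<in>UNIV. L x \<le> q x"
    using Hahn_Banach_dominated[OF subspace_UNIV subM subset_UNIV, of f q] fadd fscale qadd qscale fM by auto
  \<comment> \<open>A complex linear functional is recovered from its real part L as L x - i L (i
    x).\<close>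
  define Lc where "Lc x = Complex (L (circle_bcontfun x)) (- L (circle_bcontfun (\<lambda>z. \<i> * x z)))" for x
  have Lc_add: "Lc (\<lambda>z. x z + y z) = Lc x + Lc y" if "x \<in> TS" "y \<in> TS" for x y
  proof -
    have "(\<lambda>z. \<i> * (x z + y z)) = (\<lambda>z. \<i> * x z + \<i> * y z)" by (simp add: distrib_left)
    then show ?thesis using L(2) that
      by (simp add: Lc_def complex_eq_iff add cTS)
  qed
  have Lc_mult: "Lc (\<lambda>z. c * x z) = c * Lc x" if x: "x \<in> TS" for c x
  proof -
    have lin: "L (circle_bcontfun (\<lambda>z. Complex a b * x z)) = a * L (circle_bcontfun x) + b * L (circle_bcontfun (\<lambda>z. \<i> * x z))" for a b
    proof -
      have "(\<lambda>z. Complex a b * x z) = (\<lambda>z. of_real a * x z + of_real b * (\<i> * x z))"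
        by (simp add: complex_eq_iff fun_eq_iff algebra_simps)
      then have "circle_bcontfun (\<lambda>z. Complex a b * x z) = a *\<^sub>R circle_bcontfun x + b *\<^sub>R circle_bcontfun (\<lambda>z. \<i> * x z)"
        using add[OF cTS[OF x, of "of_real a"] cTS[OF cTS[OF x, of \<i>], of "of_real b"]] scale[OF x, of a] scale[OF cTS[OF x, of \<i>], of b]
        by simp
      then show ?thesis using L(2,3) by simp
    qed
    obtain a b where c: "c = Complex a b" by (cases c)
    have "(\<lambda>z. \<i> * (c * x z)) = (\<lambda>z. Complex (- b) a * x z)"
      by (simp add: c complex_eq_iff fun_eq_iff algebra_simps)
    then show ?thesis unfolding Lc_def c using lin[of a b] lin[of "- b" a]
      by (simp add: c complex_eq_iff algebra_simps)
  qed
  have Lc_le: "norm (Lc x) \<le> C * (LINT z|circle. norm (x z))" if x: "x \<in> TS" for x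
  proof (cases "Lc x = 0")
    case True
    then show ?thesis using C by (simp add: integral_nonneg_AE)
  next
    case False
    \<comment> \<open>A rotation that makes the value of the functional positive, so that the
      one-sided bound on the real part bounds the modulus.\<close>
    define c where "c = cnj (Lc x) / of_real (norm (Lc x))"
    have c: "norm c = 1" "c * Lc x = of_real (norm (Lc x))"
      using False by (auto simp: c_def norm_divide mult.commute complex_norm_square[symmetric] power2_eq_square)
    have "norm (Lc x) = Re (Lc (\<lambda>z. c * x z))" unfolding Lc_mult[OF x] c(2) by simp
    also have "\<dots> = L (circle_bcontfun (\<lambda>z. c * x z))" by (simp add: Lc_def)
    also have "\<dots> \<le> q (circle_bcontfun (\<lambda>z. c * x z))" using L(4) by simp
    also have "\<dots> = C * (LINT z|circle. norm (x z))"
      unfolding qval[OF cTS[OF x]] by (simp add: norm_mult c)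
    finally show ?thesis .
  qed
  define a where "a n = Lc (\<lambda>z. z powi (- n))" for n
  have zTS: "(\<lambda>z. z powi n) \<in> TS" for n :: int
    by (auto simp: TS_def intro!: continuous_intros)
  have tTS: "trig_sum A c \<in> TS" for A c by (simp add: TS_def continuous_on_trig_sum)
  have Lc_sum: "Lc (trig_sum A c) = (\<Sum>n\<in>A. c n * a (- n))" if "finite A" for A c
    using that
  proof (induction A rule: finite_induct)
    case empty
    have "trig_sum {} c = (\<lambda>z. 0 * z powi 0)" by (simp add: trig_sum_def fun_eq_iff)
    then show ?case using Lc_mult[OF zTS[of 0], of 0] by simp
  next
    case (insert m A)
    have "trig_sum (insert m A) c = (\<lambda>z. c m * z powi m + trig_sum A c z)"
      using insert by (simp add: trig_sum_def fun_eq_iff)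
    then have "Lc (trig_sum (insert m A) c) = c m * Lc (\<lambda>z. z powi m) + Lc (trig_sum A c)"
      using Lc_add[OF cTS[OF zTS[of m], of "c m"] tTS[of A c]] Lc_mult[OF zTS[of m], of "c m"] by simp
    then show ?case using insert by (simp add: a_def)
  qed
  have "a (- int n) = coef g (- int n)" if "n \<ge> 1" for n
  proof -
    have mono: "poly (monom c n) = (\<lambda>z. c * z powi int n)" for c :: complex
      by (simp add: poly_monom fun_eq_iff)
    have inM: "circle_bcontfun (\<lambda>z. c * z powi int n) \<in> M" for c
      unfolding M_def mono[symmetric] using that by (intro imageI) (simp add: poly_monom)
    have Lf: "L (circle_bcontfun (\<lambda>z. c * z powi int n)) = Re (c * coef g (- int n))" for c
    proof -
      have "L (circle_bcontfun (\<lambda>z. c * z powi int n)) = Re (LINT z|circle. g z * (c * z powi int n))"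
        using L(1) inM[of c] fval[OF cTS[OF zTS[of "int n"], of c]] by simp
      also have "(LINT z|circle. g z * (c * z powi int n)) = c * coef g (- int n)"
        by (simp add: coef_def mult.left_commute)
      finally show ?thesis .
    qed
    show ?thesis unfolding a_def Lc_def using Lf[of 1] Lf[of \<i>]
      by (simp add: complex_eq_iff)
  qed
  moreover have "norm (\<Sum>n\<in>A. c n * a (- n)) \<le> C * (LINT z|circle. norm (trig_sum A c z))" if "finite A" for A c
    using Lc_le[OF tTS[of A c]] Lc_sum[OF that] by simp
  ultimately show ?thesis by (intro exI[of _ a] conjI allI impI)
qed

text \<open>Testing the functional on the conjugates of its own values makes them square summable,
  so they are the coefficients of some \<open>X\<close>. A Poisson integral of \<open>X\<close> is a
  limit of values of the functional on truncated Poisson kernels, whose L^1 norms tend to 1; hence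
  it is bounded by \<open>C\<close>, and so are its radial limits.\<close>

theorem bounded_extension:
  fixes g :: "complex \<Rightarrow> complex"
  assumes g: "integrable circle g" and C: "C > 0"
    and bound: "\<And>F. poly F 0 = 0 \<Longrightarrow> norm (LINT z|circle. g z * poly F z) \<le> C * (LINT z|circle. norm (poly F z))"
  shows "\<exists>X. X \<in> borel_measurable borel \<and> (AE z in circle. norm (X z) \<le> C) \<and>
    (\<forall>n<0. coef X n = coef g n)"
proof -
  obtain a where a: "\<And>n. n \<ge> 1 \<Longrightarrow> a (- int n) = coef g (- int n)"
    and le: "\<And>A c. finite A \<Longrightarrow> norm (\<Sum>n\<in>A. c n * a (- n)) \<le> C * (LINT z|circle. norm (trig_sum A c z))"
    using complex_linear_extension[OF g less_imp_le[OF C] bound] by auto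
  have Bessel: "(\<Sum>n\<in>{- int N..int N}. (norm (a n))\<^sup>2) \<le> C\<^sup>2" for N
  proof -
    define A where "A = {- int N..int N}"
    define S where "S = (\<Sum>n\<in>A. (norm (a n))\<^sup>2)"
    have neg_sum: "(\<Sum>n\<in>A. h (- n)) = (\<Sum>n\<in>A. h n)" for h :: "int \<Rightarrow> 'x::comm_monoid_add"
      unfolding A_def by (rule sum.reindex_bij_witness[of _ uminus uminus]) auto
    have "(\<Sum>n\<in>A. cnj (a (- n)) * a (- n)) = of_real S"
      unfolding S_def of_real_sum neg_sum[of "\<lambda>n. cnj (a n) * a n"]
      by (rule sum.cong[OF refl]) (simp only: complex_norm_square mult.commute)
    then have "\<bar>S\<bar> \<le> C * (LINT z|circle. norm (trig_sum A (\<lambda>n. cnj (a (- n))) z))"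
      using le[of A "\<lambda>n. cnj (a (- n))"] by (simp add: A_def)
    \<comment> \<open>The parameter l = 1 / C leads to S <= (S + C^2) / 2, which can be solved for
      \<open>S\<close>.\<close>
    also have "\<dots> \<le> C * ((1 / C * (\<Sum>n\<in>A. (norm (cnj (a (- n))))\<^sup>2) + 1 / (1 / C)) / 2)"
      using C by (intro mult_left_mono integral_norm_trig_sum_le) (simp_all add: A_def)
    also have "(\<Sum>n\<in>A. (norm (cnj (a (- n))))\<^sup>2) = S"
      unfolding S_def using neg_sum[of "\<lambda>n. (norm (a n))\<^sup>2"] by simp
    also have "C * ((1 / C * S + 1 / (1 / C)) / 2) = (S + C\<^sup>2) / 2"
      using C by (simp add: field_simps power2_eq_square)
    finally have "S \<le> (S + C\<^sup>2) / 2" by (rule order_trans[OF abs_ge_self])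
    then have "S \<le> C\<^sup>2" by (simp add: field_simps)
    then show ?thesis by (simp add: S_def A_def)
  qed
  obtain X where X: "integrable circle X" "\<And>n. coef X n = a n"
    using Riesz_Fischer[of a "C\<^sup>2", OF Bessel] by auto
  have pb: "norm (poisson X w) \<le> C" if w: "norm w < 1" for w
  proof -
    \<comment> \<open>The coefficient of z^n in the Poisson kernel of the point \<open>w\<close>, as
      a function of z on the circle.\<close>
    define c where "c n = (if n \<ge> 0 then cnj w ^ nat n else w ^ nat (- n))" for n :: int
    define A where "A N = {- int N<..<int N}" for N
    have sumA: "(\<Sum>n\<in>A N. h n) = (\<Sum>n<N. h (- int n) + (if n = 0 then 0 else h (int n)))"
      for N and h :: "int \<Rightarrow> complex"
    proof (induction N)
      case 0
      then show ?case by (simp add: A_def)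
    next
      case (Suc N)
      have "A (Suc N) = A N \<union> {- int N, int N}" by (auto simp: A_def)
      moreover have "A N \<inter> {- int N, int N} = {}" "finite (A N)" by (auto simp: A_def)
      ultimately have "(\<Sum>n\<in>A (Suc N). h n) = (\<Sum>n\<in>A N. h n) + (\<Sum>n\<in>{- int N, int N}. h n)"
        by (simp only: sum.union_disjoint finite_insert finite.emptyI)
      then show ?case using Suc by (cases "N = 0") auto
    qed
    define K where "K N z = (\<Sum>n<N. w ^ n * z powi (- int n) + (if n = 0 then 0 else cnj w ^ n * z powi int n))" for N z
    have K: "trig_sum (A N) c z = K N z" for N z
      unfolding trig_sum_def sumA K_def by (intro sum.cong) (auto simp: c_def)
    have "(\<lambda>N. C * (LINT z|circle. norm (K N z))) \<longlonglongrightarrow> C * (LINT z|circle. poisson_kernel (w * cnj z))"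
    proof (intro tendsto_mult tendsto_const integral_dominated_convergence)
      show "integrable circle (\<lambda>_. 2 / (1 - norm w))" by simp
      show "AE z in circle. norm (norm (K N z)) \<le> 2 / (1 - norm w)" for N
        using AE_circle_norm by eventually_elim (use poisson_kernel_partial_sums(2)[OF w] in \<open>simp add: K_def\<close>)
      show "AE z in circle. (\<lambda>N. norm (K N z)) \<longlonglongrightarrow> poisson_kernel (w * cnj z)"
        using AE_circle_norm
      proof eventually_elim
        case (elim z)
        have "0 \<le> poisson_kernel (w * cnj z)"
          using w elim by (intro poisson_kernel_nonneg) (simp add: norm_mult)
        then show ?case using tendsto_norm[OF poisson_kernel_partial_sums(1)[OF w elim]] by (simp add: K_def)
      qed
    qed (simp_all add: K_def)
    then have lim: "(\<lambda>N. C * (LINT z|circle. norm (K N z))) \<longlonglongrightarrow> C"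
      using integral_poisson_kernel[OF w] by simp
    have "(\<lambda>N. \<Sum>n<N. a (int n) * w ^ n + (if n = 0 then 0 else a (- int n) * cnj w ^ n)) \<longlonglongrightarrow> poisson X w"
      using poisson_sums[OF X(1) w] by (simp add: X(2) sums_def cong: if_cong)
    moreover have "(\<Sum>n<N. a (int n) * w ^ n + (if n = 0 then 0 else a (- int n) * cnj w ^ n)) = (\<Sum>n\<in>A N. c n * a (- n))" for N
      unfolding sumA by (intro sum.cong) (auto simp: c_def)
    ultimately have "(\<lambda>N. norm (\<Sum>n\<in>A N. c n * a (- n))) \<longlonglongrightarrow> norm (poisson X w)"
      by (simp add: tendsto_norm)
    moreover have "norm (\<Sum>n\<in>A N. c n * a (- n)) \<le> C * (LINT z|circle. norm (K N z))" for N
    proof -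
      have "finite (A N)" by (simp add: A_def)
      from le[OF this, of c] show ?thesis by (simp only: K)
    qed
    ultimately show ?thesis by (intro LIMSEQ_le[OF _ lim]) auto
  qed
  have "AE z in circle. norm (X z) \<le> C"
    using Fatou_radial_limit[OF X(1)] AE_circle_norm
  proof eventually_elim
    case (elim z)
    have "eventually (\<lambda>r. norm (poisson X (of_real r * z)) \<le> C) (at_left 1)"
      using eventually_at_left_real[of 0 1] elim(2) by (auto elim!: eventually_mono intro!: pb simp: norm_mult)
    with tendsto_norm[OF elim(1)] show ?case
      by (rule tendsto_upperbound) simp
  qed
  moreover have "coef X n = coef g n" if "n < 0" for n
    using a[of "nat (- n)"] that by (simp add: X(2))
  ultimately show ?thesis using integrable_circle_measurable[OF X(1)] by (intro exI[of _ X]) auto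
qed

section \<open>Factorization of polynomials on the circle\<close>

lemma tendsto_integral_mult_bounded:
  fixes f :: "nat \<Rightarrow> complex \<Rightarrow> complex"
  assumes k: "integrable circle k" and [measurable]: "\<And>n. f n \<in> borel_measurable borel" "h \<in> borel_measurable borel"
    and lim: "AE z in circle. (\<lambda>n. f n z) \<longlonglongrightarrow> h z" and B: "\<And>n. AE z in circle. norm (f n z) \<le> B"
  shows "(\<lambda>n. LINT z|circle. k z * f n z) \<longlonglongrightarrow> (LINT z|circle. k z * h z)"
proof (rule integral_dominated_convergence)
  note [measurable] = integrable_circle_measurable[OF k]
  show "integrable circle (\<lambda>z. B * norm (k z))" using k by simp
  show "AE z in circle. (\<lambda>n. k z * f n z) \<longlonglongrightarrow> k z * h z"
    using lim by eventually_elim (intro tendsto_intros)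
  show "AE z in circle. norm (k z * f n z) \<le> B * norm (k z)" for n
    using B[of n] by eventually_elim (simp add: norm_mult mult.commute[of B] mult_left_mono)
  show "(\<lambda>z. k z * h z) \<in> borel_measurable circle" by simp
  show "(\<lambda>z. k z * f n z) \<in> borel_measurable circle" for n by simp
qed

lemma bounded_holomorphic_closed_disc:
  assumes "f holomorphic_on ball 0 R" "R > 1"
  obtains B where "\<And>z. norm z \<le> 1 \<Longrightarrow> norm (f z) \<le> B"
proof -
  have "continuous_on (cball 0 1) f"
    using assms by (intro holomorphic_on_imp_continuous_on[OF holomorphic_on_subset[OF assms(1)]]) auto
  then have "bounded (f ` cball 0 1)"
    by (intro compact_imp_bounded compact_continuous_image) simp_all
  then obtain B where "\<forall>y\<in>f ` cball 0 1. norm y \<le> B" unfolding bounded_iff ..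
  then show ?thesis by (intro that[of B]) simp
qed

lemma holomorphic_poly_sequence:
  assumes "f holomorphic_on ball 0 R" "R > 1"
  obtains u B where "\<And>n. poly (u n) 0 = f 0" "\<And>n z. norm z \<le> 1 \<Longrightarrow> norm (poly (u n) z) \<le> B"
    "\<And>z. norm z \<le> 1 \<Longrightarrow> (\<lambda>n. poly (u n) z) \<longlonglongrightarrow> f z" "\<And>z. norm z \<le> 1 \<Longrightarrow> norm (f z) \<le> B"
proof -
  have "\<forall>n. \<exists>u. poly u 0 = f 0 \<and> (\<forall>z. norm z \<le> 1 \<longrightarrow> norm (poly u z - f z) < 1 / real (Suc n))"
    using holomorphic_poly_approx[OF assms] by simp
  from choice[OF this] obtain u where
    *: "\<forall>n. poly (u n) 0 = f 0 \<and> (\<forall>z. norm z \<le> 1 \<longrightarrow> norm (poly (u n) z - f z) < 1 / real (Suc n))" ..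
  have u: "poly (u n) 0 = f 0" "norm z \<le> 1 \<Longrightarrow> norm (poly (u n) z - f z) < 1 / real (Suc n)" for n z
    using *[rule_format, of n] by simp_all
  obtain B where B: "\<And>z. norm z \<le> 1 \<Longrightarrow> norm (f z) \<le> B"
    using bounded_holomorphic_closed_disc[OF assms] by auto
  show ?thesis
  proof (rule that[of u "B + 1"])
    show "poly (u n) 0 = f 0" for n by (rule u(1))
    fix z :: complex assume z: "norm z \<le> 1"
    show "norm (f z) \<le> B + 1" using B[OF z] by simp
    show "norm (poly (u n) z) \<le> B + 1" for n
    proof -
      have "1 / real (Suc n) \<le> 1" by simp
      then show ?thesis using u(2)[OF z, of n] B[OF z] norm_triangle_ineq2[of "poly (u n) z" "f z"] by linarith
    qed
    have lim: "(\<lambda>n. 1 / real (Suc n)) \<longlonglongrightarrow> 0" by (rule LIMSEQ_Suc[OF lim_1_over_n])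
    have "(\<lambda>n. poly (u n) z - f z) \<longlonglongrightarrow> 0"
      by (rule Lim_null_comparison[OF always_eventually lim]) (use u(2)[OF z] in \<open>simp add: less_imp_le\<close>)
    then show "(\<lambda>n. poly (u n) z) \<longlonglongrightarrow> f z" by (simp add: LIM_zero_iff)
  qed
qed

text \<open>A polynomial \<open>F\<close> is a product \<open>f * g\<close> with \<open>\<bar>f\<bar>\<^sup>p = \<bar>g\<bar>\<^sup>q = \<bar>F\<bar>\<close> on the circle, where \<open>f\<close> is a
  \<open>p\<close>-th root of the polynomial \<open>G\<close> obtained by reflecting the zeros of \<open>F\<close>; as \<open>G\<close> may vanish on the
  circle, this is done on slightly smaller circles.\<close>

lemma bilinear_bound_imp_L1_bound:
  assumes p: "p > 1" "q > 1" "1 / p + 1 / q = 1" and g: "integrable circle g" and D: "D \<ge> 0"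
    and bil: "\<And>u y. poly y 0 = 0 \<Longrightarrow> norm (LINT z|circle. g z * (poly u z * poly y z)) \<le>
      D * (LINT z|circle. norm (poly u z) powr p) + (LINT z|circle. norm (poly y z) powr q)"
    and F0: "poly F 0 = 0"
  shows "norm (LINT z|circle. g z * poly F z) \<le> (D + 1) * (LINT z|circle. norm (poly F z))"
proof (cases "F = 0")
  case False
  obtain G where G: "\<And>z. norm z < 1 \<Longrightarrow> poly G z \<noteq> 0" "\<And>z. norm z \<le> 1 \<Longrightarrow> norm (poly F z) \<le> norm (poly G z)"
    "\<And>z. norm z = 1 \<Longrightarrow> norm (poly G z) = norm (poly F z)"
    using reflect_zeros[OF False] by auto
  have dil: "norm (LINT z|circle. g z * poly F (of_real r * z)) \<le> (D + 1) * (LINT z|circle. norm (poly G (of_real r * z)))"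
    if r: "0 < r" "r < 1" for r
  proof -
    define R where "R = 1 / r"
    have R: "R > 1" using r by (simp add: R_def)
    have rz: "norm (of_real r * z) < 1" if "z \<in> ball 0 R" for z :: complex
      using that r by (simp add: norm_mult R_def field_simps)
    have hol: "(\<lambda>z. poly H (of_real r * z)) holomorphic_on ball 0 R" for H
      by (intro holomorphic_intros)
    have "contractible (ball (0::complex) R)" by (intro convex_imp_contractible) simp
    then obtain l where l: "l holomorphic_on ball 0 R" "\<And>z. z \<in> ball 0 R \<Longrightarrow> poly G (of_real r * z) = exp (l z)"
    proof (rule contractible_imp_holomorphic_log[OF hol[of G]])
      show "poly G (of_real r * z) \<noteq> 0" if "z \<in> ball 0 R" for z by (rule G(1)[OF rz[OF that]])
    qed simp_all
    \<comment> \<open>After the dilation, f^p has the modulus of \<open>G\<close> and f k = F. As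
      |F| <= |G| and 1 - 1/p = 1/q, also |k|^q <= |G|; and \<open>k\<close> inherits from
      \<open>F\<close> the zero at 0.\<close>
    define f where "f z = exp (l z / of_real p)" for z
    define k where "k z = poly F (of_real r * z) * exp (- l z / of_real p)" for z
    have fh: "f holomorphic_on ball 0 R" "k holomorphic_on ball 0 R"
      unfolding f_def[abs_def] k_def[abs_def] using l(1) p by (auto intro!: holomorphic_intros)
    have fk: "f z * k z = poly F (of_real r * z)" for z
      by (simp add: f_def k_def exp_minus)
    have k0: "k 0 = 0" using F0 by (simp add: k_def)
    have inR: "z \<in> ball 0 R" if "norm z \<le> 1" for z :: complex using that R by simp
    have nf: "norm (f z) powr p = norm (poly G (of_real r * z))" if "norm z \<le> 1" for z
      using p by (simp add: f_def l(2)[OF inR[OF that]] powr_def)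
    have nk: "norm (k z) powr q \<le> norm (poly G (of_real r * z))" if "norm z \<le> 1" for z
    proof -
      have "norm (poly F (of_real r * z)) \<le> norm (poly G (of_real r * z))"
        using rz[OF inR[OF that]] by (intro G(2)) simp
      also have "\<dots> = exp (Re (l z))" by (simp add: l(2)[OF inR[OF that]])
      finally have "norm (k z) \<le> exp (Re (l z)) * exp (- Re (l z) / p)"
        unfolding k_def norm_mult by (intro mult_mono) (simp_all)
      also have "\<dots> = exp (Re (l z) * (1 - 1 / p))" by (simp add: algebra_simps flip: exp_add)
      also have "1 - 1 / p = 1 / q" using p by simp
      finally have "norm (k z) powr q \<le> exp (Re (l z) * (1 / q)) powr q"
        using p by (intro powr_mono2) simp_all
      also have "\<dots> = exp (Re (l z))" using p by (simp add: powr_def)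
      finally show ?thesis by (simp add: l(2)[OF inR[OF that]])
    qed
    obtain u B where u: "\<And>n z. norm z \<le> 1 \<Longrightarrow> norm (poly (u n) z) \<le> B"
      "\<And>z. norm z \<le> 1 \<Longrightarrow> (\<lambda>n. poly (u n) z) \<longlonglongrightarrow> f z" "\<And>z. norm z \<le> 1 \<Longrightarrow> norm (f z) \<le> B"
      by (rule holomorphic_poly_sequence[OF fh(1) R]) blast
    obtain y B' where y: "\<And>n. poly (y n) 0 = k 0" "\<And>n z. norm z \<le> 1 \<Longrightarrow> norm (poly (y n) z) \<le> B'"
      "\<And>z. norm z \<le> 1 \<Longrightarrow> (\<lambda>n. poly (y n) z) \<longlonglongrightarrow> k z" "\<And>z. norm z \<le> 1 \<Longrightarrow> norm (k z) \<le> B'"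
      by (rule holomorphic_poly_sequence[OF fh(2) R]) blast
    \<comment> \<open>Cut off outside the closed disc to obtain Borel functions on the plane: they
      are pointwise limits of the cut-off polynomials.\<close>
    define f' where "f' z = (if norm z \<le> 1 then f z else 0)" for z
    define k' where "k' z = (if norm z \<le> 1 then k z else 0)" for z
    have f'_lim: "(\<lambda>n. if norm z \<le> 1 then poly (u n) z else 0) \<longlonglongrightarrow> f' z" for z using u(2) by (simp add: f'_def)
    have k'_lim: "(\<lambda>n. if norm z \<le> 1 then poly (y n) z else 0) \<longlonglongrightarrow> k' z" for z using y(3) by (simp add: k'_def)
    have [measurable]: "f' \<in> borel_measurable borel"
      by (rule borel_measurable_LIMSEQ_metric[OF _ f'_lim]) measurable
    have [measurable]: "k' \<in> borel_measurable borel"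
      by (rule borel_measurable_LIMSEQ_metric[OF _ k'_lim]) measurable
    have B: "B \<ge> 0" by (rule order_trans[OF norm_ge_zero u(3)[of 0]]) simp
    have L1: "(\<lambda>n. LINT z|circle. g z * (poly (u n) z * poly (y n) z)) \<longlonglongrightarrow> (LINT z|circle. g z * poly F (of_real r * z))"
    proof (rule tendsto_integral_mult_bounded[OF g, where B = "B * B'"])
      show "AE z in circle. (\<lambda>n. poly (u n) z * poly (y n) z) \<longlonglongrightarrow> poly F (of_real r * z)"
        using AE_circle_norm
      proof eventually_elim
        case (elim z)
        then show ?case using tendsto_mult[OF u(2)[of z] y(3)[of z]] by (simp add: fk)
      qed
      show "AE z in circle. norm (poly (u n) z * poly (y n) z) \<le> B * B'" for n
        using AE_circle_norm
      proof eventually_elim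
        case (elim z)
        then show ?case unfolding norm_mult using u(1)[of z n] y(2)[of z n] B by (intro mult_mono) auto
      qed
    qed measurable
    have L2: "(\<lambda>n. LINT z|circle. norm (poly (u n) z) powr p) \<longlonglongrightarrow> (LINT z|circle. norm (f' z) powr p)"
    proof (rule tendsto_integral_powr_bounded[where B = B])
      show "AE z in circle. (\<lambda>n. poly (u n) z) \<longlonglongrightarrow> f' z"
        using AE_circle_norm by eventually_elim (use u(2) in \<open>simp add: f'_def\<close>)
      show "AE z in circle. norm (poly (u n) z) \<le> B" for n
        using AE_circle_norm by eventually_elim (use u(1) in simp)
    qed (use p in simp_all)
    have L3: "(\<lambda>n. LINT z|circle. norm (poly (y n) z) powr q) \<longlonglongrightarrow> (LINT z|circle. norm (k' z) powr q)"
    proof (rule tendsto_integral_powr_bounded[where B = B'])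
      show "AE z in circle. (\<lambda>n. poly (y n) z) \<longlonglongrightarrow> k' z"
        using AE_circle_norm by eventually_elim (use y(3) in \<open>simp add: k'_def\<close>)
      show "AE z in circle. norm (poly (y n) z) \<le> B'" for n
        using AE_circle_norm by eventually_elim (use y(2) in simp)
    qed (use p in simp_all)
    have "norm (LINT z|circle. g z * poly F (of_real r * z)) \<le>
        D * (LINT z|circle. norm (f' z) powr p) + (LINT z|circle. norm (k' z) powr q)"
      by (rule LIMSEQ_le[OF tendsto_norm[OF L1] tendsto_add[OF tendsto_mult[OF tendsto_const L2] L3]])
        (use bil y(1) k0 in auto)
    also have "(LINT z|circle. norm (f' z) powr p) = (LINT z|circle. norm (poly G (of_real r * z)))"
    proof (rule integral_cong_AE)
      show "AE z in circle. norm (f' z) powr p = norm (poly G (of_real r * z))"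
        using AE_circle_norm by eventually_elim (simp add: f'_def nf)
    qed simp_all
    also have "(LINT z|circle. norm (k' z) powr q) \<le> (LINT z|circle. norm (poly G (of_real r * z)))"
    proof (rule integral_mono_AE)
      show le: "AE z in circle. norm (k' z) powr q \<le> norm (poly G (of_real r * z))"
        using AE_circle_norm by eventually_elim (simp add: k'_def nk)
      have "poly (pcompose G [:0, of_real r:]) z = poly G (of_real r * z)" for z
        by (simp add: poly_pcompose mult.commute)
      then show *: "integrable circle (\<lambda>z. norm (poly G (of_real r * z)))"
        using integrable_norm[OF integrable_poly[of "pcompose G [:0, of_real r:]"]] by simp
      show "integrable circle (\<lambda>z. norm (k' z) powr q)"
        by (rule Bochner_Integration.integrable_bound[OF *]) (use le in \<open>auto elim: eventually_mono\<close>)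
    qed
    finally show ?thesis by (simp add: distrib_right)
  qed
  define r where "r n = 1 - 1 / real (Suc (Suc n))" for n
  have "(\<lambda>n. 1 / real (Suc (Suc n))) \<longlonglongrightarrow> 0" by (intro LIMSEQ_Suc lim_1_over_n)
  then have "(\<lambda>n. 1 - 1 / real (Suc (Suc n))) \<longlonglongrightarrow> 1 - 0" by (intro tendsto_diff tendsto_const)
  then have r: "0 < r n" "r n < 1" "r \<longlonglongrightarrow> 1" for n by (simp_all add: r_def[abs_def])
  have conv: "(\<lambda>n. poly H (of_real (r n) * z)) \<longlonglongrightarrow> poly H z" for H and z :: complex
  proof -
    have "(\<lambda>n. poly H (of_real (r n) * z)) \<longlonglongrightarrow> poly H (of_real 1 * z)"
      by (intro tendsto_intros tendsto_of_real r)
    then show ?thesis by simp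
  qed
  have bdd: "\<exists>B. \<forall>n. AE z in circle. norm (poly H (of_real (r n) * z)) \<le> B" for H
  proof -
    obtain B where B: "\<And>z. norm z \<le> 1 \<Longrightarrow> norm (poly H z) \<le> B"
      by (rule bounded_holomorphic_closed_disc[of "poly H" 2]) (auto intro!: holomorphic_intros)
    have "AE z in circle. norm (poly H (of_real (r n) * z)) \<le> B" for n
      using AE_circle_norm
    proof eventually_elim
      case (elim z)
      then show ?case using r(1,2)[of n] by (intro B) (simp add: norm_mult)
    qed
    then show ?thesis by blast
  qed
  obtain B1 where B1: "\<And>n. AE z in circle. norm (poly F (of_real (r n) * z)) \<le> B1" using bdd[of F] by blast
  obtain B2 where B2: "\<And>n. AE z in circle. norm (poly G (of_real (r n) * z)) \<le> B2" using bdd[of G] by blast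
  have M1: "(\<lambda>n. LINT z|circle. g z * poly F (of_real (r n) * z)) \<longlonglongrightarrow> (LINT z|circle. g z * poly F z)"
    by (rule tendsto_integral_mult_bounded[OF g _ _ _ B1]) (simp_all add: conv)
  have M2: "(\<lambda>n. LINT z|circle. norm (poly G (of_real (r n) * z))) \<longlonglongrightarrow> (LINT z|circle. norm (poly G z))"
  proof -
    have "(\<lambda>n. LINT z|circle. norm (poly G (of_real (r n) * z)) powr 1) \<longlonglongrightarrow> (LINT z|circle. norm (poly G z) powr 1)"
      by (rule tendsto_integral_powr_bounded[where B = B2]) (simp_all add: conv B2)
    then show ?thesis by simp
  qed
  have "norm (LINT z|circle. g z * poly F z) \<le> (D + 1) * (LINT z|circle. norm (poly G z))"
    by (rule LIMSEQ_le[OF tendsto_norm[OF M1] tendsto_mult[OF tendsto_const M2]]) (use dil r in auto)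
  also have "(LINT z|circle. norm (poly G z)) = (LINT z|circle. norm (poly F z))"
  proof (rule integral_cong_AE)
    show "AE z in circle. norm (poly G z) = norm (poly F z)"
      using AE_circle_norm by eventually_elim (rule G(3))
  qed simp_all
  finally show ?thesis .
qed simp

section \<open>Hardy and model spaces\<close>

abbreviation mk :: "(complex \<Rightarrow> complex) \<Rightarrow> circle_fun" where
  "mk \<equiv> abs_circle_fun"

lemma circle_fun_eq_refl [simp]: "circle_fun_eq f f \<longleftrightarrow> f \<in> borel_measurable borel"
  by (simp add: circle_fun_eq_def)

lemma mk_eq_iff:
  assumes "f \<in> borel_measurable borel" "g \<in> borel_measurable borel"
  shows "mk f = mk g \<longleftrightarrow> (AE z in circle. f z = g z)"
  using Quotient3_rel[OF Quotient3_circle_fun, of f g] assms by (simp add: circle_fun_eq_def)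

lemma mk_cases:
  obtains f where "F = mk f" "f \<in> borel_measurable borel"
  by (induction F rule: circle_fun.abs_induct) auto

lemma fourier_coeff_mk: "f \<in> borel_measurable borel \<Longrightarrow> fourier_coeff (mk f) n = coef f n"
  by (simp add: fourier_coeff.abs_eq coef_def)

definition hardy :: "real \<Rightarrow> (complex \<Rightarrow> complex) \<Rightarrow> bool" where
  "hardy p f \<longleftrightarrow> f \<in> borel_measurable borel \<and> integrable circle (\<lambda>z. norm (f z) powr p) \<and> (\<forall>n<0. coef f n = 0)"

text \<open>As |i| = 1 on the circle, membership in I conj(H_0^p) says that conj(i) f is the
  conjugate of a function in H_0^p, that is, has coefficients of negative index only.\<close>

definition model :: "real \<Rightarrow> (complex \<Rightarrow> complex) \<Rightarrow> (complex \<Rightarrow> complex) \<Rightarrow> bool" where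
  "model p i f \<longleftrightarrow> hardy p f \<and> (\<forall>n\<ge>0. coef (\<lambda>z. cnj (i z) * f z) n = 0)"

lemma mk_in_Hp_iff: "f \<in> borel_measurable borel \<Longrightarrow> mk f \<in> Hp p \<longleftrightarrow> hardy p f"
  by (simp add: Hp_def Lp_def p_integrable.abs_eq fourier_coeff_mk hardy_def)

lemma mk_in_Hp0_iff: "f \<in> borel_measurable borel \<Longrightarrow> mk f \<in> Hp0 p \<longleftrightarrow> hardy p f \<and> coef f 0 = 0"
  by (simp add: Hp0_def mk_in_Hp_iff hol_ext_def fourier_coeff_mk)

lemma hardy_integrable: "hardy p f \<Longrightarrow> p \<ge> 1 \<Longrightarrow> integrable circle f"
  by (auto simp: hardy_def intro: integrable_of_powr)

lemma integrable_powr_cong: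
  assumes "f \<in> borel_measurable borel" "g \<in> borel_measurable borel" "AE z in circle. norm (f z) = norm (g z)"
    and "integrable circle (\<lambda>z. norm (f z) powr p)"
  shows "integrable circle (\<lambda>z. norm (g z) powr p)"
  by (subst integrable_cong_AE[where g = "\<lambda>z. norm (f z) powr p"]) (use assms in \<open>auto elim!: eventually_mono\<close>)

lemma integral_powr_cong:
  assumes "f \<in> borel_measurable borel" "g \<in> borel_measurable borel" "AE z in circle. norm (f z) = norm (g z)"
  shows "(LINT z|circle. norm (f z) powr p) = (LINT z|circle. norm (g z) powr p)"
  by (rule integral_cong_AE) (use assms in \<open>auto elim!: eventually_mono\<close>)

lemma integrable_powr_cmult:
  fixes f :: "complex \<Rightarrow> complex"
  assumes "f \<in> borel_measurable borel" "integrable circle (\<lambda>z. norm (f z) powr p)"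
  shows "integrable circle (\<lambda>z. norm (c * f z) powr p)"
proof -
  have "norm (c * f z) powr p = norm c powr p * norm (f z) powr p" for z
    by (simp only: norm_mult powr_mult)
  then show ?thesis using assms(2) by simp
qed

lemma hardy_add:
  assumes "hardy p f" "hardy p g" "p \<ge> 1"
  shows "hardy p (\<lambda>z. f z + g z)"
  using assms hardy_integrable[OF assms(1,3)] hardy_integrable[OF assms(2,3)]
  by (simp add: hardy_def integrable_powr_add coef_add)

lemma hardy_cmult: "hardy p f \<Longrightarrow> hardy p (\<lambda>z. c * f z)"
  unfolding hardy_def by (auto simp: coef_cmult intro: integrable_powr_cmult)

lemma hardy_diff:
  assumes "hardy p f" "hardy p g" "p \<ge> 1"
  shows "hardy p (\<lambda>z. f z - g z)"
  using hardy_add[OF assms(1) hardy_cmult[OF assms(2), of "-1"] assms(3)] by simp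

lemma hardy_bounded:
  assumes "f \<in> borel_measurable borel" "AE z in circle. norm (f z) \<le> B" "\<And>n. n < 0 \<Longrightarrow> coef f n = 0" "p \<ge> 0"
  shows "hardy p f"
  using assms integrable_powr_bounded[OF assms(1,2,4)] by (simp add: hardy_def)

lemma hardy_const: "p \<ge> 0 \<Longrightarrow> hardy p (\<lambda>_. c)"
  by (rule hardy_bounded[where B = "norm c"]) (auto simp: coef_const)

lemma hardy_mult_z:
  assumes "hardy p f"
  shows "hardy p (\<lambda>z. z * f z)"
proof -
  have [measurable]: "f \<in> borel_measurable borel" using assms by (simp add: hardy_def)
  have "AE z in circle. norm (f z) = norm (z * f z)"
    using AE_circle_norm by eventually_elim (simp add: norm_mult)
  then have "integrable circle (\<lambda>z. norm (z * f z) powr p)"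
    by (rule integrable_powr_cong[rotated 2]) (use assms in \<open>simp_all add: hardy_def\<close>)
  then show ?thesis using assms by (simp add: hardy_def coef_mult_z)
qed

section \<open>Products in Hardy spaces and density of polynomials\<close>

lemma coef_poly_mult:
  assumes h: "integrable circle h" "\<And>n. n < 0 \<Longrightarrow> coef h n = 0"
  shows "integrable circle (\<lambda>z. poly u z * h z)"
    and "n < 0 \<Longrightarrow> coef (\<lambda>z. poly u z * h z) n = 0"
    and "coef (\<lambda>z. poly u z * h z) 0 = coeff u 0 * coef h 0"
proof -
  note [measurable] = integrable_circle_measurable[OF h(1)]
  have int: "integrable circle (\<lambda>z. poly u z * h z)" for u
  proof -
    obtain B where "AE z in circle. norm (poly u z) \<le> B" using AE_bounded_poly[of u] ..
    from integrable_circle_mult_bounded[OF h(1) _ this] show ?thesis by (simp add: mult.commute)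
  qed
  show "integrable circle (\<lambda>z. poly u z * h z)" by (rule int)
  have "(\<forall>n<0. coef (\<lambda>z. poly u z * h z) n = 0) \<and> coef (\<lambda>z. poly u z * h z) 0 = coeff u 0 * coef h 0"
  proof (induction u)
    case 0
    then show ?case by (simp add: coef_const)
  next
    case (pCons a u)
    have eq: "(\<lambda>z. poly (pCons a u) z * h z) = (\<lambda>z. a * h z + z * (poly u z * h z))"
      by (simp add: fun_eq_iff algebra_simps)
    have "(\<lambda>z. z * (poly u z * h z)) = (\<lambda>z. poly (pCons 0 u) z * h z)" by (simp add: fun_eq_iff algebra_simps)
    then have i2: "integrable circle (\<lambda>z. z * (poly u z * h z))" using int[of "pCons 0 u"] by simp
    have "coef (\<lambda>z. poly (pCons a u) z * h z) n = a * coef h n + coef (\<lambda>z. poly u z * h z) (n - 1)" for n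
      unfolding eq using h(1) i2 by (simp add: coef_add coef_cmult coef_mult_z)
    then show ?case using pCons.IH h(2) by simp
  qed
  then show "n < 0 \<Longrightarrow> coef (\<lambda>z. poly u z * h z) n = 0" "coef (\<lambda>z. poly u z * h z) 0 = coeff u 0 * coef h 0"
    by simp_all
qed

text \<open>A dilate of \<open>F\<close> is holomorphic on a larger disc and so a bounded limit of
  polynomials on the closed unit disc, and these are covered by \<open>coef_poly_mult\<close>; the
  dilates in turn converge boundedly to \<open>i\<close>.\<close>

lemma coef_boundary_mult:
  assumes F: "F holomorphic_on ball 0 1" "\<And>w. norm w < 1 \<Longrightarrow> norm (F w) \<le> B"
    and [measurable]: "i \<in> borel_measurable borel"
    and lim: "AE z in circle. ((\<lambda>r. F (of_real r * z)) \<longlongrightarrow> i z) (at_left (1::real))"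
    and h: "integrable circle h" "\<And>n. n < 0 \<Longrightarrow> coef h n = 0" and n: "n < 0"
  shows "coef (\<lambda>z. i z * h z) n = 0"
proof -
  note [measurable] = integrable_circle_measurable[OF h(1)]
  \<comment> \<open>Nothing is known about \<open>F\<close> off the open disc, so it is cut off to
    get a Borel function.\<close>
  define F' where "F' = (\<lambda>z. if z \<in> ball 0 1 then F z else 0)"
  have [measurable]: "F' \<in> borel_measurable borel"
    unfolding F'_def using holomorphic_on_imp_continuous_on[OF F(1)]
    by (intro borel_measurable_continuous_on_if) simp_all
  define k where "k = (\<lambda>z. h z * z powi (- n))"
  have k: "integrable circle k" unfolding k_def by (rule integrable_mult_powi[OF h(1)])
  define r where "r n = 1 - 1 / real (Suc (Suc n))" for n
  have "(\<lambda>n. 1 / real (Suc (Suc n))) \<longlonglongrightarrow> 0" by (intro LIMSEQ_Suc lim_1_over_n)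
  then have "(\<lambda>n. 1 - 1 / real (Suc (Suc n))) \<longlonglongrightarrow> 1 - 0" by (intro tendsto_diff tendsto_const)
  then have r: "0 < r n" "r n < 1" "r \<longlonglongrightarrow> 1" for n by (simp_all add: r_def[abs_def])
  have filt: "filterlim r (at_left 1) sequentially"
    unfolding filterlim_at using r by (auto intro!: always_eventually simp: less_le)
  have B0: "AE z in circle. norm (F' (of_real (r m) * z)) \<le> B" for m
    using AE_circle_norm
  proof eventually_elim
    case (elim z)
    then have "norm (of_real (r m) * z) < 1" using r(1,2)[of m] by (simp add: norm_mult)
    then show ?case using F(2) by (simp add: F'_def)
  qed
  have "(\<lambda>m. LINT z|circle. k z * F' (of_real (r m) * z)) \<longlonglongrightarrow> (LINT z|circle. k z * i z)"
  proof (rule tendsto_integral_mult_bounded[OF k _ _ _ B0])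
    show "AE z in circle. (\<lambda>m. F' (of_real (r m) * z)) \<longlonglongrightarrow> i z"
      using lim AE_circle_norm
    proof eventually_elim
      case (elim z)
      have "norm (of_real (r m) * z) < 1" for m using r(1,2)[of m] elim(2) by (simp add: norm_mult)
      then have "F' (of_real (r m) * z) = F (of_real (r m) * z)" for m by (simp add: F'_def)
      then show ?case using filterlim_compose[OF elim(1) filt] by simp
    qed
  qed measurable
  moreover have "(LINT z|circle. k z * F' (of_real (r m) * z)) = 0" for m
  proof -
    have inb: "norm (of_real (r m) * z) < 1" if "z \<in> ball 0 (1 / r m)" for z :: complex
      using that r(1,2)[of m] by (simp add: norm_mult field_simps)
    have hol: "(\<lambda>z. F (of_real (r m) * z)) holomorphic_on ball 0 (1 / r m)"
      using inb by (intro holomorphic_on_compose_gen[OF _ F(1), unfolded o_def] holomorphic_intros) auto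
    have R: "1 / r m > 1" using r(1,2)[of m] by simp
    obtain u B' where u: "\<And>j z. norm z \<le> 1 \<Longrightarrow> norm (poly (u j) z) \<le> B'"
      "\<And>z. norm z \<le> 1 \<Longrightarrow> (\<lambda>j. poly (u j) z) \<longlonglongrightarrow> F (of_real (r m) * z)"
      by (rule holomorphic_poly_sequence[OF hol R]) blast
    have "(\<lambda>j. LINT z|circle. k z * poly (u j) z) \<longlonglongrightarrow> (LINT z|circle. k z * F' (of_real (r m) * z))"
    proof (rule tendsto_integral_mult_bounded[OF k, where B = B'])
      show "AE z in circle. (\<lambda>j. poly (u j) z) \<longlonglongrightarrow> F' (of_real (r m) * z)"
        using AE_circle_norm
      proof eventually_elim
        case (elim z)
        then have "norm (of_real (r m) * z) < 1" using r(1,2)[of m] by (simp add: norm_mult)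
        then show ?case using u(2)[of z] elim by (simp add: F'_def)
      qed
      show "AE z in circle. norm (poly (u j) z) \<le> B'" for j
        using AE_circle_norm by eventually_elim (rule u(1), simp)
    qed measurable
    moreover have "(LINT z|circle. k z * poly (u j) z) = 0" for j
      using coef_poly_mult(2)[OF h n, of "u j"] by (simp add: coef_def k_def mult_ac)
    ultimately have "(\<lambda>j. 0) \<longlonglongrightarrow> (LINT z|circle. k z * F' (of_real (r m) * z))" by (simp only:)
    then show ?thesis by (simp add: LIMSEQ_const_iff)
  qed
  ultimately have "(LINT z|circle. k z * i z) = 0" by (simp add: LIMSEQ_const_iff)
  then show ?thesis by (simp add: coef_def k_def mult_ac)
qed

text \<open>Without negative coefficients the Poisson integral is a power series, hence holomorphic;
  it obeys the bound of \<open>f\<close> and has \<open>f\<close> as its radial limits.\<close>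

lemma mk_in_Hinf:
  assumes [measurable]: "f \<in> borel_measurable borel" and B: "AE z in circle. norm (f z) \<le> B"
    and coefs: "\<And>n. n < 0 \<Longrightarrow> coef f n = 0"
  shows "mk f \<in> Hinf"
proof -
  have f: "integrable circle f" by (rule integrable_circle_bounded[OF _ B]) simp
  have "(\<lambda>n. coef f (int n) * (w - 0) ^ n) sums poisson f w" if "w \<in> ball 0 1" for w
  proof -
    have "(if n = 0 then 0 else coef f (- int n) * cnj w ^ n) = 0" for n using coefs by simp
    then show ?thesis using poisson_sums[OF f, of w] that by simp
  qed
  then have "poisson f holomorphic_on ball 0 1" by (rule power_series_holomorphic)
  moreover have "bounded (poisson f ` ball 0 1)"
    unfolding bounded_iff using norm_poisson_le_max[OF _ B] by (intro exI[of _ B]) auto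
  moreover have "has_boundary_values (poisson f) (mk f)"
    using Fatou_radial_limit[OF f] by (simp add: has_boundary_values.abs_eq)
  ultimately show ?thesis unfolding Hinf_def by blast
qed

text \<open>A Poisson dilate is close to \<open>f\<close> in L^p, and the partial sums of its series
  are uniformly close to it on the circle; they are polynomials because the negative coefficients
  vanish.\<close>

lemma hardy_poly_approx:
  assumes p: "p > 1" and f: "hardy p f" and e: "e > 0"
  shows "\<exists>u. (LINT z|circle. norm (f z - poly u z) powr p) \<le> e"
proof -
  have [measurable]: "f \<in> borel_measurable borel" and fp: "integrable circle (\<lambda>z. norm (f z) powr p)"
    and f0: "\<And>n. n < 0 \<Longrightarrow> coef f n = 0" using f by (auto simp: hardy_def)
  have fi: "integrable circle f" using hardy_integrable[OF f] p by simp
  define e' where "e' = e / (2 * 2 powr p)"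
  have e': "e' > 0" using e by (simp add: e'_def)
  define r where "r n = 1 - 1 / real (Suc n)" for n
  have "(\<lambda>n. 1 - 1 / real (Suc n)) \<longlonglongrightarrow> 1 - 0"
    by (intro tendsto_diff tendsto_const LIMSEQ_Suc[OF lim_1_over_n])
  then have r: "0 \<le> r n" "r n < 1" "r \<longlonglongrightarrow> 1" for n by (simp_all add: r_def[abs_def])
  have "eventually (\<lambda>n. (LINT z|circle. norm (poisson f (of_real (r n) * z) - f z) powr p) < e') sequentially"
    using poisson_tendsto_Lp[OF p _ fp r] e' by (intro order_tendstoD(2)) simp_all
  then obtain n where n: "(LINT z|circle. norm (poisson f (of_real (r n) * z) - f z) powr p) < e'"
    unfolding eventually_sequentially by auto
  define M where "M = (LINT z|circle. norm (f z))"
  have "(\<lambda>N. (2 * M * r n ^ N / (1 - r n)) powr p) \<longlonglongrightarrow> (2 * M * 0 / (1 - r n)) powr p"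
  proof (intro tendsto_powr' tendsto_intros LIMSEQ_power_zero)
    have "M \<ge> 0" by (simp add: M_def)
    then have "0 \<le> 2 * M * r n ^ N / (1 - r n)" for N using r(1,2)[of n] by simp
    then have "eventually (\<lambda>N. 0 \<le> 2 * M * r n ^ N / (1 - r n)) sequentially" by (intro always_eventually) simp
    then show "2 * M * 0 / (1 - r n) \<noteq> 0 \<or> 0 < p \<and> eventually (\<lambda>N. 0 \<le> 2 * M * r n ^ N / (1 - r n)) sequentially"
      using p by simp
  qed (use r(1,2)[of n] in simp_all)
  then have "eventually (\<lambda>N. (2 * M * r n ^ N / (1 - r n)) powr p < e') sequentially"
    using p e' by (intro order_tendstoD(2)) simp_all
  then obtain N where N: "(2 * M * r n ^ N / (1 - r n)) powr p < e'"
    unfolding eventually_sequentially by auto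
  define u where "u = dilated_partial_sum (\<lambda>n. coef f (int n)) (r n) N"
  have approx: "norm (poisson f (of_real (r n) * z) - poly u z) \<le> 2 * M * r n ^ N / (1 - r n)" if "norm z = 1" for z
  proof -
    have "poly (dilated_partial_sum (\<lambda>n. if n = 0 then 0 else cnj (coef f (- int n))) (r n) N) z = 0"
      unfolding poly_dilated_partial_sum by (intro sum.neutral) (auto simp: f0)
    then show ?thesis using poisson_trig_approx[OF fi r(1,2)[of n] that, of N] by (simp add: u_def M_def)
  qed
  have "(LINT z|circle. norm (poisson f (of_real (r n) * z) - poly u z) powr p) \<le> (LINT z|circle. e')"
  proof (rule integral_mono_AE)
    show "AE z in circle. norm (poisson f (of_real (r n) * z) - poly u z) powr p \<le> e'"
      using AE_circle_norm
    proof eventually_elim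
      case (elim z)
      have "norm (poisson f (of_real (r n) * z) - poly u z) powr p \<le> (2 * M * r n ^ N / (1 - r n)) powr p"
        using p by (intro powr_mono2 approx elim) simp_all
      then show ?case using N by simp
    qed
    show "integrable circle (\<lambda>z. norm (poisson f (of_real (r n) * z) - poly u z) powr p)"
      using p r(1,2)[of n] by (intro integrable_powr_diff integral_poisson_powr_le(1)[OF p _ fp]) simp_all
  qed simp
  then have 2: "(LINT z|circle. norm (poisson f (of_real (r n) * z) - poly u z) powr p) \<le> e'"
    using circle.prob_space by simp
  have "(LINT z|circle. norm (f z - poly u z) powr p) =
      (LINT z|circle. norm ((poisson f (of_real (r n) * z) - poly u z) - (poisson f (of_real (r n) * z) - f z)) powr p)"
    by simp
  also have "\<dots> \<le> 2 powr p * ((LINT z|circle. norm (poisson f (of_real (r n) * z) - poly u z) powr p)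
      + (LINT z|circle. norm (poisson f (of_real (r n) * z) - f z) powr p))"
    using p r(1,2)[of n] by (intro integral_powr_diff_le integrable_powr_diff integral_poisson_powr_le(1)[OF p _ fp] fp) simp_all
  also have "\<dots> \<le> 2 powr p * (e' + e')" using n 2 by (intro mult_left_mono) simp_all
  also have "\<dots> = e" by (simp add: e'_def)
  finally show ?thesis by blast
qed

text \<open>A representative \<open>i\<close> of the inner function together with a bounded
  holomorphic \<open>F\<close> whose boundary function it is; \<open>F\<close> is what makes
  multiplication by \<open>i\<close> preserve the vanishing of negative coefficients.\<close>

locale inner_setting =
  fixes p :: real and i :: "complex \<Rightarrow> complex" and F :: "complex \<Rightarrow> complex" and B :: real
  assumes p: "1 < p"
    and i_meas [measurable]: "i \<in> borel_measurable borel"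
    and i_norm: "AE z in circle. norm (i z) = 1"
    and F: "F holomorphic_on ball 0 1" "\<And>w. norm w < 1 \<Longrightarrow> norm (F w) \<le> B"
    and F_lim: "AE z in circle. ((\<lambda>r. F (of_real r * z)) \<longlongrightarrow> i z) (at_left (1::real))"
begin

lemma i_cnj: "AE z in circle. i z * cnj (i z) = 1"
  using i_norm by eventually_elim (simp add: complex_norm_square[symmetric])

lemma coef_i_mult: "integrable circle h \<Longrightarrow> (\<And>n. n < 0 \<Longrightarrow> coef h n = 0) \<Longrightarrow> n < 0 \<Longrightarrow> coef (\<lambda>z. i z * h z) n = 0"
  by (rule coef_boundary_mult[OF F i_meas F_lim])

lemma i_int: "integrable circle i"
  by (rule integrable_circle_bounded[where B = 1]) (use i_norm in \<open>auto elim!: eventually_mono\<close>)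

lemma coef_i: "n < 0 \<Longrightarrow> coef i n = 0"
  using coef_i_mult[of "\<lambda>_. 1" n] by (simp add: coef_const)

lemma hardy_i: "hardy p i"
  by (rule hardy_bounded[where B = 1]) (use i_norm p coef_i in \<open>auto elim!: eventually_mono\<close>)

lemma norm_i_mult: "AE z in circle. norm (i z * f z) = norm (f z)"
  using i_norm by eventually_elim (simp add: norm_mult)

lemma norm_cnj_i_mult: "AE z in circle. norm (cnj (i z) * f z) = norm (f z)"
  using i_norm by eventually_elim (simp add: norm_mult)

lemma integrable_cnj_i_mult:
  assumes "integrable circle f"
  shows "integrable circle (\<lambda>z. cnj (i z) * f z)"
proof -
  have "AE z in circle. norm (cnj (i z)) \<le> 1" using i_norm by eventually_elim simp
  from integrable_circle_mult_bounded[OF assms _ this] show ?thesis by (simp add: mult.commute)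
qed

lemma model_meas: "model p i f \<Longrightarrow> f \<in> borel_measurable borel"
  by (simp add: model_def hardy_def)

lemma model_int: "model p i f \<Longrightarrow> integrable circle f"
  using p by (auto simp: model_def intro: hardy_integrable)

lemma model_add:
  assumes "model p i f" "model p i g"
  shows "model p i (\<lambda>z. f z + g z)"
proof -
  have "coef (\<lambda>z. cnj (i z) * (f z + g z)) n = coef (\<lambda>z. cnj (i z) * f z) n + coef (\<lambda>z. cnj (i z) * g z) n" for n
    unfolding distrib_left using assms by (intro coef_add integrable_cnj_i_mult model_int)
  then show ?thesis using assms p by (simp add: model_def hardy_add)
qed

lemma model_cmult:
  assumes "model p i f"
  shows "model p i (\<lambda>z. c * f z)"
proof -
  have "coef (\<lambda>z. cnj (i z) * (c * f z)) n = c * coef (\<lambda>z. cnj (i z) * f z) n" for n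
    unfolding mult.left_commute[of _ c] by (rule coef_cmult)
  then show ?thesis using assms by (simp add: model_def hardy_cmult)
qed

lemma mk_in_model_space_iff:
  assumes [measurable]: "f \<in> borel_measurable borel"
  shows "mk f \<in> model_space p (mk i) \<longleftrightarrow> model p i f"
proof
  assume "mk f \<in> model_space p (mk i)"
  then obtain G where f: "mk f \<in> Hp p" and G: "G \<in> Hp0 p" "mk f = mk i * cnj_fun G"
    unfolding model_space_def by auto
  obtain g where g: "G = mk g" and [measurable]: "g \<in> borel_measurable borel" by (rule mk_cases)
  have g0: "hardy p g" "coef g 0 = 0" using G(1) by (simp_all add: g mk_in_Hp0_iff)
  have "mk f = mk (\<lambda>z. i z * cnj (g z))"
    using G(2) by (simp add: g cnj_fun.abs_eq times_circle_fun.abs_eq)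
  then have "AE z in circle. f z = i z * cnj (g z)" by (subst (asm) mk_eq_iff) simp_all
  then have "AE z in circle. cnj (i z) * f z = cnj (g z)"
    using i_cnj by eventually_elim (metis mult.assoc mult.commute mult_1)
  then have "coef (\<lambda>z. cnj (i z) * f z) n = cnj (coef g (- n))" for n
    using coef_cong_AE[of "\<lambda>z. cnj (i z) * f z" "\<lambda>z. cnj (g z)" n] by (simp add: coef_cnj)
  moreover have "coef g (- n) = 0" if "n \<ge> 0" for n
    using g0 that by (cases "n = 0") (auto simp: hardy_def)
  ultimately show "model p i f" using f by (simp add: model_def mk_in_Hp_iff)
next
  assume m: "model p i f"
  define g where "g = (\<lambda>z. cnj (cnj (i z) * f z))"
  have [measurable]: "g \<in> borel_measurable borel" unfolding g_def by measurable
  have "coef g n = cnj (coef (\<lambda>z. cnj (i z) * f z) (- n))" for n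
    unfolding g_def by (rule coef_cnj) measurable
  then have c: "coef g n = 0" if "n \<le> 0" for n using m that by (simp add: model_def)
  have "AE z in circle. norm (f z) = norm (g z)"
    using i_norm by eventually_elim (simp add: g_def norm_mult)
  then have "integrable circle (\<lambda>z. norm (g z) powr p)"
    by (rule integrable_powr_cong[rotated 2]) (use m in \<open>simp_all add: model_def hardy_def\<close>)
  then have "mk g \<in> Hp0 p" using c by (simp add: mk_in_Hp0_iff hardy_def)
  moreover have "mk f = mk i * cnj_fun (mk g)"
  proof -
    have "AE z in circle. f z = i z * cnj (g z)"
      using i_cnj by eventually_elim (simp add: g_def mult.assoc[symmetric])
    then show ?thesis by (simp add: cnj_fun.abs_eq times_circle_fun.abs_eq mk_eq_iff)
  qed
  moreover have "mk f \<in> Hp p" using m by (simp add: mk_in_Hp_iff model_def)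
  ultimately show "mk f \<in> model_space p (mk i)"
    unfolding model_space_def by (intro IntI image_eqI[where x = "mk g"])
qed

text \<open>This evaluates the definite description in \<open>riesz_proj\<close>: conj(i) f splits
  into h and a function with negative indices only, and two such splittings agree by
  \<open>Fourier_uniqueness\<close>.\<close>

lemma model_proj_eq:
  assumes k: "model p i k" and h: "hardy p h" and [measurable]: "f \<in> borel_measurable borel"
    and eq: "AE z in circle. f z = k z + i z * h z"
  shows "model_proj p (mk i) (mk f) = mk k"
proof -
  have [measurable]: "k \<in> borel_measurable borel" "h \<in> borel_measurable borel"
    using k h by (simp_all add: model_def hardy_def)
  define b where "b = (\<lambda>z. cnj (i z) * f z)"
  have [measurable]: "b \<in> borel_measurable borel" unfolding b_def by measurable
  have bk: "AE z in circle. b z - h z = cnj (i z) * k z"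
    using eq i_cnj
  proof eventually_elim
    case (elim z)
    have "b z = cnj (i z) * k z + (i z * cnj (i z)) * h z" by (simp add: b_def elim(1) algebra_simps)
    then show ?case using elim(2) by simp
  qed
  have coef_bh: "coef (\<lambda>z. b z - h z) n = 0" if "n \<ge> 0" for n
    using coef_cong_AE[OF _ _ bk, of n] k that by (simp add: model_def)
  have hi: "integrable circle h" using h p by (intro hardy_integrable) auto
  have kp: "integrable circle (\<lambda>z. norm (k z) powr p)" using k by (simp add: model_def hardy_def)
  have "AE z in circle. norm (k z) = norm (b z - h z)"
    using bk norm_cnj_i_mult[of k] by eventually_elim simp
  then have bhp: "integrable circle (\<lambda>z. norm (b z - h z) powr p)"
    by (rule integrable_powr_cong[rotated 2]) (use kp in simp_all)
  have bhi: "integrable circle (\<lambda>z. b z - h z)"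
    using p by (intro integrable_of_powr[OF _ _ bhp]) simp_all
  have "riesz_proj p (mk b) = mk h"
    unfolding riesz_proj_def
  proof (rule the_equality)
    define g where "g = (\<lambda>z. cnj (b z - h z))"
    have [measurable]: "g \<in> borel_measurable borel" unfolding g_def by measurable
    have "coef g n = cnj (coef (\<lambda>z. b z - h z) (- n))" for n
      unfolding g_def by (rule coef_cnj) measurable
    moreover have "norm (g z) = norm (b z - h z)" for z unfolding g_def by (rule complex_mod_cnj)
    ultimately have "mk g \<in> Hp0 p"
      using coef_bh bhp by (simp add: mk_in_Hp0_iff hardy_def)
    moreover have "mk b - mk h = cnj_fun (mk g)"
      by (simp add: minus_circle_fun.abs_eq cnj_fun.abs_eq) (simp add: g_def)
    ultimately show "mk h \<in> Hp p \<and> mk b - mk h \<in> cnj_fun ` Hp0 p"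
      using h by (simp add: mk_in_Hp_iff)
  next
    fix G assume G: "G \<in> Hp p \<and> mk b - G \<in> cnj_fun ` Hp0 p"
    then obtain G1 where G1: "G1 \<in> Hp0 p" "mk b - G = cnj_fun G1" by auto
    obtain g where g: "G = mk g" and [measurable]: "g \<in> borel_measurable borel" by (rule mk_cases)
    obtain g1 where g1: "G1 = mk g1" and [measurable]: "g1 \<in> borel_measurable borel" by (rule mk_cases)
    have hg: "hardy p g" "hardy p g1" "coef g1 0 = 0"
      using G G1(1) by (simp_all add: g g1 mk_in_Hp_iff mk_in_Hp0_iff)
    have gi: "integrable circle g" "integrable circle g1" using hg p by (auto intro: hardy_integrable)
    have "mk (\<lambda>z. b z - g z) = mk (\<lambda>z. cnj (g1 z))"
      using G1(2) by (simp add: g g1 minus_circle_fun.abs_eq cnj_fun.abs_eq)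
    then have ae: "AE z in circle. b z - g z = cnj (g1 z)" by (subst (asm) mk_eq_iff) simp_all
    have "coef (\<lambda>z. g z - h z) n = 0" for n
    proof (cases "n < 0")
      case True
      then show ?thesis using hg h gi hi by (simp add: coef_diff hardy_def)
    next
      case False
      have "coef (\<lambda>z. g z - h z) n = coef (\<lambda>z. (b z - h z) - cnj (g1 z)) n"
      proof (rule coef_cong_AE)
        show "AE z in circle. g z - h z = (b z - h z) - cnj (g1 z)"
          using ae
        proof eventually_elim
          case (elim z)
          show ?case unfolding elim[symmetric] by simp
        qed
      qed simp_all
      also have "\<dots> = coef (\<lambda>z. b z - h z) n - cnj (coef g1 (- n))"
        using bhi gi by (simp add: coef_diff[of "\<lambda>z. b z - h z"] coef_cnj)
      also have "coef g1 (- n) = 0" using hg False by (cases "n = 0") (auto simp: hardy_def)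
      finally show ?thesis using coef_bh False by simp
    qed
    then have "AE z in circle. g z - h z = 0" using gi hi by (intro Fourier_uniqueness) auto
    then show "G = mk h" unfolding g by (subst mk_eq_iff) (auto elim!: eventually_mono)
  qed
  moreover have "cnj_fun (mk i) * mk f = mk b"
    by (simp add: cnj_fun.abs_eq times_circle_fun.abs_eq b_def)
  ultimately have "model_proj p (mk i) (mk f) = mk (\<lambda>z. i z * (b z - h z))"
    by (simp add: model_proj_def riesz_proj_neg_def minus_circle_fun.abs_eq times_circle_fun.abs_eq)
  also have "\<dots> = mk k"
  proof (subst mk_eq_iff)
    show "AE z in circle. i z * (b z - h z) = k z"
      using bk i_cnj by eventually_elim (simp add: mult.assoc[symmetric])
  qed simp_all
  finally show ?thesis .
qed

text \<open>Multiplication by z moves only the coefficient of index -1 of conj(i) k to a nonnegative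
  index, namely to 0. With c this coefficient, subtracting c i restores membership in the model
  space.\<close>

lemma shift_model:
  assumes k: "model p i k"
  shows "\<exists>c. model p i (\<lambda>z. z * k z - c * i z) \<and>
    compressed_shift p (mk i) (mk k) = mk (\<lambda>z. z * k z - c * i z)"
proof -
  have [measurable]: "k \<in> borel_measurable borel" by (rule model_meas[OF k])
  define c where "c = coef (\<lambda>z. cnj (i z) * k z) (- 1)"
  define s where "s = (\<lambda>z. z * k z - c * i z)"
  have [measurable]: "s \<in> borel_measurable borel" unfolding s_def by measurable
  have "hardy p s"
    unfolding s_def using k p hardy_i by (intro hardy_diff hardy_mult_z hardy_cmult) (simp_all add: model_def)
  moreover have "coef (\<lambda>z. cnj (i z) * s z) n = 0" if "n \<ge> 0" for n
  proof -
    have "coef (\<lambda>z. cnj (i z) * s z) n = coef (\<lambda>z. z * (cnj (i z) * k z) - c) n"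
    proof (rule coef_cong_AE)
      show "AE z in circle. cnj (i z) * s z = z * (cnj (i z) * k z) - c"
        using i_cnj
      proof eventually_elim
        case (elim z)
        have "cnj (i z) * s z = z * (cnj (i z) * k z) - c * (i z * cnj (i z))" by (simp add: s_def algebra_simps)
        then show ?case using elim by simp
      qed
    qed simp_all
    also have "\<dots> = coef (\<lambda>z. z * (cnj (i z) * k z)) n - coef (\<lambda>z. c) n"
    proof (rule coef_diff)
      show "integrable circle (\<lambda>z. z * (cnj (i z) * k z))"
        using integrable_mult_powi[OF integrable_cnj_i_mult[OF model_int[OF k]], of 1] by (simp add: mult_ac)
    qed simp
    also have "\<dots> = 0"
      using k that by (cases "n = 0") (simp_all add: coef_mult_z coef_const c_def model_def)
    finally show ?thesis .
  qed
  ultimately have m: "model p i s" by (simp add: model_def)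
  have "model_proj p (mk i) (mk (\<lambda>z. z * k z)) = mk s"
    by (rule model_proj_eq[OF m hardy_const[of p c]]) (use p in \<open>simp_all add: s_def\<close>)
  then have "compressed_shift p (mk i) (mk k) = mk s"
    by (simp add: compressed_shift_def id_fun.abs_eq times_circle_fun.abs_eq)
  then show ?thesis using m unfolding s_def by blast
qed

text \<open>The projection of the constant 1: conj(i) has no coefficients of positive index, and the
  one of index 0 is removed.\<close>

lemma model_one: "model p i (\<lambda>z. 1 - cnj (coef i 0) * i z)"
proof -
  define s where "s = (\<lambda>z. 1 - cnj (coef i 0) * i z)"
  have [measurable]: "s \<in> borel_measurable borel" unfolding s_def by measurable
  have "hardy p s" unfolding s_def using p hardy_i by (intro hardy_diff hardy_const hardy_cmult) simp_all
  moreover have "coef (\<lambda>z. cnj (i z) * s z) n = 0" if "n \<ge> 0" for n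
  proof -
    have "coef (\<lambda>z. cnj (i z) * s z) n = coef (\<lambda>z. cnj (i z) - cnj (coef i 0)) n"
    proof (rule coef_cong_AE)
      show "AE z in circle. cnj (i z) * s z = cnj (i z) - cnj (coef i 0)"
        using i_cnj
      proof eventually_elim
        case (elim z)
        have "cnj (i z) * s z = cnj (i z) - cnj (coef i 0) * (i z * cnj (i z))" by (simp add: s_def algebra_simps)
        then show ?case using elim by simp
      qed
    qed simp_all
    also have "\<dots> = cnj (coef i (- n)) - (if n = 0 then cnj (coef i 0) else 0)"
      using i_int by (simp add: coef_diff coef_cnj coef_const)
    also have "\<dots> = 0" using coef_i[of "- n"] that by auto
    finally show ?thesis .
  qed
  ultimately show ?thesis by (simp add: model_def s_def)
qed

text \<open>Boundedness of the projection P_I, for functions whose component in I H^p is I times a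
  polynomial \<open>v\<close>: the analytic part of conj(i) f is v, so \<open>Riesz_Lp\<close>
  bounds it, and with it k = f - i v.\<close>

lemma model_Riesz:
  shows "\<exists>C\<ge>0. \<forall>f k v. f \<in> borel_measurable borel \<longrightarrow> integrable circle (\<lambda>z. norm (f z) powr p) \<longrightarrow>
    model p i k \<longrightarrow> (AE z in circle. f z = k z + i z * poly v z) \<longrightarrow>
    (LINT z|circle. norm (k z) powr p) \<le> C * (LINT z|circle. norm (f z) powr p)"
proof -
  obtain C where C: "C \<ge> 0" and Riesz: "\<And>b v. b \<in> borel_measurable borel \<Longrightarrow>
     integrable circle (\<lambda>z. norm (b z) powr p) \<Longrightarrow> (\<And>n. coef b (int n) = coeff v n) \<Longrightarrow>
    (LINT z|circle. norm (poly v z) powr p) \<le> C * (LINT z|circle. norm (b z) powr p)"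
    using Riesz_Lp[OF p] by auto
  define D where "D = 2 powr p * (1 + C)"
  have "(LINT z|circle. norm (k z) powr p) \<le> D * (LINT z|circle. norm (f z) powr p)"
    if [measurable]: "f \<in> borel_measurable borel" and fp: "integrable circle (\<lambda>z. norm (f z) powr p)"
      and k: "model p i k" and eq: "AE z in circle. f z = k z + i z * poly v z" for f k v
  proof -
    have [measurable]: "k \<in> borel_measurable borel" by (rule model_meas[OF k])
    define b where "b = (\<lambda>z. cnj (i z) * f z)"
    have [measurable]: "b \<in> borel_measurable borel" unfolding b_def by measurable
    have nb: "AE z in circle. norm (f z) = norm (b z)"
      using norm_cnj_i_mult[of f] by eventually_elim (simp add: b_def)
    have bp: "integrable circle (\<lambda>z. norm (b z) powr p)"
      by (rule integrable_powr_cong[OF _ _ nb fp]) simp_all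
    have "coef b (int n) = coeff v n" for n
    proof -
      have "coef b (int n) = coef (\<lambda>z. cnj (i z) * k z + poly v z) (int n)"
      proof (rule coef_cong_AE)
        show "AE z in circle. b z = cnj (i z) * k z + poly v z"
          using eq i_cnj
        proof eventually_elim
          case (elim z)
          have "b z = cnj (i z) * k z + (i z * cnj (i z)) * poly v z" by (simp add: b_def elim(1) algebra_simps)
          then show ?case using elim(2) by simp
        qed
      qed simp_all
      also have "\<dots> = coef (\<lambda>z. cnj (i z) * k z) (int n) + coef (poly v) (int n)"
        using integrable_cnj_i_mult[OF model_int[OF k]] by (intro coef_add) simp_all
      finally show ?thesis using k by (simp add: model_def coef_poly)
    qed
    from Riesz[OF _ bp this] have v: "(LINT z|circle. norm (poly v z) powr p) \<le> C * (LINT z|circle. norm (f z) powr p)"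
      using integral_powr_cong[OF _ _ nb] by simp
    have "(LINT z|circle. norm (k z) powr p) = (LINT z|circle. norm (f z - i z * poly v z) powr p)"
    proof (rule integral_powr_cong)
      show "AE z in circle. norm (k z) = norm (f z - i z * poly v z)"
        using eq by eventually_elim simp
    qed simp_all
    also have "\<dots> \<le> 2 powr p * ((LINT z|circle. norm (f z) powr p) + (LINT z|circle. norm (i z * poly v z) powr p))"
    proof (rule integral_powr_diff_le)
      have "AE z in circle. norm (poly v z) = norm (i z * poly v z)"
        using norm_i_mult[of "poly v"] by eventually_elim simp
      then show "integrable circle (\<lambda>z. norm (i z * poly v z) powr p)"
        by (rule integrable_powr_cong[rotated 2]) (use p in simp_all)
    qed (use p fp in simp_all)
    also have "(LINT z|circle. norm (i z * poly v z) powr p) = (LINT z|circle. norm (poly v z) powr p)"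
      by (rule integral_powr_cong[OF _ _ norm_i_mult]) simp_all
    also have "2 powr p * ((LINT z|circle. norm (f z) powr p) + (LINT z|circle. norm (poly v z) powr p)) \<le>
        2 powr p * ((LINT z|circle. norm (f z) powr p) + C * (LINT z|circle. norm (f z) powr p))"
      using v by simp
    also have "\<dots> = D * (LINT z|circle. norm (f z) powr p)" by (simp add: D_def algebra_simps)
    finally show ?thesis .
  qed
  moreover have "D \<ge> 0" using C by (simp add: D_def)
  ultimately show ?thesis by (intro exI[of _ D] conjI allI impI)
qed

end

section \<open>Operators commuting with the compressed shift\<close>

lemma scale_fun_mk: "f \<in> borel_measurable borel \<Longrightarrow> scale_fun c (mk f) = mk (\<lambda>z. c * f z)"
  by (simp add: scale_fun.abs_eq)

lemma add_mk: "f \<in> borel_measurable borel \<Longrightarrow> g \<in> borel_measurable borel \<Longrightarrow> mk f + mk g = mk (\<lambda>z. f z + g z)"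
  by (simp add: plus_circle_fun.abs_eq)

locale commutant = inner_setting +
  fixes T :: "circle_fun \<Rightarrow> circle_fun"
  assumes T: "bounded_linear_op_on p (model_space p (mk i)) T"
    and commute: "\<forall>f\<in>model_space p (mk i). T (compressed_shift p (mk i) f) = compressed_shift p (mk i) (T f)"
begin

text \<open>\<open>T\<close> acts on classes. As a relation between representatives, its graph can
  be handled by pointwise formulas without choosing a representative for each image.\<close>

definition maps_to :: "(complex \<Rightarrow> complex) \<Rightarrow> (complex \<Rightarrow> complex) \<Rightarrow> bool" where
  "maps_to f g \<longleftrightarrow> model p i f \<and> model p i g \<and> T (mk f) = mk g"

lemma maps_to_exists:
  assumes f: "model p i f"
  shows "\<exists>g. maps_to f g"
proof -
  have fK: "mk f \<in> model_space p (mk i)" using f by (simp add: mk_in_model_space_iff model_meas)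
  obtain g where g: "T (mk f) = mk g" "g \<in> borel_measurable borel" by (rule mk_cases)
  have "T (mk f) \<in> model_space p (mk i)" using T fK by (simp add: bounded_linear_op_on_def)
  then have "model p i g" using g by (simp add: mk_in_model_space_iff)
  then show ?thesis using f g by (auto simp: maps_to_def)
qed

lemma maps_to_add:
  assumes "maps_to f g" "maps_to f' g'"
  shows "maps_to (\<lambda>z. f z + f' z) (\<lambda>z. g z + g' z)"
proof -
  have m: "model p i f" "model p i g" "model p i f'" "model p i g'" and t: "T (mk f) = mk g" "T (mk f') = mk g'"
    using assms by (simp_all add: maps_to_def)
  have "T (mk f + mk f') = T (mk f) + T (mk f')"
    using T m(1,3) by (simp add: bounded_linear_op_on_def mk_in_model_space_iff model_meas)
  then show ?thesis using m t by (simp add: maps_to_def model_add add_mk model_meas)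
qed

lemma maps_to_cmult:
  assumes "maps_to f g"
  shows "maps_to (\<lambda>z. c * f z) (\<lambda>z. c * g z)"
proof -
  have m: "model p i f" "model p i g" and t: "T (mk f) = mk g"
    using assms by (simp_all add: maps_to_def)
  have "T (scale_fun c (mk f)) = scale_fun c (T (mk f))"
    using T m(1) by (simp add: bounded_linear_op_on_def mk_in_model_space_iff model_meas)
  then show ?thesis using m t by (simp add: maps_to_def model_cmult scale_fun_mk model_meas)
qed

lemma maps_to_shift:
  assumes "maps_to f g"
  shows "\<exists>c d. maps_to (\<lambda>z. z * f z - c * i z) (\<lambda>z. z * g z - d * i z)"
proof -
  have m: "model p i f" "model p i g" and t: "T (mk f) = mk g"
    using assms by (simp_all add: maps_to_def)
  obtain c where c: "model p i (\<lambda>z. z * f z - c * i z)" "compressed_shift p (mk i) (mk f) = mk (\<lambda>z. z * f z - c * i z)"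
    using shift_model[OF m(1)] by auto
  obtain d where d: "model p i (\<lambda>z. z * g z - d * i z)" "compressed_shift p (mk i) (mk g) = mk (\<lambda>z. z * g z - d * i z)"
    using shift_model[OF m(2)] by auto
  have "T (compressed_shift p (mk i) (mk f)) = compressed_shift p (mk i) (T (mk f))"
    using commute m(1) by (simp add: mk_in_model_space_iff model_meas)
  then show ?thesis using c d t by (auto simp: maps_to_def)
qed

lemma maps_to_bound:
  "\<exists>D\<ge>0. \<forall>f g. maps_to f g \<longrightarrow> (LINT z|circle. norm (g z) powr p) \<le> D * (LINT z|circle. norm (f z) powr p)"
proof -
  obtain C where C: "\<forall>f\<in>model_space p (mk i). Lp_norm p (T f) \<le> C * Lp_norm p f"
    using T unfolding bounded_linear_op_on_def by (elim conjE exE)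
  have "(LINT z|circle. norm (g z) powr p) \<le> \<bar>C\<bar> powr p * (LINT z|circle. norm (f z) powr p)" if "maps_to f g" for f g
  proof -
    have m: "model p i f" "model p i g" and t: "T (mk f) = mk g" using that by (simp_all add: maps_to_def)
    define X where "X = (LINT z|circle. norm (f z) powr p)"
    define Y where "Y = (LINT z|circle. norm (g z) powr p)"
    have XY: "X \<ge> 0" "Y \<ge> 0" by (simp_all add: X_def Y_def)
    have "Y powr (1 / p) \<le> C * X powr (1 / p)"
      using C[rule_format, of "mk f"] m t by (simp add: mk_in_model_space_iff model_meas Lp_norm.abs_eq X_def Y_def)
    \<comment> \<open>The constant in the boundedness hypothesis may be negative.\<close>
    also have "\<dots> \<le> \<bar>C\<bar> * X powr (1 / p)" by (intro mult_right_mono) simp_all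
    finally have "(Y powr (1 / p)) powr p \<le> (\<bar>C\<bar> * X powr (1 / p)) powr p"
      using p by (intro powr_mono2) simp_all
    then show ?thesis using p XY by (simp add: powr_powr powr_mult X_def Y_def)
  qed
  then show ?thesis by (intro exI[of _ "\<bar>C\<bar> powr p"]) simp
qed

text \<open>\<open>k\<close> is the projection of the polynomial \<open>u\<close>; the constant \<open>1\<close> projects to
  \<open>1 - cnj (coef i 0) * i\<close>, whose image under \<open>T\<close> is \<open>\<psi>\<close>.\<close>

lemma maps_to_poly:
  assumes \<psi>: "maps_to (\<lambda>z. 1 - cnj (coef i 0) * i z) \<psi>"
  shows "\<exists>k v h t. maps_to k t \<and> hardy p h \<and> (\<forall>z. k z = poly u z - i z * poly v z) \<and>
    (\<forall>z. t z = \<psi> z * poly u z - i z * h z)"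
proof (induction u)
  case 0
  show ?case
  proof (rule exI[of _ "\<lambda>z. 0 * (1 - cnj (coef i 0) * i z)"], rule exI[of _ 0], rule exI[of _ "\<lambda>_. 0"],
      rule exI[of _ "\<lambda>z. 0 * \<psi> z"], intro conjI allI)
    show "maps_to (\<lambda>z. 0 * (1 - cnj (coef i 0) * i z)) (\<lambda>z. 0 * \<psi> z)" by (rule maps_to_cmult[OF \<psi>])
    show "hardy p (\<lambda>_. 0)" using p by (intro hardy_const) simp
  qed simp_all
next
  case (pCons a u)
  obtain k v h t where IH: "maps_to k t" "hardy p h" "\<And>z. k z = poly u z - i z * poly v z"
    "\<And>z. t z = \<psi> z * poly u z - i z * h z" using pCons.IH by auto
  obtain c d where cd: "maps_to (\<lambda>z. z * k z - c * i z) (\<lambda>z. z * t z - d * i z)"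
    using maps_to_shift[OF IH(1)] by auto
  show ?case
  \<comment> \<open>The new polynomial is a + z u. The constant \<open>a\<close> contributes
    \<open>a * \<psi>\<close> to the image, and all multiples of \<open>i\<close> produced by it and
    by the shift are collected in the constant terms of the new \<open>v\<close> and
    \<open>h\<close>.\<close>
  proof (rule exI[of _ "\<lambda>z. a * (1 - cnj (coef i 0) * i z) + (z * k z - c * i z)"],
      rule exI[of _ "pCons (a * cnj (coef i 0) + c) v"], rule exI[of _ "\<lambda>z. z * h z + d"],
      rule exI[of _ "\<lambda>z. a * \<psi> z + (z * t z - d * i z)"], intro conjI allI)
    show "maps_to (\<lambda>z. a * (1 - cnj (coef i 0) * i z) + (z * k z - c * i z)) (\<lambda>z. a * \<psi> z + (z * t z - d * i z))"
      by (rule maps_to_add[OF maps_to_cmult[OF \<psi>] cd])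
    show "hardy p (\<lambda>z. z * h z + d)"
      using p IH(2) by (intro hardy_add hardy_mult_z hardy_const) simp_all
    show "a * (1 - cnj (coef i 0) * i z) + (z * k z - c * i z) = poly (pCons a u) z - i z * poly (pCons (a * cnj (coef i 0) + c) v) z" for z
      by (simp add: IH(3) algebra_simps)
    show "a * \<psi> z + (z * t z - d * i z) = \<psi> z * poly (pCons a u) z - i z * (z * h z + d)" for z
      by (simp add: IH(4) algebra_simps)
  qed
qed

text \<open>Since the image of the projection of u is t = psi u - i h, the integrand conj(i) psi u y
  equals conj(i) t y + h y, where h y has mean 0 because y vanishes at 0. Young's inequality,
  boundedness of \<open>T\<close> and \<open>model_Riesz\<close> then give the additive bound that
  \<open>bilinear_bound_imp_L1_bound\<close> requires.\<close>

lemma symbol_bound: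
  assumes \<psi>: "maps_to (\<lambda>z. 1 - cnj (coef i 0) * i z) \<psi>"
  shows "\<exists>C>0. \<forall>F. poly F 0 = 0 \<longrightarrow>
    norm (LINT z|circle. (cnj (i z) * \<psi> z) * poly F z) \<le> C * (LINT z|circle. norm (poly F z))"
proof -
  obtain D where D: "D \<ge> 0" and Tb: "\<And>f g. maps_to f g \<Longrightarrow> (LINT z|circle. norm (g z) powr p) \<le> D * (LINT z|circle. norm (f z) powr p)"
    using maps_to_bound by auto
  obtain R where R: "R \<ge> 0" and Rb: "\<And>f k v. f \<in> borel_measurable borel \<Longrightarrow> integrable circle (\<lambda>z. norm (f z) powr p) \<Longrightarrow>
    model p i k \<Longrightarrow> (AE z in circle. f z = k z + i z * poly v z) \<Longrightarrow>
    (LINT z|circle. norm (k z) powr p) \<le> R * (LINT z|circle. norm (f z) powr p)"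
    using model_Riesz by auto
  define q where "q = p / (p - 1)"
  have q: "q > 1" "1 / p + 1 / q = 1" using p by (auto simp: q_def field_simps)
  have m\<psi>: "model p i \<psi>" using \<psi> by (simp add: maps_to_def)
  have g: "integrable circle (\<lambda>z. cnj (i z) * \<psi> z)"
    by (intro integrable_cnj_i_mult model_int m\<psi>)
  have DR: "D * R \<ge> 0" using D R by simp
  have "norm (LINT z|circle. (cnj (i z) * \<psi> z) * (poly u z * poly y z)) \<le>
      (D * R) * (LINT z|circle. norm (poly u z) powr p) + (LINT z|circle. norm (poly y z) powr q)"
    if y0: "poly y 0 = 0" for u y
  proof -
    obtain k v h t where k: "maps_to k t" "hardy p h" "\<And>z. k z = poly u z - i z * poly v z"
      "\<And>z. t z = \<psi> z * poly u z - i z * h z" using maps_to_poly[OF \<psi>, of u] by auto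
    have mk: "model p i k" "model p i t" using k(1) by (simp_all add: maps_to_def)
    have [measurable]: "t \<in> borel_measurable borel" "h \<in> borel_measurable borel" "\<psi> \<in> borel_measurable borel"
      using mk m\<psi> k(2) by (simp_all add: model_meas hardy_def)
    have tp: "integrable circle (\<lambda>z. norm (t z) powr p)" using mk by (simp add: model_def hardy_def)
    have hi: "integrable circle h" using k(2) p by (intro hardy_integrable) auto
    obtain B where B: "AE z in circle. norm (poly y z) \<le> B" using AE_bounded_poly[of y] ..
    have ti: "integrable circle (\<lambda>z. (cnj (i z) * t z) * poly y z)"
      by (rule integrable_circle_mult_bounded[OF integrable_cnj_i_mult[OF model_int[OF mk(2)]] _ B]) simp
    have yh: "integrable circle (\<lambda>z. poly y z * h z)" "(LINT z|circle. poly y z * h z) = 0"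
    proof -
      have c: "\<And>n. n < 0 \<Longrightarrow> coef h n = 0" using k(2) by (simp add: hardy_def)
      show "integrable circle (\<lambda>z. poly y z * h z)" by (rule coef_poly_mult(1)[OF hi c])
      show "(LINT z|circle. poly y z * h z) = 0"
        using coef_poly_mult(3)[OF hi c, of y] y0 by (simp add: coef_def poly_0_coeff_0)
    qed
    have "(LINT z|circle. (cnj (i z) * \<psi> z) * (poly u z * poly y z)) =
        (LINT z|circle. (cnj (i z) * t z) * poly y z + poly y z * h z)"
    proof (rule integral_cong_AE)
      show "AE z in circle. (cnj (i z) * \<psi> z) * (poly u z * poly y z) = (cnj (i z) * t z) * poly y z + poly y z * h z"
        using i_cnj
      proof eventually_elim
        case (elim z)
        have "(cnj (i z) * t z) * poly y z = (cnj (i z) * \<psi> z) * (poly u z * poly y z) - (i z * cnj (i z)) * (poly y z * h z)"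
          by (simp add: k(4) algebra_simps)
        then show ?case using elim by simp
      qed
    qed simp_all
    also have "\<dots> = (LINT z|circle. (cnj (i z) * t z) * poly y z)" using ti yh by simp
    finally have "norm (LINT z|circle. (cnj (i z) * \<psi> z) * (poly u z * poly y z)) \<le> (LINT z|circle. norm ((cnj (i z) * t z) * poly y z))"
      using integral_norm_bound by simp
    also have "\<dots> \<le> (LINT z|circle. norm (t z) powr p + norm (poly y z) powr q)"
    proof (rule integral_mono_AE)
      show "AE z in circle. norm ((cnj (i z) * t z) * poly y z) \<le> norm (t z) powr p + norm (poly y z) powr q"
        using norm_cnj_i_mult[of t]
      proof eventually_elim
        case (elim z)
        have "norm ((cnj (i z) * t z) * poly y z) = norm (t z) * norm (poly y z)" using elim by (simp add: norm_mult)
        also have "\<dots> \<le> norm (t z) powr p / p + norm (poly y z) powr q / q"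
          using p q by (intro Youngs_inequality) simp_all
        also have "\<dots> \<le> norm (t z) powr p / 1 + norm (poly y z) powr q / 1"
          using p q by (intro add_mono divide_left_mono) simp_all
        finally show ?case by simp
      qed
    qed (use ti tp q in simp_all)
    also have "\<dots> = (LINT z|circle. norm (t z) powr p) + (LINT z|circle. norm (poly y z) powr q)"
      using tp q by simp
    also have "(LINT z|circle. norm (t z) powr p) \<le> D * (R * (LINT z|circle. norm (poly u z) powr p))"
    proof (rule order_trans[OF Tb[OF k(1)] mult_left_mono[OF Rb D]])
      show "AE z in circle. poly u z = k z + i z * poly v z" by (simp add: k(3))
    qed (use p mk in simp_all)
    finally show ?thesis by (simp add: mult.assoc)
  qed
  from bilinear_bound_imp_L1_bound[OF p q(1,2) g DR this] have
    "norm (LINT z|circle. (cnj (i z) * \<psi> z) * poly F z) \<le> (D * R + 1) * (LINT z|circle. norm (poly F z))"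
    if "poly F 0 = 0" for F using that by blast
  then show ?thesis using DR by (intro exI[of _ "D * R + 1"]) simp
qed

text \<open>By \<open>model_proj_eq\<close>, T f is the compression of f as soon as conj(i) (phi f -
  T f) lies in H^p. For projections of polynomials the negative coefficients of this function vanish
  by the choice of phi, and each of them depends continuously on f in L^p.\<close>

theorem symbol_exists:
  "\<exists>\<phi>\<in>Hinf. \<forall>f\<in>model_space p (mk i). T f = compression p (mk i) \<phi> f"
proof -
  obtain \<psi> where \<psi>: "maps_to (\<lambda>z. 1 - cnj (coef i 0) * i z) \<psi>"
    using maps_to_exists[OF model_one] by auto
  have m\<psi>: "model p i \<psi>" using \<psi> by (simp add: maps_to_def)
  have [measurable]: "\<psi> \<in> borel_measurable borel" by (rule model_meas[OF m\<psi>])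
  have g: "integrable circle (\<lambda>z. cnj (i z) * \<psi> z)"
    by (intro integrable_cnj_i_mult model_int m\<psi>)
  obtain C where C: "C > 0" and Cb: "\<And>F. poly F 0 = 0 \<Longrightarrow>
    norm (LINT z|circle. (cnj (i z) * \<psi> z) * poly F z) \<le> C * (LINT z|circle. norm (poly F z))"
    using symbol_bound[OF \<psi>] by auto
  obtain X where [measurable]: "X \<in> borel_measurable borel" and XC: "AE z in circle. norm (X z) \<le> C"
    and Xc: "\<And>n. n < 0 \<Longrightarrow> coef X n = coef (\<lambda>z. cnj (i z) * \<psi> z) n"
    using bounded_extension[OF g C Cb] by auto
  define \<phi> where "\<phi> = (\<lambda>z. i z * X z)"
  have [measurable]: "\<phi> \<in> borel_measurable borel" unfolding \<phi>_def by measurable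
  have \<phi>C: "AE z in circle. norm (\<phi> z) \<le> C"
    using XC norm_i_mult[of X] by eventually_elim (simp add: \<phi>_def)
  have Xi: "integrable circle X" by (rule integrable_circle_bounded[OF _ XC]) simp
  have \<phi>i: "integrable circle \<phi>" by (rule integrable_circle_bounded[OF _ \<phi>C]) simp
  \<comment> \<open>\<open>X\<close> matches the negative coefficients of conj(i) psi, so
    \<open>h0\<close> has none; then neither has phi = psi - i h0.\<close>
  define h0 where "h0 = (\<lambda>z. cnj (i z) * \<psi> z - X z)"
  have [measurable]: "h0 \<in> borel_measurable borel" unfolding h0_def by measurable
  have h0i: "integrable circle h0" unfolding h0_def using g Xi by simp
  have h0c: "coef h0 n = 0" if "n < 0" for n
    unfolding h0_def using coef_diff[OF g Xi] Xc[OF that] by simp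
  have \<phi>_eq: "AE z in circle. \<phi> z = \<psi> z - i z * h0 z"
    using i_cnj
  proof eventually_elim
    case (elim z)
    have "\<psi> z - i z * h0 z = \<psi> z - (i z * cnj (i z)) * \<psi> z + \<phi> z" by (simp add: h0_def \<phi>_def algebra_simps)
    then show ?case using elim by simp
  qed
  have ih0: "integrable circle (\<lambda>z. i z * h0 z)"
  proof -
    have "AE z in circle. norm (i z) \<le> 1" using i_norm by eventually_elim simp
    from integrable_circle_mult_bounded[OF h0i _ this] show ?thesis by (simp add: mult.commute)
  qed
  have \<phi>c: "coef \<phi> n = 0" if "n < 0" for n
  proof -
    have "coef \<phi> n = coef (\<lambda>z. \<psi> z - i z * h0 z) n" by (rule coef_cong_AE[OF _ _ \<phi>_eq]) simp_all
    also have "\<dots> = coef \<psi> n - coef (\<lambda>z. i z * h0 z) n" by (intro coef_diff model_int m\<psi> ih0)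
    also have "\<dots> = 0" using coef_i_mult[OF h0i h0c that] m\<psi> that by (simp add: model_def hardy_def)
    finally show ?thesis .
  qed
  obtain D where D: "D \<ge> 0" and Tb: "\<And>f g. maps_to f g \<Longrightarrow> (LINT z|circle. norm (g z) powr p) \<le> D * (LINT z|circle. norm (f z) powr p)"
    using maps_to_bound by auto
  obtain R where R: "R \<ge> 0" and Rb: "\<And>f k v. f \<in> borel_measurable borel \<Longrightarrow> integrable circle (\<lambda>z. norm (f z) powr p) \<Longrightarrow>
    model p i k \<Longrightarrow> (AE z in circle. f z = k z + i z * poly v z) \<Longrightarrow>
    (LINT z|circle. norm (k z) powr p) \<le> R * (LINT z|circle. norm (f z) powr p)"
    using model_Riesz by auto
  have \<phi>int: "integrable circle (\<lambda>z. norm (\<phi> z * x z) powr p)"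
    "(LINT z|circle. norm (\<phi> z * x z) powr p) \<le> C powr p * (LINT z|circle. norm (x z) powr p)"
    if [measurable]: "x \<in> borel_measurable borel" and xp: "integrable circle (\<lambda>z. norm (x z) powr p)" for x
  proof -
    have le: "AE z in circle. norm (\<phi> z * x z) powr p \<le> C powr p * norm (x z) powr p"
      using \<phi>C
    proof eventually_elim
      case (elim z)
      have "norm (\<phi> z * x z) powr p \<le> (C * norm (x z)) powr p"
        unfolding norm_mult using elim p by (intro powr_mono2 mult_right_mono) simp_all
      then show ?case by (simp only: powr_mult)
    qed
    have i1: "integrable circle (\<lambda>z. C powr p * norm (x z) powr p)" using xp by simp
    show i2: "integrable circle (\<lambda>z. norm (\<phi> z * x z) powr p)"
      by (rule Bochner_Integration.integrable_bound[OF i1]) (use le in \<open>auto elim!: eventually_mono\<close>)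
    show "(LINT z|circle. norm (\<phi> z * x z) powr p) \<le> C powr p * (LINT z|circle. norm (x z) powr p)"
      using integral_mono_AE[OF i2 i1 le] by simp
  qed
  \<comment> \<open>If phi x = y + i h, then this is h; the aim is that it has no negative
    coefficients whenever \<open>T\<close> maps x to y.\<close>
  define err where "err x y = (\<lambda>z. cnj (i z) * (\<phi> z * x z - y z))" for x y
  have "T (mk f) = compression p (mk i) (mk \<phi>) (mk f)" if f: "model p i f" for f
  proof -
    obtain t where ft: "maps_to f t" using maps_to_exists[OF f] by auto
    have mt: "model p i t" using ft by (simp add: maps_to_def)
    have [measurable]: "f \<in> borel_measurable borel" "t \<in> borel_measurable borel"
      by (rule model_meas[OF f], rule model_meas[OF mt])
    have fp: "integrable circle (\<lambda>z. norm (f z) powr p)" and tp: "integrable circle (\<lambda>z. norm (t z) powr p)"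
      using f mt by (simp_all add: model_def hardy_def)
    have [measurable]: "err f t \<in> borel_measurable borel" unfolding err_def by measurable
    have errp: "integrable circle (\<lambda>z. norm (err f t z) powr p)"
    proof (rule integrable_powr_cong)
      show "AE z in circle. norm (\<phi> z * f z - t z) = norm (err f t z)"
        using norm_cnj_i_mult[of "\<lambda>z. \<phi> z * f z - t z"] by eventually_elim (simp add: err_def)
      show "integrable circle (\<lambda>z. norm (\<phi> z * f z - t z) powr p)"
        using p fp tp by (intro integrable_powr_diff \<phi>int(1)) simp_all
    qed simp_all
    have erri: "integrable circle (err f t)" using p by (intro integrable_of_powr[OF _ _ errp]) simp_all
    \<comment> \<open>The price of the estimate that follows: passing from f - u to its projection
      costs \<open>R\<close>, multiplication by phi costs C^p, \<open>T\<close> costs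
      \<open>D\<close>, and adding the two contributions costs 2^p.\<close>
    define Q where "Q = 2 powr p * (C powr p * R + D * R)"
    have Q: "Q \<ge> 0" using D R by (simp add: Q_def)
    have "coef (err f t) n = 0" if n: "n < 0" for n
    proof -
      \<comment> \<open>\<open>err\<close> is linear in the pair, and its negative coefficients
        vanish on the pair (k, s) that belongs to a polynomial \<open>u\<close> near
        \<open>f\<close>. So only the pair of differences (x, y) contributes, and it is small in
        L^p.\<close>
      have small: "norm (coef (err f t) n) powr p \<le> 0 + Q * e" if "e > 0" for e
      proof -
        obtain u where u: "(LINT z|circle. norm (f z - poly u z) powr p) \<le> e"
          using hardy_poly_approx[OF p _ \<open>e > 0\<close>, of f] f by (auto simp: model_def)
        obtain k v h s where k: "maps_to k s" "hardy p h" "\<And>z. k z = poly u z - i z * poly v z"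
          "\<And>z. s z = \<psi> z * poly u z - i z * h z" using maps_to_poly[OF \<psi>, of u] by auto
        have mks: "model p i k" "model p i s" using k(1) by (simp_all add: maps_to_def)
        have [measurable]: "k \<in> borel_measurable borel" "s \<in> borel_measurable borel" "h \<in> borel_measurable borel"
          using k(2) by (simp_all add: model_meas[OF mks(1)] model_meas[OF mks(2)] hardy_def)
        define x where "x = (\<lambda>z. f z + (- 1) * k z)"
        define y where "y = (\<lambda>z. t z + (- 1) * s z)"
        have xy: "maps_to x y" unfolding x_def y_def by (intro maps_to_add maps_to_cmult ft k(1))
        then have mxy: "model p i x" "model p i y" by (simp_all add: maps_to_def)
        have [measurable]: "x \<in> borel_measurable borel" "y \<in> borel_measurable borel"
          by (rule model_meas[OF mxy(1)], rule model_meas[OF mxy(2)])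
        have xp: "integrable circle (\<lambda>z. norm (x z) powr p)" and yp: "integrable circle (\<lambda>z. norm (y z) powr p)"
          using mxy by (simp_all add: model_def hardy_def)
        have Nx: "(LINT z|circle. norm (x z) powr p) \<le> R * e"
        \<comment> \<open>From k = u - i v follows f - u = x + i (-v), so x is the projection of f -
          u.\<close>
        proof (rule order_trans[OF Rb[of "\<lambda>z. f z - poly u z" x "- v"] mult_left_mono[OF u R]])
          show "integrable circle (\<lambda>z. norm (f z - poly u z) powr p)"
            using p fp by (intro integrable_powr_diff) simp_all
          show "AE z in circle. f z - poly u z = x z + i z * poly (- v) z"
            by (simp add: x_def k(3) algebra_simps)
        qed (use mxy in simp_all)
        have Ny: "(LINT z|circle. norm (y z) powr p) \<le> D * (R * e)"
          by (rule order_trans[OF Tb[OF xy] mult_left_mono[OF Nx D]])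
        \<comment> \<open>For the pair of a polynomial, \<open>err k s\<close> is h - u h0 - v phi,
          a combination of functions without negative coefficients.\<close>
        have zero: "coef (err k s) n = 0"
        proof -
          have "coef (err k s) n = coef (\<lambda>z. (h z - poly u z * h0 z) - poly v z * \<phi> z) n"
          proof (rule coef_cong_AE)
            show "AE z in circle. err k s z = (h z - poly u z * h0 z) - poly v z * \<phi> z"
              using \<phi>_eq i_cnj
            proof eventually_elim
              case (elim z)
              have "\<phi> z * k z - s z = \<phi> z * poly u z - \<phi> z * i z * poly v z - \<psi> z * poly u z + i z * h z"
                by (simp add: k(3,4) algebra_simps)
              also have "\<phi> z * poly u z = \<psi> z * poly u z - i z * h0 z * poly u z" by (simp add: elim(1) algebra_simps)
              finally have "\<phi> z * k z - s z = i z * ((h z - poly u z * h0 z) - poly v z * \<phi> z)"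
                by (simp add: algebra_simps)
              then have "err k s z = (i z * cnj (i z)) * ((h z - poly u z * h0 z) - poly v z * \<phi> z)"
                by (simp add: err_def mult_ac)
              then show ?case using elim(2) by simp
            qed
          qed (simp_all add: err_def)
          also have "\<dots> = (coef h n - coef (\<lambda>z. poly u z * h0 z) n) - coef (\<lambda>z. poly v z * \<phi> z) n"
            using hardy_integrable[OF k(2)] p coef_poly_mult(1)[OF h0i h0c, of u] coef_poly_mult(1)[OF \<phi>i \<phi>c, of v]
            by (simp add: coef_diff)
          also have "\<dots> = 0"
            using coef_poly_mult(2)[OF h0i h0c n, of u] coef_poly_mult(2)[OF \<phi>i \<phi>c n, of v] k(2) n
            by (simp add: hardy_def)
          finally show ?thesis .
        qed
        have errxy: "err x y z = err f t z - err k s z" for z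
          by (simp add: err_def x_def y_def algebra_simps)
        have exyp: "integrable circle (\<lambda>z. norm (\<phi> z * x z - y z) powr p)"
          using p xp yp by (intro integrable_powr_diff \<phi>int(1)) simp_all
        \<comment> \<open>The twist by a power of z turns the coefficient into a mean without
          changing moduli on the circle, so Jensen's inequality applies.\<close>
        define w where "w = (\<lambda>z. err x y z * z powi (- n))"
        have [measurable]: "w \<in> borel_measurable borel" unfolding w_def err_def by measurable
        have nw: "AE z in circle. norm (\<phi> z * x z - y z) = norm (w z)"
          using norm_cnj_i_mult[of "\<lambda>z. \<phi> z * x z - y z"] AE_norm_powi[of "- n"]
          by eventually_elim (simp add: w_def err_def norm_mult)
        have wp: "integrable circle (\<lambda>z. norm (w z) powr p)"
          by (rule integrable_powr_cong[OF _ _ nw exyp]) simp_all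
        have eksi: "integrable circle (err k s)"
        proof -
          have "integrable circle (\<lambda>z. k z * \<phi> z)"
            by (rule integrable_circle_mult_bounded[OF model_int[OF mks(1)] _ \<phi>C]) simp
          then have "integrable circle (\<lambda>z. \<phi> z * k z)" by (simp only: mult.commute)
          then show ?thesis
            unfolding err_def by (intro integrable_cnj_i_mult Bochner_Integration.integrable_diff model_int[OF mks(2)])
        qed
        have "coef (err f t) n = coef (\<lambda>z. err f t z - err k s z) n"
          using coef_diff[OF erri eksi, of n] zero by simp
        also have "\<dots> = integral\<^sup>L circle w" by (simp add: coef_def w_def errxy)
        finally have "norm (coef (err f t) n) powr p \<le> (LINT z|circle. norm (w z) powr p)"
          using Jensen_circle[OF p _ wp] by simp
        also have "\<dots> = (LINT z|circle. norm (\<phi> z * x z - y z) powr p)"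
          by (rule integral_powr_cong[OF _ _ nw, symmetric]) simp_all
        also have "\<dots> \<le> 2 powr p * ((LINT z|circle. norm (\<phi> z * x z) powr p) + (LINT z|circle. norm (y z) powr p))"
          using p xp yp by (intro integral_powr_diff_le \<phi>int(1)) simp_all
        also have "\<dots> \<le> 2 powr p * (C powr p * (R * e) + D * (R * e))"
        proof (intro mult_left_mono add_mono Ny)
          show "(LINT z|circle. norm (\<phi> z * x z) powr p) \<le> C powr p * (R * e)"
            by (rule order_trans[OF \<phi>int(2)[OF _ xp] mult_left_mono[OF Nx]]) simp_all
        qed simp
        also have "\<dots> = 0 + Q * e" by (simp add: Q_def algebra_simps)
        finally show ?thesis .
      qed
      have "norm (coef (err f t) n) powr p \<le> 0" by (rule le_add_epsilon_mult[OF Q small])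
      then show ?thesis by simp
    qed
    then have "hardy p (err f t)" using errp by (simp add: hardy_def)
    moreover have "AE z in circle. \<phi> z * f z = t z + i z * err f t z"
      using i_cnj
    proof eventually_elim
      case (elim z)
      have "t z + i z * err f t z = t z + (i z * cnj (i z)) * (\<phi> z * f z - t z)" by (simp add: err_def)
      then show ?case using elim by simp
    qed
    ultimately have "model_proj p (mk i) (mk (\<lambda>z. \<phi> z * f z)) = mk t"
      by (intro model_proj_eq[OF mt]) simp_all
    then show ?thesis using ft
      by (simp add: compression_def maps_to_def times_circle_fun.abs_eq)
  qed
  note main = this
  have "T G = compression p (mk i) (mk \<phi>) G" if G: "G \<in> model_space p (mk i)" for G
  proof -
    obtain f where f: "G = mk f" "f \<in> borel_measurable borel" by (rule mk_cases)
    then show ?thesis using main[of f] G by (simp add: mk_in_model_space_iff)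
  qed
  moreover have "mk \<phi> \<in> Hinf" by (rule mk_in_Hinf[OF _ \<phi>C \<phi>c]) simp_all
  ultimately show ?thesis by (intro bexI[of _ "mk \<phi>"] ballI)
qed

end

theorem theorem4p2:
  fixes p :: real and I :: circle_fun and T :: "circle_fun \<Rightarrow> circle_fun"
  assumes "1 < p"
    and "inner_fun I"
    and "bounded_linear_op_on p (model_space p I) T"
    and "\<forall>f\<in>model_space p I. T (compressed_shift p I f) = compressed_shift p I (T f)"
  shows "\<exists>\<phi>\<in>Hinf. \<forall>f\<in>model_space p I. T f = compression p I \<phi> f"
proof -
  obtain i where i: "I = mk i" "i \<in> borel_measurable borel" by (rule mk_cases)
  obtain F where F: "F holomorphic_on ball 0 1" "bounded (F ` ball 0 1)" "has_boundary_values F I"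
    using assms(2) unfolding inner_fun_def Hinf_def by auto
  obtain B where B: "\<forall>y\<in>F ` ball 0 1. norm y \<le> B" using F(2) unfolding bounded_iff ..
  interpret commutant p i F B T
  proof
    show "AE z in circle. norm (i z) = 1"
      using assms(2) i by (simp add: inner_fun_def unimodular.abs_eq)
    show "AE z in circle. ((\<lambda>r. F (of_real r * z)) \<longlongrightarrow> i z) (at_left (1::real))"
      using F(3) i by (simp add: has_boundary_values.abs_eq)
    show "norm (F w) \<le> B" if "norm w < 1" for w using B that by simp
  qed (use assms i F(1) in simp_all)
  show ?thesis unfolding i(1) by (rule symbol_exists)
qed

end
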